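(* Let $f\in\mathcal{C}(K,\mathfrak{o}_p)$ be such that $0=\lim_{x\to\infty}f(x)=\lim_{x\to\infty}\hat f(x)=f(0)=\hat f(0)$. Let $\tilde\chi:K^\times\to\mathbf{C}_p^\times$ be a continuous character with $\tilde\chi(\pi)=1$, and for any $\lambda\in\mathbf{C}_p^\times$ let $\chi_\lambda:K^\times\to\mathbf{C}_p^\times$ be the unramified character with $\chi_\lambda(\pi)=\lambda$. Then the zeta integral $Z(f,\tilde\chi\chi_\lambda)=\int_K f(x)\tilde\chi\chi_\lambda(x)\,dx$ is a rigid analytic function of $\lambda$ on the Laurent domain $\{\lambda\in\mathbf{C}_p^\times:|\lambda|_p=1\}$, and satisfies a local functional equation (an identity of rigid meromorphic functions of $\lambda$ on this domain) $$\int_K f(x)\tilde\chi\chi_\lambda(x)\,dx=\rho(\tilde\chi\chi_\lambda)\int_K\hat f(x)\tilde\chi^{-1}\chi_{q\lambda^{-1}}(x)\,dx ,$$ where $\lambda\mapsto\rho(\tilde\chi\chi_\lambda)$ is a rigid meromorphic function on $\mathbf{C}_p^\times$ independent of $f$. Moreover, if both $f$ and $\hat f$ are of Schwartz class $c$ for some $c\ge1$, then this functional equation implies that $Z(f,\tilde\chi\chi_\lambda)$ can be meromorphically continued to the annulus $\{\lambda\in\mathbf{C}_p^\times: c^{-1}\le|\lambda|_p\le c\}$.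
   Context: $\ell\neq p$ are primes; $K$ is a finite extension of $\mathbf{Q}_\ell$ with valuation ring $\mathfrak{o}_K$, maximal ideal $\mathfrak{l}=(\pi)$ with fixed uniformizer $\pi$, $q=\#\mathfrak{o}_K/(\pi)$; $\mathfrak{d}=(\pi^\delta)$ is the different of $\mathfrak{o}_K/\mathbf{Z}_\ell$; $\mathrm{tr}:K\to\mathbf{Q}_\ell$ is the trace. $\mathbf{C}_p$ is the completion of an algebraic closure of $\mathbf{Q}_p$, with absolute value $|\cdot|_p$, $|p|_p=1/p$, and ring of integers $\mathfrak{o}_p$. A square root $q^{1/2}\in\mathbf{C}_p$ of $q$ is fixed. $\mathcal{C}(K,\mathfrak{o}_p)$ is the set of continuous functions $K\to\mathfrak{o}_p$. Dissipative functions and integration: a continuous $f:K\to\mathfrak{o}_p$ is dissipative if $\lim_{x\to\infty}f(x)=0$; likewise a $\mathbf{C}_p$-valued dissipative function is a continuous $f:K\to\mathbf{C}_p$ with $\lim_{x\to\infty}f(x)=0$. $dx$ is the linear functional on compactly supported locally constant functions with $dx(\mathbf{1}_{a+\mathfrak{l}^n})=q^{-n-\delta/2}$ ($a\in K$, $n\in\mathbf{Z}$), extended to $\mathbf{C}_p$-valued dissipative functions by continuity for the sup norm; the extension is written $\int_K f(x)\,dx$. Fourier transform: fix $\zeta=(\zeta_n)_{n\ge0}$ with $\zeta_n\in\mathfrak{o}_p$ a primitive $\ell^n$-th root of unity and $\zeta_{n+1}^\ell=\zeta_n$. For $x\in\mathbf{Q}_\ell$, $\zeta^x=\zeta_t^{x\ell^t}$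 if $\mathrm{ord}_\ell(x)=-t<0$ and $\zeta^x=1$ if $x\in\mathbf{Z}_\ell$. For dissipative $f$, $\hat f(\xi)=\int_K f(x)\zeta^{\mathrm{tr}(x\xi)}\,dx$. Characters: a multiplicative character is a continuous homomorphism $\chi:K^\times\to\mathbf{C}_p^\times$; it is unramified if trivial on $\mathfrak{o}_K^\times$; its modulus is $|\chi(\pi)|_p$. Schwartz class: for $c$ a positive real number, a dissipative $f:K\to\mathfrak{o}_p$ is of Schwartz class $c$ if for every multiplicative character $\chi$ of modulus $c$ the limit $\lim_{x\to0}f(x)\chi(x)$ exists and, with $f\chi(0)$ defined to be this limit, the resulting function $f\chi$ on $K$ is ($\mathbf{C}_p$-valued) dissipative. In zeta integrals $\int_K f(x)\chi(x)\,dx$ the integrand at $x=0$ is $\lim_{x\to0}f(x)\chi(x)$. A rigid analytic function on a domain $\{\lambda\in\mathbf{C}_p^\times: r\le|\lambda|_p\le s\}$ is one given by a Laurent series in $\lambda$ with $\mathbf{C}_p$-coefficients converging on it; meromorphic functions are locally quotients of analytic ones (by non-zero-divisors).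
   Formalization: In the "moreover" part, c is assumed to be a value of |·|_p on C_p, so that characters of modulus c exist; for other c > 1 "Schwartz class c" holds vacuously for every dissipative function and the continuation claim is false. *)

theory Defs
  imports "HOL-Analysis.Analysis" "HOL-Computational_Algebra.Primes" "HOL-Computational_Algebra.Polynomial"
begin

section \<open>Non-archimedean valued fields\<close>

text \<open>The library reserves \<open>norm\<close> for real normed vector spaces, hence a separate constant for the
  absolute value.\<close>

class nonarch_field = field_char_0 + metric_space +
  fixes vnorm :: "'a \<Rightarrow> real"
  assumes dist_vnorm: "dist x y = vnorm (x - y)"
    and vnorm_mult: "vnorm (x * y) = vnorm x * vnorm y"
    and vnorm_add_le_max: "vnorm (x + y) \<le> max (vnorm x) (vnorm y)"

text \<open>The \<open>l\<close>-adic numbers are the completion of the rationals for the \<open>l\<close>-adic absolute value.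
  A non-archimedean absolute value with \<open>|l| = 1/l\<close> restricts to the \<open>l\<close>-adic one on the
  rationals.\<close>

definition is_padic_numbers :: "nat \<Rightarrow> 'q::nonarch_field itself \<Rightarrow> bool" where
  "is_padic_numbers l (_ :: 'q itself) \<longleftrightarrow>
     vnorm (of_nat l :: 'q) = 1 / real l \<and>
     complete (UNIV :: 'q set) \<and>
     closure \<rat> = (UNIV :: 'q set)"

text \<open>Inside a complete field with \<open>|p| = 1/p\<close>, the field of \<open>p\<close>-adic numbers is the closure of the
  rationals.  The three clauses below say that the elements algebraic over it form an algebraic
  closure, of which the whole type is the completion.\<close>

definition algebraic_over_padic :: "'c::nonarch_field set" where
  "algebraic_over_padic =
     {x. \<exists>P :: 'c poly. P \<noteq> 0 \<and> (\<forall>i. coeff P i \<in> closure \<rat>) \<and> poly P x = 0}"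

definition is_padic_complex_numbers :: "nat \<Rightarrow> 'c::nonarch_field itself \<Rightarrow> bool" where
  "is_padic_complex_numbers p (_ :: 'c itself) \<longleftrightarrow>
     vnorm (of_nat p :: 'c) = 1 / real p \<and>
     complete (UNIV :: 'c set) \<and>
     (\<forall>P :: 'c poly. (\<forall>i. coeff P i \<in> algebraic_over_padic) \<and> degree P > 0 \<longrightarrow>
        (\<exists>x\<in>algebraic_over_padic. poly P x = 0)) \<and>
     closure algebraic_over_padic = (UNIV :: 'c set)"

section \<open>The local field\<close>

text \<open>The absolute value on the extension is the one extending the given one on the base field.\<close>

definition is_finite_extension :: "('q::nonarch_field \<Rightarrow> 'k::nonarch_field) \<Rightarrow> bool" where
  "is_finite_extension \<iota> \<longleftrightarrow>
     \<iota> 1 = 1 \<and> (\<forall>x y. \<iota> (x + y) = \<iota> x + \<iota> y) \<and> (\<forall>x y. \<iota> (x * y) = \<iota> x * \<iota> y) \<and>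
     (\<forall>x. vnorm (\<iota> x) = vnorm x) \<and>
     (\<exists>B. finite B \<and> module.span (\<lambda>a x. \<iota> a * x) B = UNIV)"

definition field_basis :: "('q::nonarch_field \<Rightarrow> 'k::nonarch_field) \<Rightarrow> 'k set" where
  "field_basis \<iota> =
     (SOME B. \<not> module.dependent (\<lambda>a x. \<iota> a * x) B \<and> module.span (\<lambda>a x. \<iota> a * x) B = UNIV)"

text \<open>The trace of the linear map \<open>y \<mapsto> x * y\<close>, read off from its matrix in a basis.\<close>

definition field_trace :: "('q::nonarch_field \<Rightarrow> 'k::nonarch_field) \<Rightarrow> 'k \<Rightarrow> 'q" where
  "field_trace \<iota> x =
     (\<Sum>b\<in>field_basis \<iota>. module.representation (\<lambda>a x. \<iota> a * x) (field_basis \<iota>) (x * b) b)"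

definition valuation_ring :: "'k::nonarch_field set" where
  "valuation_ring = {x. vnorm x \<le> 1}"

definition ideal_pow :: "'k::nonarch_field \<Rightarrow> int \<Rightarrow> 'k set" where
  "ideal_pow \<pi> n = (\<lambda>y. \<pi> powi n * y) ` valuation_ring"

definition is_uniformizer :: "'k::nonarch_field \<Rightarrow> bool" where
  "is_uniformizer \<pi> \<longleftrightarrow> ideal_pow \<pi> 1 = {x. vnorm x < 1}"

definition residue_card :: "'k::nonarch_field \<Rightarrow> nat" where
  "residue_card \<pi> = card ((\<lambda>x. (+) x ` ideal_pow \<pi> 1) ` valuation_ring)"

definition inverse_different :: "('q::nonarch_field \<Rightarrow> 'k::nonarch_field) \<Rightarrow> 'k set" where
  "inverse_different \<iota> = {x. \<forall>y\<in>valuation_ring. field_trace \<iota> (x * y) \<in> valuation_ring}"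

definition different :: "('q::nonarch_field \<Rightarrow> 'k::nonarch_field) \<Rightarrow> 'k set" where
  "different \<iota> = {x. \<forall>y\<in>inverse_different \<iota>. x * y \<in> valuation_ring}"

section \<open>Dissipative functions and integration\<close>

definition at_inf :: "'k::nonarch_field filter" where
  "at_inf = filtercomap vnorm at_top"

definition dissipative :: "('k::nonarch_field \<Rightarrow> 'c::nonarch_field) \<Rightarrow> bool" where
  "dissipative f \<longleftrightarrow> continuous_on UNIV f \<and> (f \<longlongrightarrow> 0) at_inf"

definition test_function :: "('k::nonarch_field \<Rightarrow> 'c::nonarch_field) \<Rightarrow> bool" where
  "test_function g \<longleftrightarrow>
     (\<forall>x. \<exists>U. open U \<and> x \<in> U \<and> (\<forall>y\<in>U. g y = g x)) \<and> compact (closure {x. g x \<noteq> 0})"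

text \<open>Here and below \<open>sq\<close> is the chosen square root of \<open>q\<close>, so that
  \<open>sq powi (- 2 * n - \<delta>)\<close> is \<open>q\<close> to the power \<open>- n - \<delta> / 2\<close>.  Outside the test functions the
  functional is set to 0 only to make it unique.\<close>

definition haar_functional ::
  "'k::nonarch_field \<Rightarrow> nat \<Rightarrow> 'c::nonarch_field \<Rightarrow> ('k \<Rightarrow> 'c) \<Rightarrow> 'c" where
  "haar_functional \<pi> \<delta> sq = (THE D.
     (\<forall>g h. test_function g \<and> test_function h \<longrightarrow> D (\<lambda>x. g x + h x) = D g + D h) \<and>
     (\<forall>a g. test_function g \<longrightarrow> D (\<lambda>x. a * g x) = a * D g) \<and>
     (\<forall>a n. D (indicator ((+) a ` ideal_pow \<pi> n)) = sq powi (- 2 * n - int \<delta>)) \<and>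
     (\<forall>g. \<not> test_function g \<longrightarrow> D g = 0))"

definition integral_K ::
  "'k::nonarch_field \<Rightarrow> nat \<Rightarrow> 'c::nonarch_field \<Rightarrow> ('k \<Rightarrow> 'c) \<Rightarrow> 'c" where
  "integral_K \<pi> \<delta> sq f = (THE I. \<exists>g :: nat \<Rightarrow> 'k \<Rightarrow> 'c.
     (\<forall>n. test_function (g n)) \<and> uniform_limit UNIV g f sequentially \<and>
     (\<lambda>n. haar_functional \<pi> \<delta> sq (g n)) \<longlonglongrightarrow> I)"

section \<open>Fourier transform\<close>

definition is_root_system :: "nat \<Rightarrow> (nat \<Rightarrow> 'c::nonarch_field) \<Rightarrow> bool" where
  "is_root_system l \<zeta> \<longleftrightarrow>
     (\<forall>n. \<zeta> n \<in> valuation_ring \<and> \<zeta> n ^ (l ^ n) = 1 \<and> (\<forall>k. 0 < k \<and> k < l ^ n \<longrightarrow> \<zeta> n ^ k \<noteq> 1) \<and>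
          \<zeta> (Suc n) ^ l = \<zeta> n)"

text \<open>For \<open>x\<close> of order \<open>- t < 0\<close>, the exponent \<open>x * l ^ t\<close> is an \<open>l\<close>-adic integer, and raising the
  \<open>l ^ t\<close>-th root of unity \<open>\<zeta> t\<close> to it means raising it to any natural number \<open>m\<close> congruent to it
  modulo \<open>l ^ t\<close>.\<close>

definition zeta_power ::
  "nat \<Rightarrow> (nat \<Rightarrow> 'c::nonarch_field) \<Rightarrow> 'q::nonarch_field \<Rightarrow> 'c" where
  "zeta_power l \<zeta> x =
     (if x \<in> valuation_ring then 1
      else let t = (THE t :: nat. vnorm x = real l ^ t);
               m = (SOME m :: nat. vnorm (of_nat m - x * of_nat l ^ t) \<le> 1 / real l ^ t)
           in \<zeta> t ^ m)"

definition fourier ::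
  "nat \<Rightarrow> ('q::nonarch_field \<Rightarrow> 'k::nonarch_field) \<Rightarrow> 'k \<Rightarrow> nat \<Rightarrow> 'c::nonarch_field \<Rightarrow> (nat \<Rightarrow> 'c)
     \<Rightarrow> ('k \<Rightarrow> 'c) \<Rightarrow> 'k \<Rightarrow> 'c" where
  "fourier l \<iota> \<pi> \<delta> sq \<zeta> f \<xi> =
     integral_K \<pi> \<delta> sq (\<lambda>x. f x * zeta_power l \<zeta> (field_trace \<iota> (x * \<xi>)))"

section \<open>Multiplicative characters and zeta integrals\<close>

text \<open>A character of the multiplicative group is represented by its extension by 0 to the whole
  field, so that equality of characters is equality of functions, and products and inverses of
  characters are pointwise.\<close>

definition mult_character :: "('k::nonarch_field \<Rightarrow> 'c::nonarch_field) \<Rightarrow> bool" where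
  "mult_character \<psi> \<longleftrightarrow>
     \<psi> 0 = 0 \<and> (\<forall>x. x \<noteq> 0 \<longrightarrow> \<psi> x \<noteq> 0) \<and>
     (\<forall>x y. x \<noteq> 0 \<and> y \<noteq> 0 \<longrightarrow> \<psi> (x * y) = \<psi> x * \<psi> y) \<and>
     continuous_on (UNIV - {0}) \<psi>"

definition unramified :: "('k::nonarch_field \<Rightarrow> 'c::nonarch_field) \<Rightarrow> bool" where
  "unramified \<psi> \<longleftrightarrow> (\<forall>u. vnorm u = 1 \<longrightarrow> \<psi> u = 1)"

definition unram_char :: "'k::nonarch_field \<Rightarrow> 'c::nonarch_field \<Rightarrow> 'k \<Rightarrow> 'c" where
  "unram_char \<pi> w = (THE \<psi>. mult_character \<psi> \<and> unramified \<psi> \<and> \<psi> \<pi> = w)"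

definition twist :: "('k::nonarch_field \<Rightarrow> 'c::nonarch_field) \<Rightarrow> ('k \<Rightarrow> 'c) \<Rightarrow> 'k \<Rightarrow> 'c" where
  "twist f \<psi> x = (if x = 0 then Lim (at 0) (\<lambda>y. f y * \<psi> y) else f x * \<psi> x)"

definition schwartz_class ::
  "'k::nonarch_field \<Rightarrow> real \<Rightarrow> ('k \<Rightarrow> 'c::nonarch_field) \<Rightarrow> bool" where
  "schwartz_class \<pi> c f \<longleftrightarrow>
     dissipative f \<and> (\<forall>x. f x \<in> valuation_ring) \<and>
     (\<forall>\<psi>. mult_character \<psi> \<and> vnorm (\<psi> \<pi>) = c \<longrightarrow>
        (\<exists>L. ((\<lambda>x. f x * \<psi> x) \<longlongrightarrow> L) (at 0)) \<and> dissipative (twist f \<psi>))"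

definition zeta_integral ::
  "'k::nonarch_field \<Rightarrow> nat \<Rightarrow> 'c::nonarch_field \<Rightarrow> ('k \<Rightarrow> 'c) \<Rightarrow> ('k \<Rightarrow> 'c) \<Rightarrow> 'c" where
  "zeta_integral \<pi> \<delta> sq f \<psi> = integral_K \<pi> \<delta> sq (twist f \<psi>)"

section \<open>Rigid analytic and meromorphic functions on annuli\<close>

definition annulus :: "real set \<Rightarrow> 'c::nonarch_field set" where
  "annulus I = {w. w \<noteq> 0 \<and> vnorm w \<in> I}"

definition rigid_analytic_on :: "real set \<Rightarrow> ('c::nonarch_field \<Rightarrow> 'c) \<Rightarrow> bool" where
  "rigid_analytic_on I F \<longleftrightarrow>
     (\<exists>a :: int \<Rightarrow> 'c. \<forall>w\<in>annulus I. ((\<lambda>n. a n * w powi n) has_sum F w) UNIV)"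

definition non_zero_divisor_on :: "real set \<Rightarrow> ('c::nonarch_field \<Rightarrow> 'c) \<Rightarrow> bool" where
  "non_zero_divisor_on I G \<longleftrightarrow>
     rigid_analytic_on I G \<and>
     (\<forall>H. rigid_analytic_on I H \<and> (\<forall>w\<in>annulus I. G w * H w = 0) \<longrightarrow> (\<forall>w\<in>annulus I. H w = 0))"

text \<open>Radii of the closed (affinoid) annuli contained in \<open>annulus I\<close>; their ends lie in the value
  group.  The annuli themselves form an admissible covering of \<open>annulus I\<close> for the intervals used
  (a compact interval with ends in the value group, or the positive half-line), and ``locally'' below
  means on each of them.\<close>

definition affinoid_radii :: "'c::nonarch_field itself \<Rightarrow> real set \<Rightarrow> real set set" where
  "affinoid_radii (_ :: 'c itself) I =
     {J. J \<subseteq> I \<and> (\<exists>(a::'c) (b::'c). a \<noteq> 0 \<and> vnorm a \<le> vnorm b \<and> J = {vnorm a..vnorm b})}"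

text \<open>A meromorphic function is represented by a total function whose values at the zeros of a
  denominator carry no information; accordingly, two of them are identified if locally they agree off
  the zeros of some non-zero-divisor.\<close>

definition rigid_meromorphic_on :: "real set \<Rightarrow> ('c::nonarch_field \<Rightarrow> 'c) \<Rightarrow> bool" where
  "rigid_meromorphic_on I g \<longleftrightarrow>
     (\<forall>J\<in>affinoid_radii TYPE('c) I. \<exists>F G. rigid_analytic_on J F \<and> non_zero_divisor_on J G \<and>
        (\<forall>w\<in>annulus J. G w \<noteq> 0 \<longrightarrow> g w = F w / G w))"

definition meromorphic_eq_on ::
  "real set \<Rightarrow> ('c::nonarch_field \<Rightarrow> 'c) \<Rightarrow> ('c \<Rightarrow> 'c) \<Rightarrow> bool" where
  "meromorphic_eq_on I g h \<longleftrightarrow>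
     rigid_meromorphic_on I g \<and> rigid_meromorphic_on I h \<and>
     (\<forall>J\<in>affinoid_radii TYPE('c) I. \<exists>G. non_zero_divisor_on J G \<and>
        (\<forall>w\<in>annulus J. G w \<noteq> 0 \<longrightarrow> g w = h w))"

end

theory Submission
  imports Defs
begin

text \<open>Since \<open>q\<close> is a power of \<open>l\<close>, all ball volumes are \<open>p\<close>-adic units, so the integral is a bounded
  functional, the limit of Riemann sums over cosets, and the multiplication formula
  \<open>\<integral> FT f \<cdot> \<phi> = \<integral> f \<cdot> FT \<phi>\<close> holds for every dissipative \<open>f\<close> and every compactly supported \<open>\<phi>\<close>.
  Write \<open>a k\<close> for the integral of \<open>f \<psi>\<close> over the shell \<open>|x| = |\<pi>|\<^sup>k\<close>, so that the zeta integral is the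
  Laurent series with coefficients \<open>a k\<close> on the unit circle.  Taking for \<open>\<phi>\<close> the restriction of
  \<open>1 / \<psi>\<close> to a shell expresses the coefficients of the dual zeta integral through the \<open>a k\<close>: by a
  shift and a nonzero Gauss sum if \<open>\<psi>\<close> is ramified, and through the ball integrals
  \<open>A k = a k + a (k + 1) + \<dots>\<close> if \<open>\<psi>\<close> is trivial.  This is the functional equation, coefficient by
  coefficient.  For the continuation, class \<open>c\<close> for \<open>f\<close> and \<open>FT f\<close> makes the \<open>a k\<close> decay like
  \<open>c powr (- \<bar>k\<bar>)\<close> in both directions, in the unramified case because \<open>FT f 0 = 0\<close> sends \<open>A k\<close> to 0 as
  \<open>k\<close> tends to \<open>-\<infinity>\<close>; so the same Laurent series converges on the whole annulus.\<close>

subsection \<open>Ultrametric fields\<close>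

text \<open>Because volumes have absolute value 1, integration does not increase the sup norm. An
  identity between integrals therefore only has to hold on step functions up to an arbitrary error
  \<open>e\<close>; this takes the place of measure theory and Fubini. A continuous character is
  constant near 1 on the units because raising to the power \<open>l\<close> contracts a
  neighbourhood of 1 in \<open>K\<close> while preserving small distances to 1 in C_p. So every
  shell carries locally constant functions. If \<psi> is trivial, both families of coefficients are
  differences of one sequence: \<open>a k = A k - A (k + 1)\<close>, while the dual ones are, up to
  a unit and a shift by \<delta>, \<open>A k - A (k - 1) / q\<close>. The two difference operators
  commute, so applying each of them to the other family eliminates \<open>A\<close>. This is where
  the denominator \<open>1 - w / q\<close> and the factor \<open>1 - 1 / w\<close> of the numerator
  come from. If \<psi> is ramified, the factor \<rho> is a single monomial.\<close>

lemma vnorm_eq_0_iff [simp]: "vnorm x = 0 \<longleftrightarrow> x = (0::'a::nonarch_field)"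
  using dist_vnorm[of x 0] by (metis diff_zero dist_eq_0_iff)

lemma vnorm_zero [simp]: "vnorm (0::'a::nonarch_field) = 0"
  by simp

lemma vnorm_nonneg [simp]: "0 \<le> vnorm (x::'a::nonarch_field)"
  using dist_vnorm[of x 0] by (metis diff_zero zero_le_dist)

lemma vnorm_pos_iff [simp]: "0 < vnorm x \<longleftrightarrow> x \<noteq> (0::'a::nonarch_field)"
  using vnorm_nonneg[of x] vnorm_eq_0_iff[of x] by linarith

lemma vnorm_one [simp]: "vnorm (1::'a::nonarch_field) = 1"
  using vnorm_mult[of "1::'a" 1] by simp

lemma vnorm_minus [simp]: "vnorm (- x) = vnorm (x::'a::nonarch_field)"
  using dist_vnorm[of x 0] dist_vnorm[of 0 x] by (simp add: dist_commute)

lemma vnorm_minus_commute: "vnorm (x - y) = vnorm (y - x :: 'a::nonarch_field)"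
  using vnorm_minus[of "x - y"] by simp

lemma vnorm_inverse: "vnorm (inverse x) = inverse (vnorm (x::'a::nonarch_field))"
proof (cases "x = 0")
  case False
  then have "vnorm (inverse x) * vnorm x = 1"
    by (simp flip: vnorm_mult)
  then show ?thesis
    by (simp add: inverse_unique[symmetric] mult.commute)
qed simp

lemma vnorm_divide: "vnorm (x / y) = vnorm x / vnorm (y::'a::nonarch_field)"
  by (simp add: divide_inverse vnorm_mult vnorm_inverse)

lemma vnorm_power: "vnorm (x ^ n) = vnorm (x::'a::nonarch_field) ^ n"
  by (induction n) (auto simp: vnorm_mult)

lemma vnorm_powi: "vnorm (x powi n) = vnorm (x::'a::nonarch_field) powi n"
  by (simp add: power_int_def vnorm_power vnorm_inverse)

lemma vnorm_add_le: "vnorm x \<le> e \<Longrightarrow> vnorm y \<le> e \<Longrightarrow> vnorm (x + y :: 'a::nonarch_field) \<le> e"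
  using vnorm_add_le_max[of x y] by linarith

lemma vnorm_diff_le: "vnorm x \<le> e \<Longrightarrow> vnorm y \<le> e \<Longrightarrow> vnorm (x - y :: 'a::nonarch_field) \<le> e"
  using vnorm_add_le[of x e "- y"] by simp

lemma vnorm_add_less: "vnorm x < e \<Longrightarrow> vnorm y < e \<Longrightarrow> vnorm (x + y :: 'a::nonarch_field) < e"
  using vnorm_add_le_max[of x y] by linarith

lemma vnorm_diff_less: "vnorm x < e \<Longrightarrow> vnorm y < e \<Longrightarrow> vnorm (x - y :: 'a::nonarch_field) < e"
  using vnorm_add_less[of x e "- y"] by simp

lemma vnorm_eq_if_diff_less:
  assumes "vnorm (x - y) < vnorm (x::'a::nonarch_field)"
  shows "vnorm y = vnorm x"
proof (rule antisym)
  have "vnorm (x - (x - y)) \<le> vnorm x"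
    using assms vnorm_diff_le[of x "vnorm x" "x - y"] by linarith
  then show "vnorm y \<le> vnorm x" by simp
  have "vnorm ((x - y) + y) \<le> max (vnorm (x - y)) (vnorm y)"
    by (rule vnorm_add_le_max)
  then show "vnorm x \<le> vnorm y" using assms by auto
qed

lemma vnorm_sum_le:
  assumes "\<And>i. i \<in> A \<Longrightarrow> vnorm (f i :: 'a::nonarch_field) \<le> e" and "0 \<le> e"
  shows "vnorm (sum f A) \<le> e"
  using assms(1)
  by (induction A rule: infinite_finite_induct) (auto intro!: vnorm_add_le simp: \<open>0 \<le> e\<close>)

lemma vnorm_diff_le_imp_eq:
  fixes x y :: "'a::nonarch_field"
  assumes "\<And>e. e > 0 \<Longrightarrow> vnorm (x - y) \<le> e"
  shows "x = y"
proof -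
  have "vnorm (x - y) \<le> 0" using assms by (rule field_le_epsilon[of _ 0, simplified])
  then show ?thesis using vnorm_nonneg[of "x - y"] vnorm_eq_0_iff[of "x - y"] by simp
qed

lemma vnorm_of_nat_le_1: "vnorm (of_nat n :: 'a::nonarch_field) \<le> 1"
  by (induction n) (auto intro: vnorm_add_le)

lemma vnorm_of_int_le_1: "vnorm (of_int n :: 'a::nonarch_field) \<le> 1"
  by (cases n rule: int_cases2) (auto simp: vnorm_of_nat_le_1)

text \<open>Bezout: in \<open>u * n + v * l = 1\<close> the second term is smaller than 1, so the
  first, and with it \<open>n\<close>, has absolute value at least 1. This serves for integers prime
  to \<open>l\<close> in the \<open>l\<close>-adic field, and later for \<open>l\<close> itself in
  C_p.\<close>

lemma vnorm_of_nat_coprime: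
  assumes "vnorm (of_nat l :: 'a::nonarch_field) < 1" "coprime n l"
  shows "vnorm (of_nat n :: 'a) = 1"
proof (rule antisym)
  obtain u v where "u * int n + v * int l = 1"
    using assms(2) by (metis bezout_int coprime_int_iff coprime_iff_gcd_eq_1)
  then have "of_int u * of_nat n + of_int v * of_nat l = (1::'a)"
    by (metis of_int_1 of_int_add of_int_mult of_int_of_nat_eq)
  moreover have "vnorm (of_int v * of_nat l :: 'a) < 1"
    using assms(1) vnorm_of_int_le_1[of v, where 'a='a]
    by (metis vnorm_mult mult_left_le_one_le order.strict_trans1 vnorm_nonneg)
  ultimately have "1 \<le> vnorm (of_int u * of_nat n :: 'a)"
    using vnorm_add_less[of "of_int u * of_nat n :: 'a" 1 "of_int v * of_nat l"] by force
  also have "\<dots> \<le> vnorm (of_nat n :: 'a)"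
    using vnorm_of_int_le_1[of u, where 'a='a] by (simp add: vnorm_mult mult_left_le_one_le)
  finally show "1 \<le> vnorm (of_nat n :: 'a)" .
qed (rule vnorm_of_nat_le_1)

section \<open>Topology and summability in ultrametric fields\<close>

lemma tendsto_vnorm_iff:
  "(f \<longlongrightarrow> (a::'a::nonarch_field)) F \<longleftrightarrow> (\<forall>e>0. eventually (\<lambda>x. vnorm (f x - a) < e) F)"
  by (simp add: tendsto_iff dist_vnorm)

text \<open>Continuous addition and multiplication make the general rules for limits, continuity and
  \<open>has_sum\<close> applicable to the bare metric class.\<close>

instance nonarch_field \<subseteq> topological_ab_group_add
proof
  fix a b :: 'a
  show "LIM x (nhds a \<times>\<^sub>F nhds b). fst x + snd x :> nhds (a + b)"
    unfolding tendsto_vnorm_iff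
  proof (intro allI impI)
    fix e :: real assume "e > 0"
    then have "eventually (\<lambda>x. vnorm (x - a) < e) (nhds a)" "eventually (\<lambda>x. vnorm (x - b) < e) (nhds b)"
      by (auto simp: eventually_nhds_metric dist_vnorm)
    then show "\<forall>\<^sub>F x in nhds a \<times>\<^sub>F nhds b. vnorm (fst x + snd x - (a + b)) < e"
      unfolding eventually_prod_filter
      by (rule_tac exI, rule_tac exI)
         (auto simp: add_diff_add intro!: vnorm_add_less)
  qed
  show "(uminus \<longlongrightarrow> - a) (nhds a)"
    unfolding tendsto_vnorm_iff
  proof (intro allI impI)
    fix e :: real assume "e > 0"
    have "vnorm (- x - - a) = vnorm (x - a)" for x
      by (metis minus_diff_minus vnorm_minus)
    with \<open>e > 0\<close> show "\<forall>\<^sub>F x in nhds a. vnorm (- x - - a) < e"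
      by (auto simp: eventually_nhds_metric dist_vnorm)
  qed
qed

instance nonarch_field \<subseteq> topological_semigroup_mult
proof
  fix a b :: 'a
  show "LIM x (nhds a \<times>\<^sub>F nhds b). fst x * snd x :> nhds (a * b)"
    unfolding tendsto_vnorm_iff
  proof (intro allI impI)
    fix e :: real assume "e > 0"
    define r where "r = Max {1, vnorm a, vnorm b}"
    have r: "1 \<le> r" "vnorm a \<le> r" "vnorm b \<le> r" by (auto simp: r_def)
    define d where "d = min 1 (e / r)"
    have d: "0 < d" "d \<le> 1" "d \<le> e / r" using r \<open>e > 0\<close> by (auto simp: d_def)
    \<comment> \<open>Here \<open>x * y - a * b = x * (y - b) + b * (x - a)\<close>, and
      \<open>d \<le> 1 \<le> r\<close> keeps \<open>x\<close> within the bound \<open>r\<close>, so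
      each summand stays below \<open>r * (e / r)\<close>.\<close>
    have *: "vnorm (x * y - a * b) < e" if x: "vnorm (x - a) < d" and y: "vnorm (y - b) < d" for x y
    proof -
      have "vnorm x \<le> r"
        using vnorm_add_le[of "x - a" r a] x r d by auto
      have small: "vnorm (z * u) < e" if "vnorm z \<le> r" "vnorm u < d" for z u :: 'a
      proof -
        have "vnorm (z * u) \<le> r * vnorm u"
          using that by (simp add: vnorm_mult mult_right_mono)
        also have "\<dots> < r * (e / r)" using that d r by (intro mult_strict_left_mono) auto
        finally show ?thesis using r by simp
      qed
      have "vnorm (x * (y - b) + b * (x - a)) < e"
        using \<open>vnorm x \<le> r\<close> r x y by (intro vnorm_add_less small)
      then show ?thesis by (simp add: algebra_simps)
    qed
    have "eventually (\<lambda>x. vnorm (x - a) < d) (nhds a)" "eventually (\<lambda>x. vnorm (x - b) < d) (nhds b)"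
      using d by (auto simp: eventually_nhds_metric dist_vnorm)
    then show "\<forall>\<^sub>F x in nhds a \<times>\<^sub>F nhds b. vnorm (fst x * snd x - a * b) < e"
      unfolding eventually_prod_filter using * by fastforce
  qed
qed

instance nonarch_field \<subseteq> topological_comm_monoid_mult ..

lemma open_vnorm_ball: "open {x. vnorm (x - a) < e}" for a :: "'a::nonarch_field"
proof -
  have "{x. vnorm (x - a) < e} = ball a e"
    by (auto simp: dist_vnorm vnorm_minus_commute)
  then show ?thesis by simp
qed

text \<open>Near a nonzero limit the absolute value is eventually constant, so the limit inherits
  the bound.\<close>

lemma vnorm_tendsto_le:
  fixes f :: "'b \<Rightarrow> 'a::nonarch_field"
  assumes "(f \<longlongrightarrow> a) F" "eventually (\<lambda>x. vnorm (f x) \<le> e) F" "F \<noteq> bot"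
  shows "vnorm a \<le> e"
proof (rule ccontr)
  assume "\<not> vnorm a \<le> e"
  moreover have "0 \<le> e"
    using eventually_happens'[OF assms(3,2)] vnorm_nonneg order_trans by blast
  ultimately have "0 < vnorm a" "e < vnorm a" by linarith+
  then have "eventually (\<lambda>x. vnorm (f x - a) < vnorm a) F"
    using assms(1) tendsto_vnorm_iff by blast
  with assms(2) have "eventually (\<lambda>x. False) F"
  proof eventually_elim
    case (elim x)
    then have "vnorm (f x) = vnorm a"
      by (intro vnorm_eq_if_diff_less) (simp add: vnorm_minus_commute)
    with elim \<open>e < vnorm a\<close> show ?case by simp
  qed
  with assms(3) show False by simp
qed

text \<open>Terms tending to 0 suffice: two finite sums whose index sets contain all terms of size
  at least \<open>1 / (n + 1)\<close> differ only by smaller terms, hence by at most that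
  much.\<close>

lemma nonarch_has_sum_exists:
  fixes t :: "'i \<Rightarrow> 'a::nonarch_field"
  assumes "complete (UNIV :: 'a set)" and small: "\<And>e. e > 0 \<Longrightarrow> finite {i. e \<le> vnorm (t i)}"
  shows "\<exists>s. (t has_sum s) UNIV"
proof -
  let ?A = "\<lambda>n::nat. {i. inverse (real (Suc n)) \<le> vnorm (t i)}"
  have fin: "finite (?A n)" for n by (rule small) simp
  have tail: "vnorm (sum t B - sum t (?A n)) \<le> inverse (real (Suc n))"
    if "finite B" "?A n \<subseteq> B" for B n
  proof -
    have "sum t B - sum t (?A n) = sum t (B - ?A n)"
      using that fin by (simp add: sum_diff)
    then show ?thesis by (auto intro!: vnorm_sum_le)
  qed
  have "Cauchy (\<lambda>n. sum t (?A n))"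
  proof (rule metric_CauchyI)
    fix e :: real assume "e > 0"
    then obtain N where N: "inverse (real (Suc N)) < e" using reals_Archimedean by blast
    have mono: "?A N \<subseteq> ?A n" if "N \<le> n" for n
      using that by (auto intro: order_trans[rotated] le_imp_inverse_le)
    have "vnorm (sum t (?A n) - sum t (?A N)) < e" if "N \<le> n" for n
      using tail[OF fin mono[OF that]] N by linarith
    then have "vnorm ((sum t (?A m) - sum t (?A N)) - (sum t (?A n) - sum t (?A N))) < e"
      if "N \<le> m" "N \<le> n" for m n using that by (metis vnorm_diff_less)
    then show "\<exists>M. \<forall>m\<ge>M. \<forall>n\<ge>M. dist (sum t (?A m)) (sum t (?A n)) < e"
      by (auto simp: dist_vnorm)
  qed
  then obtain s where s: "(\<lambda>n. sum t (?A n)) \<longlonglongrightarrow> s"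
    using assms(1) by (auto simp: complete_def)
  have "(sum t \<longlongrightarrow> s) (finite_subsets_at_top UNIV)"
    unfolding tendsto_vnorm_iff
  proof (intro allI impI)
    fix e :: real assume "e > 0"
    have "eventually (\<lambda>n. inverse (real (Suc n)) < e) sequentially"
      using LIMSEQ_inverse_real_of_nat \<open>e > 0\<close> by (rule order_tendstoD)
    moreover have "eventually (\<lambda>n. vnorm (sum t (?A n) - s) < e) sequentially"
      using s \<open>e > 0\<close> by (simp add: tendsto_vnorm_iff)
    ultimately obtain n where n: "inverse (real (Suc n)) < e" "vnorm (sum t (?A n) - s) < e"
      by (metis (no_types, lifting) eventually_conj eventually_sequentially le_refl)
    have "vnorm (sum t B - s) < e" if "finite B" "?A n \<subseteq> B" for B
      using vnorm_add_less[OF _ n(2), of "sum t B - sum t (?A n)"] tail[OF that] n by simp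
    then show "\<forall>\<^sub>F B in finite_subsets_at_top UNIV. vnorm (sum t B - s) < e"
      unfolding eventually_finite_subsets_at_top using fin by blast
  qed
  then show ?thesis by (auto simp: has_sum_def)
qed

subsection \<open>The \<open>l\<close>-adic numbers and local compactness\<close>

locale padic_field =
  fixes l :: nat and ty :: "'q::nonarch_field itself"
  assumes prime_l: "prime l" and padic: "is_padic_numbers l TYPE('q)"
begin

lemma l_gt_1: "1 < real l"
  using prime_l prime_gt_1_nat by simp

lemma l_pos: "0 < real l"
  using l_gt_1 by simp

lemma vnorm_l: "vnorm (of_nat l :: 'q) = 1 / real l"
  using padic by (simp add: is_padic_numbers_def)

lemma vnorm_l_less_1: "vnorm (of_nat l :: 'q) < 1"
  using l_gt_1 by (simp add: vnorm_l)

lemma vnorm_l_power: "vnorm (of_nat l ^ t :: 'q) = 1 / real l ^ t"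
  by (simp add: vnorm_power vnorm_l power_one_over)

lemma vnorm_of_nat_not_dvd: "\<not> l dvd n \<Longrightarrow> vnorm (of_nat n :: 'q) = 1"
  using vnorm_of_nat_coprime[OF vnorm_l_less_1, of n] prime_imp_coprime[OF prime_l, of n]
  by (simp add: coprime_commute)

lemma vnorm_of_int_not_dvd: "\<not> int l dvd n \<Longrightarrow> vnorm (of_int n :: 'q) = 1"
  using vnorm_of_nat_not_dvd by (cases n rule: int_cases2) auto

lemma vnorm_of_int_le_dvd: "vnorm (of_int n :: 'q) \<le> 1 / real l ^ t \<Longrightarrow> int l ^ t dvd n"
proof (induction t)
  case (Suc t)
  have "1 / real l ^ Suc t \<le> 1 / real l ^ t"
    using l_gt_1 by (intro divide_left_mono) auto
  then obtain k where k: "n = int l ^ t * k"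
    using Suc by (meson dvdE order_trans)
  have "vnorm (of_int n :: 'q) = vnorm (of_int k :: 'q) / real l ^ t"
    by (simp add: k vnorm_mult vnorm_l_power)
  with Suc.prems have "vnorm (of_int k :: 'q) \<le> 1 / real l"
    using l_pos by (simp add: field_simps)
  moreover have "1 / real l < 1" using l_gt_1 by simp
  ultimately have "vnorm (of_int k :: 'q) \<noteq> 1" by linarith
  then have "int l dvd k"
    using vnorm_of_int_not_dvd by blast
  then show ?case by (auto simp: k)
qed simp

lemma vnorm_of_int_dvd_le: "int l ^ t dvd n \<Longrightarrow> vnorm (of_int n :: 'q) \<le> 1 / real l ^ t"
  using l_pos vnorm_of_int_le_1[where 'a='q]
  by (auto simp: vnorm_mult vnorm_l_power divide_right_mono elim!: dvdE)

text \<open>Density of the rationals gives a fraction \<open>a / b\<close> in lowest terms close to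
  \<open>x\<close>. As \<open>|a / b| \<le> 1\<close>, the prime \<open>l\<close> does not divide
  \<open>b\<close>, and inverting \<open>b\<close> modulo \<open>l ^ t\<close> turns the fraction
  into a natural number.\<close>

lemma nat_approx:
  assumes "vnorm (x::'q) \<le> 1"
  shows "\<exists>m::nat. m < l ^ t \<and> vnorm (of_nat m - x) \<le> 1 / real l ^ t"
proof -
  let ?e = "1 / real l ^ t"
  have e: "0 < ?e" "?e \<le> 1"
    using l_gt_1 by (auto simp: field_simps)
  have "x \<in> closure \<rat>"
    using padic by (simp add: is_padic_numbers_def)
  then obtain r where r: "r \<in> \<rat>" "vnorm (r - x) < ?e"
    using e by (metis closure_approachable dist_vnorm)
  obtain a b :: int where ab: "b > 0" "coprime a b" "r = of_int a / of_int b"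
    using r(1) by (metis Rats_cases')
  have r1: "vnorm r \<le> 1"
    using vnorm_add_le[of "r - x" 1 x] r e assms by auto
  have b: "\<not> int l dvd b"
  proof
    assume lb: "int l dvd b"
    then have "\<not> int l dvd a"
      using ab(2) prime_l coprime_common_divisor[of a b "int l"] by (auto dest: not_prime_unit)
    then have "vnorm (of_int a :: 'q) = 1" by (rule vnorm_of_int_not_dvd)
    moreover have "vnorm (of_int b :: 'q) < 1"
      using vnorm_of_int_dvd_le[of 1 b] lb l_gt_1 by (auto intro: le_less_trans)
    moreover have "(of_int b :: 'q) \<noteq> 0" using ab by simp
    ultimately have "vnorm r > 1" by (simp add: ab vnorm_divide)
    with r1 show False by simp
  qed
  then have "coprime (int l ^ t) b"
    using prime_l prime_imp_coprime[of "int l" b] by simp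
  then obtain u v where uv: "u * int l ^ t + v * b = 1"
    by (metis bezout_int coprime_iff_gcd_eq_1)
  define m where "m = nat ((a * v) mod int l ^ t)"
  have lt: "0 < int l ^ t" using l_pos by simp
  have m: "int m = (a * v) mod int l ^ t"
    using lt by (simp add: m_def)
  have "int l ^ t dvd int m * b - a"
  proof -
    have "int l ^ t dvd int m - a * v"
      unfolding m by (metis dvd_minus_mod dvd_diff_commute)
    then have "int l ^ t dvd (int m - a * v) * b - a * (u * int l ^ t)" by simp
    moreover have "(int m - a * v) * b - a * (u * int l ^ t) = int m * b - a * (u * int l ^ t + v * b)"
      by (simp add: algebra_simps)
    ultimately show ?thesis by (simp add: uv)
  qed
  then have "vnorm (of_int (int m * b - a) :: 'q) \<le> ?e"
    by (rule vnorm_of_int_dvd_le)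
  moreover have "of_nat m - r = of_int (int m * b - a) / (of_int b :: 'q)"
    using ab by (simp add: field_simps)
  ultimately have "vnorm (of_nat m - r) \<le> ?e"
    using vnorm_of_int_not_dvd[OF b] by (simp add: vnorm_divide)
  then have "vnorm ((of_nat m - r) + (r - x)) \<le> ?e"
    using r by (intro vnorm_add_le) auto
  moreover have "m < l ^ t"
    using m lt by (metis of_nat_less_iff of_nat_power pos_mod_bound)
  ultimately show ?thesis by auto
qed

text \<open>Scaling by the least suitable power of \<open>l\<close> gives \<open>y\<close> with
  \<open>1 / l < |y| \<le> 1\<close>. A natural number approximating \<open>y\<close> to within
  \<open>1 / l\<close> has the same absolute value and is therefore prime to \<open>l\<close>, so
  \<open>|y| = 1\<close>. This justifies the \<open>THE t\<close> in
  \<open>zeta_power\<close>.\<close>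

lemma vnorm_eq_power:
  assumes "x \<notin> valuation_ring"
  shows "\<exists>t::nat. vnorm (x::'q) = real l ^ t"
proof -
  obtain k0 where "vnorm x < real l ^ k0"
    using real_arch_pow[OF l_gt_1] by blast
  then have ex: "\<exists>k. vnorm x \<le> real l ^ k" by (auto intro: less_imp_le)
  define k where "k = (LEAST k. vnorm x \<le> real l ^ k)"
  have k: "vnorm x \<le> real l ^ k"
    unfolding k_def by (rule LeastI_ex[OF ex])
  have "k \<noteq> 0"
    using k assms by (cases k) (auto simp: valuation_ring_def)
  then have "\<not> vnorm x \<le> real l ^ (k - 1)"
    unfolding k_def by (metis diff_less less_one not_less_Least zero_less_iff_neq_zero)
  then have k': "real l ^ k < vnorm x * real l"
    using \<open>k \<noteq> 0\<close> l_pos by (cases k) (auto simp: field_simps)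
  define y where "y = x * of_nat l ^ k"
  have vy: "vnorm y = vnorm x / real l ^ k"
    by (simp add: y_def vnorm_mult vnorm_l_power)
  have "vnorm y \<le> 1" "1 / real l < vnorm y"
    unfolding vy using k k' l_pos by (auto simp: field_simps)
  then obtain m where m: "vnorm (of_nat m - y) \<le> 1 / real l"
    using nat_approx[of y 1] by auto
  have "vnorm (y - of_nat m) < vnorm y"
    using m \<open>1 / real l < vnorm y\<close> by (simp add: vnorm_minus_commute)
  then have my: "vnorm (of_nat m :: 'q) = vnorm y" by (rule vnorm_eq_if_diff_less)
  have "\<not> l dvd m"
    using vnorm_of_int_dvd_le[of 1 "int m"] my \<open>1 / real l < vnorm y\<close> by auto
  then have "vnorm y = 1"
    using vnorm_of_nat_not_dvd my by simp
  moreover have "vnorm x = vnorm x / real l ^ k * real l ^ k"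
    using l_pos by simp
  ultimately have "vnorm x = real l ^ k"
    using vy by simp
  then show ?thesis by blast
qed

text \<open>The ball is complete, and the natural numbers below \<open>l ^ t\<close> form a finite
  net for the radius \<open>1 / l ^ t\<close>.\<close>

lemma compact_unit_ball: "compact {x::'q. vnorm x \<le> 1}"
  unfolding compact_eq_totally_bounded
proof (intro conjI allI impI)
  have "closed {x::'q. vnorm x \<le> 1}"
    using closed_cball[of "0::'q" 1] by (simp add: cball_def dist_vnorm)
  moreover have "complete (UNIV::'q set)"
    using padic by (simp add: is_padic_numbers_def)
  ultimately show "complete {x::'q. vnorm x \<le> 1}"
    using closed_subset complete_closed_subset by blast
  fix e :: real assume "e > 0"
  obtain t where t: "1 / real l ^ t < e"
    using real_arch_pow_inv[OF \<open>e > 0\<close>, of "1 / real l"] l_gt_1 by (auto simp: power_one_over)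
  have "{x::'q. vnorm x \<le> 1} \<subseteq> (\<Union>x\<in>of_nat ` {..<l ^ t}. ball x e)"
  proof
    fix x :: 'q assume "x \<in> {x. vnorm x \<le> 1}"
    then obtain m where "m < l ^ t" "vnorm (of_nat m - x) \<le> 1 / real l ^ t"
      using nat_approx by blast
    then show "x \<in> (\<Union>x\<in>of_nat ` {..<l ^ t}. ball x e)"
      using t by (auto simp: dist_vnorm intro!: bexI[of _ m])
  qed
  then show "\<exists>k. finite k \<and> {x::'q. vnorm x \<le> 1} \<subseteq> (\<Union>x\<in>k. ball x e)"
    by blast
qed

lemma compact_ball: "compact {x::'q. vnorm x \<le> r}"
proof -
  obtain k where k: "r < real l ^ k"
    using real_arch_pow[OF l_gt_1] by blast
  have "compact ((\<lambda>x. inverse (of_nat l ^ k) * x) ` {x::'q. vnorm x \<le> 1})"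
    by (intro compact_continuous_image compact_unit_ball continuous_intros)
  moreover have "{x::'q. vnorm x \<le> r} \<subseteq> (\<lambda>x. inverse (of_nat l ^ k) * x) ` {x::'q. vnorm x \<le> 1}"
  proof
    fix x :: 'q assume "x \<in> {x. vnorm x \<le> r}"
    then have "vnorm (of_nat l ^ k * x) \<le> 1"
      using k l_pos by (simp add: vnorm_mult vnorm_l_power field_simps)
    moreover have "x = inverse (of_nat l ^ k) * (of_nat l ^ k * x)"
      using prime_l prime_gt_0_nat by (simp add: field_simps)
    ultimately show "x \<in> (\<lambda>x. inverse (of_nat l ^ k) * x) ` {x::'q. vnorm x \<le> 1}"
      by blast
  qed
  moreover have "closed {x::'q. vnorm x \<le> r}"
    using closed_cball[of "0::'q" r] by (simp add: cball_def dist_vnorm)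
  ultimately show ?thesis
    by (metis closed_Int_compact inf.absorb1)
qed

end

section \<open>Finite extensions of the \<open>l\<close>-adic numbers: compact balls and the
  trace\<close>

locale finite_padic_extension = padic_field l ty for l :: nat and ty :: "'q::nonarch_field itself" +
  fixes \<iota> :: "'q \<Rightarrow> 'k::nonarch_field"
  assumes finite_ext: "is_finite_extension \<iota>"
begin

lemma \<iota>_1: "\<iota> 1 = 1" and \<iota>_add: "\<iota> (x + y) = \<iota> x + \<iota> y" and \<iota>_mult: "\<iota> (x * y) = \<iota> x * \<iota> y"
  and vnorm_\<iota>: "vnorm (\<iota> x) = vnorm x"
  using finite_ext by (simp_all add: is_finite_extension_def)

sublocale vs: vector_space "\<lambda>a x. \<iota> a * x"
  by unfold_locales (auto simp: \<iota>_1 \<iota>_add \<iota>_mult algebra_simps)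

lemma \<iota>_diff: "\<iota> (x - y) = \<iota> x - \<iota> y"
  by (metis \<iota>_add add_diff_cancel_right' diff_add_cancel)

lemma \<iota>_of_nat: "\<iota> (of_nat n) = of_nat n"
proof (induction n)
  case 0
  then show ?case using \<iota>_diff[of 0 0] by simp
qed (simp add: \<iota>_add \<iota>_1)

lemma continuous_on_\<iota>: "continuous_on A \<iota>"
  unfolding continuous_on_iff by (metis \<iota>_diff dist_vnorm vnorm_\<iota>)

text \<open>A vector \<open>b\<close> outside the span \<open>V\<close> has positive distance
  \<open>d\<close> from it, because bounded pieces of \<open>V\<close> are compact by induction.
  Hence the coefficient of \<open>b\<close> in a vector of size at most \<open>r\<close> is at most
  \<open>r / d\<close>, and the new ball is a closed part of the continuous image of a compact
  product.\<close>

lemma compact_ball_span: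
  assumes "finite B"
  shows "compact {x \<in> vs.span B. vnorm x \<le> r}"
  using assms
proof (induction B arbitrary: r rule: finite_induct)
  case empty
  have "{x \<in> vs.span {}. vnorm x \<le> r} \<subseteq> {0}" by auto
  then show ?case
    by (meson finite.emptyI finite.insertI finite_imp_compact finite_subset)
next
  case (insert b B)
  let ?V = "vs.span B"
  show ?case
  proof (cases "b \<in> ?V")
    case True
    then show ?thesis using insert.IH[of r] by (simp add: vs.span_redundant)
  next
    case False
    have "b \<noteq> 0" using False vs.span_zero by auto
    let ?C = "{x \<in> ?V. vnorm x \<le> vnorm b}"
    have "open (- ?C)" using insert.IH[of "vnorm b"] compact_imp_closed by auto
    moreover have "b \<in> - ?C" using False by simp
    ultimately obtain e where e: "e > 0" "ball b e \<subseteq> - ?C"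
      by (meson open_contains_ball)
    \<comment> \<open>The radius \<open>e\<close> only keeps away the \<open>v\<close> with
      \<open>|v| \<le> |b|\<close>. Taking \<open>d \<le> |b|\<close> as well deals with the others,
      since \<open>|b - v| < |b|\<close> forces \<open>|v| = |b|\<close>.\<close>
    define d where "d = min e (vnorm b)"
    have "d > 0" using e \<open>b \<noteq> 0\<close> by (simp add: d_def)
    have d: "d \<le> vnorm (b - v)" if "v \<in> ?V" for v
    proof (rule ccontr)
      assume *: "\<not> d \<le> vnorm (b - v)"
      then have "vnorm v = vnorm b"
        by (intro vnorm_eq_if_diff_less) (simp add: d_def)
      with that have "v \<in> ?C" by simp
      moreover have "v \<in> ball b e" using * by (simp add: d_def dist_vnorm)
      ultimately show False using e by blast
    qed
    define R where "R = max r (r / d * vnorm b)"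
    let ?S = "{x \<in> ?V. vnorm x \<le> R} \<times> {a::'q. vnorm a \<le> r / d}"
    let ?h = "\<lambda>z. fst z + \<iota> (snd z) * b"
    have "compact (?h ` ?S)"
      by (intro compact_continuous_image compact_Times insert.IH compact_ball continuous_intros
          continuous_on_compose2[OF continuous_on_\<iota>[of UNIV]]) auto
    moreover have "{x \<in> vs.span (insert b B). vnorm x \<le> r} = ?h ` ?S \<inter> cball 0 r"
    proof (intro equalityI subsetI)
      fix x assume "x \<in> {x \<in> vs.span (insert b B). vnorm x \<le> r}"
      then have x: "x \<in> vs.span (insert b B)" "vnorm x \<le> r" by auto
      then obtain a where a: "x - \<iota> a * b \<in> ?V"
        by (auto simp: vs.span_insert)
      have "vnorm a * d \<le> r"
      proof (cases "a = 0")
        case True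
        then show ?thesis using order_trans[OF vnorm_nonneg x(2)] by simp
      next
        case False
        then have "\<iota> a \<noteq> 0" using vnorm_\<iota>[of a] by auto
        have "\<iota> (- inverse a) * (x - \<iota> a * b) \<in> ?V"
          using a by (rule vs.span_scale)
        moreover have "\<iota> (- inverse a) = - inverse (\<iota> a)"
        proof -
          have "\<iota> a * \<iota> (inverse a) = 1"
            using False by (simp add: \<iota>_1 flip: \<iota>_mult)
          then have "inverse (\<iota> a) = \<iota> (inverse a)" by (rule inverse_unique)
          then show ?thesis
            using \<iota>_diff[of 0 "inverse a"] \<iota>_diff[of 0 0] by simp
        qed
        ultimately have "d \<le> vnorm (b - - inverse (\<iota> a) * (x - \<iota> a * b))"
          using d by metis
        also have "b - - inverse (\<iota> a) * (x - \<iota> a * b) = inverse (\<iota> a) * x"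
          using \<open>\<iota> a \<noteq> 0\<close> by (simp add: algebra_simps)
        finally have "d * vnorm a \<le> vnorm x"
          using False by (simp add: vnorm_mult vnorm_inverse vnorm_divide vnorm_\<iota> field_simps)
        with x show ?thesis by (simp add: mult.commute)
      qed
      then have a2: "vnorm a \<le> r / d" using \<open>d > 0\<close> by (simp add: field_simps)
      then have "vnorm (\<iota> a * b) \<le> r / d * vnorm b"
        using mult_right_mono[OF a2, of "vnorm b"] by (simp add: vnorm_mult vnorm_\<iota>)
      then have "vnorm (x - \<iota> a * b) \<le> R"
        using x by (intro vnorm_diff_le) (auto simp: R_def)
      with a a2 have "(x - \<iota> a * b, a) \<in> ?S" by simp
      then have "?h (x - \<iota> a * b, a) \<in> ?h ` ?S" by (rule imageI)
      then show "x \<in> ?h ` ?S \<inter> cball 0 r" using x by (simp add: dist_vnorm)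
    next
      fix x assume "x \<in> ?h ` ?S \<inter> cball 0 r"
      then obtain v a where "x = v + \<iota> a * b" "v \<in> ?V" "vnorm x \<le> r"
        by (auto simp: dist_vnorm)
      moreover from this have "x - \<iota> a * b \<in> ?V" by simp
      ultimately show "x \<in> {x \<in> vs.span (insert b B). vnorm x \<le> r}"
        unfolding vs.span_insert by blast
    qed
    ultimately show ?thesis
      using compact_Int_closed[OF _ closed_cball] by auto
  qed
qed

lemma compact_vnorm_ball: "compact {x::'k. vnorm x \<le> r}"
proof -
  obtain B where "finite B" "vs.span B = UNIV"
    using finite_ext by (auto simp: is_finite_extension_def)
  then show ?thesis using compact_ball_span[of B r] by simp
qed

lemma field_trace_add: "field_trace \<iota> (x + y) = field_trace \<iota> x + field_trace \<iota> y"
proof -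
  \<comment> \<open>Existence of a basis makes the \<open>SOME\<close> in \<open>field_basis\<close>
    meaningful, and coordinates in a basis are additive.\<close>
  have "\<exists>B. \<not> vs.dependent B \<and> vs.span B = UNIV"
    by (metis vs.independent_extend_basis vs.span_extend_basis vs.independent_empty)
  then have B: "\<not> vs.dependent (field_basis \<iota>)" "vs.span (field_basis \<iota>) = UNIV"
    unfolding field_basis_def by (metis (mono_tags, lifting) someI_ex)+
  show ?thesis
    unfolding field_trace_def
    by (simp add: distrib_right vs.representation_add[OF B(1)] B(2) sum.distrib)
qed

end

subsection \<open>Balls and cosets in the local field\<close>

text \<open>Transfers the size of the residue field between cosets as sets, chosen representatives,
  and translated and scaled copies.\<close>

lemma card_image_eq_if_same_kernel:
  assumes "\<And>x y. x \<in> A \<Longrightarrow> y \<in> A \<Longrightarrow> f x = f y \<longleftrightarrow> g x = g y"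
  shows "card (f ` A) = card (g ` A)"
proof -
  have g: "g (inv_into A f (f x)) = g x" if "x \<in> A" for x
  proof -
    have "inv_into A f (f x) \<in> A" "f (inv_into A f (f x)) = f x"
      using that by (auto intro: inv_into_into f_inv_into_f)
    then show ?thesis using assms that by blast
  qed
  have "inj_on (\<lambda>c. g (inv_into A f c)) (f ` A)"
    by (rule inj_onI) (auto simp: g assms)
  moreover have "(\<lambda>c. g (inv_into A f c)) ` f ` A = g ` A"
    unfolding image_image by (rule image_cong) (auto simp: g)
  ultimately show ?thesis by (metis card_image)
qed

text \<open>What is retained of the extension: a uniformizer and compact balls. The base field
  returns only with the different and the additive character.\<close>

locale local_field =
  fixes \<pi> :: "'k::nonarch_field"
  assumes uniformizer: "is_uniformizer \<pi>" and pi_nz [simp]: "\<pi> \<noteq> 0"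
    and compact_vnorm_ball: "\<And>r. compact {x::'k. vnorm x \<le> r}"
begin

abbreviation B :: "int \<Rightarrow> 'k set" where "B n \<equiv> ideal_pow \<pi> n"

lemma in_B_iff: "x \<in> B n \<longleftrightarrow> vnorm x \<le> vnorm \<pi> powi n"
proof
  assume "x \<in> B n"
  then show "vnorm x \<le> vnorm \<pi> powi n"
    by (auto simp: ideal_pow_def valuation_ring_def vnorm_mult vnorm_powi intro!: mult_left_le)
next
  assume *: "vnorm x \<le> vnorm \<pi> powi n"
  have "vnorm (x / \<pi> powi n) \<le> 1"
    using * pi_nz by (simp add: vnorm_divide vnorm_powi divide_le_eq_1)
  then show "x \<in> B n"
    unfolding ideal_pow_def valuation_ring_def
    by (intro image_eqI[of _ _ "x / \<pi> powi n"]) auto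
qed

lemma in_B_0_iff: "x \<in> B 0 \<longleftrightarrow> vnorm x \<le> 1"
  by (simp add: in_B_iff)

lemma B_1: "x \<in> B 1 \<longleftrightarrow> vnorm x < 1"
  using uniformizer by (auto simp: is_uniformizer_def)

lemma vnorm_pi_pos: "0 < vnorm \<pi>"
  using pi_nz by simp

lemma vnorm_pi_less_1: "vnorm \<pi> < 1"
  using B_1[of \<pi>] by (simp add: in_B_iff)

lemma vnorm_pi_powi_le_iff: "vnorm \<pi> powi m \<le> vnorm \<pi> powi n \<longleftrightarrow> n \<le> m"
proof (cases "n \<le> m")
  case True
  then show ?thesis
    using vnorm_pi_pos vnorm_pi_less_1 by (auto intro!: power_int_decreasing)
next
  case False
  then have "vnorm \<pi> powi n < vnorm \<pi> powi m"
    using vnorm_pi_pos vnorm_pi_less_1 by (intro power_int_strict_decreasing) auto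
  with False show ?thesis by simp
qed

lemma vnorm_pi_powi_eq_iff: "vnorm \<pi> powi m = vnorm \<pi> powi n \<longleftrightarrow> n = m"
proof
  assume "vnorm \<pi> powi m = vnorm \<pi> powi n"
  then have "vnorm \<pi> powi m \<le> vnorm \<pi> powi n" "vnorm \<pi> powi n \<le> vnorm \<pi> powi m" by simp_all
  then show "n = m" unfolding vnorm_pi_powi_le_iff by (rule antisym)
qed simp

lemma ex_vnorm_pi_powi_less:
  assumes "0 < e" obtains N :: nat where "vnorm \<pi> powi (int N) < e"
  using real_arch_pow_inv[OF assms vnorm_pi_less_1] by auto

lemma ex_in_B:
  fixes x :: 'k
  obtains N :: nat where "x \<in> B (- int N)"
proof (cases "x = 0")
  case True
  then show ?thesis using that[of 0] by (simp add: in_B_iff)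
next
  case False
  then obtain N :: nat where N: "vnorm \<pi> powi (int N) < 1 / vnorm x"
    using ex_vnorm_pi_powi_less[of "1 / vnorm x"] by auto
  then have "vnorm \<pi> ^ N * vnorm x < 1"
    using False by (simp add: pos_less_divide_eq)
  then have "vnorm x \<le> 1 / vnorm \<pi> ^ N"
    using vnorm_pi_pos by (subst pos_le_divide_eq) (auto simp: mult.commute)
  then have "vnorm x \<le> vnorm \<pi> powi (- int N)"
    by (simp add: power_int_minus inverse_eq_divide)
  then show ?thesis using that by (simp add: in_B_iff)
qed

text \<open>For the largest \<open>n\<close> with \<open>x \<in> B n\<close>, the quotient of
  \<open>x\<close> by the \<open>n\<close>-th power of \<pi> is integral. If it were smaller than 1,
  it would be a multiple of \<pi> by the definition of a uniformizer, contradicting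
  maximality.\<close>

lemma ex_vnorm_eq:
  fixes x :: 'k
  assumes "x \<noteq> 0"
  shows "\<exists>n. vnorm x = vnorm \<pi> powi n"
proof -
  obtain N :: nat where N: "x \<in> B (- int N)" by (rule ex_in_B)
  obtain M :: nat where M: "vnorm \<pi> powi (int M) < vnorm x"
    using ex_vnorm_pi_powi_less[of "vnorm x"] assms by auto
  define k where "k = (GREATEST k::nat. x \<in> B (int k - int N))"
  have bound: "k \<le> N + M" if "x \<in> B (int k - int N)" for k
  proof (rule ccontr)
    assume "\<not> k \<le> N + M"
    then have "vnorm \<pi> powi (int k - int N) \<le> vnorm \<pi> powi (int M)"
      by (simp only: vnorm_pi_powi_le_iff)
    then show False using that M by (simp add: in_B_iff)
  qed
  have "x \<in> B (int 0 - int N)" using N by simp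
  then have k: "x \<in> B (int k - int N)"
    unfolding k_def using bound by (rule GreatestI_nat)
  have k': "x \<notin> B (int (Suc k) - int N)"
  proof
    assume "x \<in> B (int (Suc k) - int N)"
    then have "Suc k \<le> k"
      unfolding k_def using bound by (rule Greatest_le_nat)
    then show False by simp
  qed
  define n where "n = int k - int N"
  have n: "vnorm x \<le> vnorm \<pi> powi n" "\<not> vnorm x \<le> vnorm \<pi> powi (n + 1)"
    using k k' by (auto simp: in_B_iff n_def algebra_simps)
  have "\<not> vnorm (x / \<pi> powi n) < 1"
  proof
    assume "vnorm (x / \<pi> powi n) < 1"
    then have "vnorm (x / \<pi> powi n) \<le> vnorm \<pi>"
      using B_1 by (simp add: in_B_iff)
    then show False
      using n(2) vnorm_pi_pos by (simp add: vnorm_divide vnorm_powi power_int_add field_simps)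
  qed
  then have "vnorm \<pi> powi n \<le> vnorm x"
    using vnorm_pi_pos by (simp add: vnorm_divide vnorm_powi field_simps)
  with n(1) show ?thesis by (intro exI[of _ n]) simp
qed

text \<open>\<open>val 0\<close> is unspecified, as no power of \<open>vnorm \<pi>\<close> vanishes;
  the definitions built on it treat 0 separately.\<close>

definition val :: "'k \<Rightarrow> int" where "val x = (THE n. vnorm x = vnorm \<pi> powi n)"

lemma vnorm_eq_val:
  fixes x :: 'k
  assumes "x \<noteq> 0" shows "vnorm x = vnorm \<pi> powi (val x)"
proof -
  have "\<exists>!n. vnorm x = vnorm \<pi> powi n"
    using ex_vnorm_eq[OF assms] by (metis vnorm_pi_powi_eq_iff)
  then show ?thesis unfolding val_def by (rule theI')
qed

lemma val_eqI: "vnorm x = vnorm \<pi> powi n \<Longrightarrow> val x = n"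
  using vnorm_eq_val[of x] vnorm_pi_powi_eq_iff pi_nz by (cases "x = 0") auto

lemma in_B_val_iff: "x \<noteq> 0 \<Longrightarrow> x \<in> B n \<longleftrightarrow> n \<le> val x"
  unfolding in_B_iff vnorm_eq_val[of x] vnorm_pi_powi_le_iff ..

lemma val_mult: "x \<noteq> 0 \<Longrightarrow> y \<noteq> 0 \<Longrightarrow> val (x * y) = val x + val y"
  by (rule val_eqI) (simp add: vnorm_mult vnorm_eq_val[of x] vnorm_eq_val[of y] power_int_add)

lemma val_pi_powi: "val (\<pi> powi n) = n"
  by (rule val_eqI) (simp add: vnorm_powi)

lemma val_unit: "vnorm x = 1 \<Longrightarrow> val x = 0"
  by (rule val_eqI) simp

lemma unit_part: "x \<noteq> 0 \<Longrightarrow> vnorm (x / \<pi> powi (val x)) = 1"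
  by (simp add: vnorm_divide vnorm_powi vnorm_eq_val[symmetric])

lemma zero_in_B [simp]: "0 \<in> B n"
  by (simp add: in_B_iff)

lemma B_add: "x \<in> B n \<Longrightarrow> y \<in> B n \<Longrightarrow> x + y \<in> B n"
  by (simp add: in_B_iff vnorm_add_le)

lemma B_diff: "x \<in> B n \<Longrightarrow> y \<in> B n \<Longrightarrow> x - y \<in> B n"
  by (simp add: in_B_iff vnorm_diff_le)

lemma B_minus_iff [simp]: "- x \<in> B n \<longleftrightarrow> x \<in> B n"
  by (simp add: in_B_iff)

lemma B_diff_commute: "x - y \<in> B n \<longleftrightarrow> y - x \<in> B n"
  by (simp add: in_B_iff vnorm_minus_commute)

lemma B_diff_trans: "x - y \<in> B n \<Longrightarrow> y - z \<in> B n \<Longrightarrow> x - z \<in> B n"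
  using B_add[of "x - y" n "y - z"] by simp

lemma B_diff_cancel: "x - y \<in> B n \<Longrightarrow> x \<in> B n \<longleftrightarrow> y \<in> B n"
  using B_add[of "x - y" n y] B_diff[of x n "x - y"] by auto

lemma B_mult: "x \<in> B m \<Longrightarrow> y \<in> B n \<Longrightarrow> x * y \<in> B (m + n)"
  by (simp add: in_B_iff vnorm_mult power_int_add pi_nz mult_mono)

lemma B_mono: "x \<in> B n \<Longrightarrow> m \<le> n \<Longrightarrow> x \<in> B m"
  using vnorm_pi_powi_le_iff[of n m] by (simp add: in_B_iff)

lemma powi_mult_in_B_iff: "\<pi> powi k * x \<in> B n \<longleftrightarrow> x \<in> B (n - k)"
  using vnorm_pi_pos by (simp add: in_B_iff vnorm_mult vnorm_powi power_int_diff field_simps)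

lemma unit_mult_in_B_iff: "vnorm u = 1 \<Longrightarrow> u * x \<in> B n \<longleftrightarrow> x \<in> B n"
  by (simp add: in_B_iff vnorm_mult)

lemma compact_B: "compact (B n)"
proof -
  have "B n = {x. vnorm x \<le> vnorm \<pi> powi n}" by (auto simp: in_B_iff)
  then show ?thesis using compact_vnorm_ball by simp
qed

text \<open>The value group is discrete, so the closed condition of level \<open>n\<close> is the
  strict inequality one level lower.\<close>

lemma open_coset: "open {y. y - x \<in> B n}"
proof -
  have "{y. y - x \<in> B n} = {y. vnorm (y - x) < vnorm \<pi> powi (n - 1)}"
  proof -
    have "z \<in> B n \<longleftrightarrow> vnorm z < vnorm \<pi> powi (n - 1)" for z
    proof -
      have "z \<in> B n \<longleftrightarrow> \<pi> powi (1 - n) * z \<in> B 1" by (simp add: powi_mult_in_B_iff)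
      also have "\<dots> \<longleftrightarrow> vnorm z < vnorm \<pi> powi (n - 1)"
        unfolding B_1 using vnorm_pi_pos
        by (simp add: vnorm_mult vnorm_divide vnorm_powi power_int_diff field_simps)
      finally show ?thesis .
    qed
    then show ?thesis by simp
  qed
  then show ?thesis by (simp add: open_vnorm_ball)
qed

text \<open>Limits at 0 are unique only for a nontrivial filter; the value \<open>Lim (at 0)\<close>
  in \<open>twist\<close> depends on this.\<close>

lemma at_0_nontrivial: "at (0::'k) \<noteq> bot"
proof -
  have "\<not> open {0::'k}"
  proof
    assume "open {0::'k}"
    then obtain e where e: "e > 0" "ball (0::'k) e \<subseteq> {0}"
      unfolding open_contains_ball by auto
    obtain N :: nat where "vnorm \<pi> powi (int N) < e"
      using ex_vnorm_pi_powi_less[OF e(1)] by blast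
    then have "\<pi> ^ N \<in> ball 0 e" by (simp add: dist_vnorm vnorm_power)
    then have "\<pi> ^ N \<in> {0}" using e(2) by blast
    then show False by simp
  qed
  then show ?thesis unfolding at_eq_bot_iff .
qed

section \<open>Coset representatives and refinement of finite sums\<close>

definition rep :: "int \<Rightarrow> 'k \<Rightarrow> 'k" where "rep n x = (SOME y. y - x \<in> B n)"

lemma rep_diff: "rep n x - x \<in> B n"
  unfolding rep_def by (rule someI[of _ x]) simp

lemma diff_rep: "x - rep n x \<in> B n"
  using rep_diff[of n x] B_diff_commute[of "rep n x" x n] by blast

text \<open>The predicate behind the choice depends only on the coset of \<open>x\<close>, hence so
  does the chosen element. Sums over cosets thus become finite sums over points of
  \<open>K\<close>.\<close>

lemma rep_eq_iff: "rep n x = rep n y \<longleftrightarrow> x - y \<in> B n"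
proof
  assume "rep n x = rep n y"
  then show "x - y \<in> B n"
    using B_diff_trans[OF diff_rep[of x n], of y] rep_diff[of n y] by simp
next
  assume *: "x - y \<in> B n"
  have "z - x \<in> B n \<longleftrightarrow> z - y \<in> B n" for z
    using * B_diff_trans[of z x n y] B_diff_trans[of z y n x] B_diff_commute[of x y n] by blast
  then show "rep n x = rep n y" by (simp add: rep_def)
qed

lemma rep_rep: "n \<le> m \<Longrightarrow> rep n (rep m x) = rep n x"
  using rep_diff[of m x] by (auto simp: rep_eq_iff intro: B_mono)

lemma rep_rep_same [simp]: "rep n (rep n x) = rep n x"
  by (simp add: rep_rep)

lemma rep_in_B_iff: "m \<le> n \<Longrightarrow> rep n x \<in> B m \<longleftrightarrow> x \<in> B m"
  using B_diff_cancel[OF B_mono[OF rep_diff[of n x]]] .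

lemma finite_rep_B: "finite (rep n ` B m)"
proof -
  have "\<exists>T. finite T \<and> B m \<subseteq> (\<Union>x\<in>T. ball x (vnorm \<pi> powi n))"
    using compact_B[of m] vnorm_pi_pos unfolding compact_eq_totally_bounded by simp
  then obtain T where T: "finite T" "B m \<subseteq> (\<Union>x\<in>T. ball x (vnorm \<pi> powi n))"
    by blast
  have "rep n ` B m \<subseteq> rep n ` T"
  proof
    fix y assume "y \<in> rep n ` B m"
    then obtain x t where "y = rep n x" "t \<in> T" "x \<in> ball t (vnorm \<pi> powi n)"
      using T by blast
    moreover from this have "t - x \<in> B n" by (auto simp: in_B_iff dist_vnorm)
    ultimately show "y \<in> rep n ` T" using rep_eq_iff[of n t x] by (metis image_eqI)
  qed
  then show ?thesis using T finite_subset by blast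
qed

abbreviation q :: nat where "q \<equiv> residue_card \<pi>"

lemma q_eq_card_rep: "q = card (rep 1 ` B 0)"
proof -
  have "(+) x ` B 1 = (+) y ` B 1 \<longleftrightarrow> rep 1 x = rep 1 y" for x y
  proof
    assume "(+) x ` B 1 = (+) y ` B 1"
    then have "x + 0 \<in> (+) y ` B 1" by (metis imageI zero_in_B)
    then show "rep 1 x = rep 1 y" by (auto simp: rep_eq_iff)
  next
    assume "rep 1 x = rep 1 y"
    then have xy: "x - y \<in> B 1" by (simp add: rep_eq_iff)
    have "z \<in> (+) x ` B 1 \<longleftrightarrow> z - x \<in> B 1" for z x
      by (auto intro: image_eqI[of _ _ "z - x"])
    moreover have "z - x \<in> B 1 \<longleftrightarrow> z - y \<in> B 1" for z
      using xy B_diff_trans[of z x 1 y] B_diff_trans[of z y 1 x] B_diff_commute[of x y 1] by blast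
    ultimately show "(+) x ` B 1 = (+) y ` B 1" by blast
  qed
  moreover have "valuation_ring = B 0" by (auto simp: valuation_ring_def in_B_iff)
  ultimately show ?thesis
    unfolding residue_card_def
    using card_image_eq_if_same_kernel[of "B 0" "\<lambda>x. (+) x ` B 1" "rep 1"] by simp
qed

lemma q_pos: "0 < q"
  unfolding q_eq_card_rep using finite_rep_B[of 1 0] zero_in_B[of 0]
  by (metis card_gt_0_iff empty_iff image_is_empty)

lemma card_rep_coset: "card (rep (n + 1) ` {x. x - y \<in> B n}) = q"
proof -
  have "{x. x - y \<in> B n} = (\<lambda>u. y + \<pi> powi n * u) ` B 0" (is "?L = ?R")
  proof (intro equalityI subsetI)
    fix x assume "x \<in> ?L"
    then have "(x - y) / \<pi> powi n \<in> B 0"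
      using powi_mult_in_B_iff[of n "(x - y) / \<pi> powi n" n] by simp
    then show "x \<in> ?R" by (intro image_eqI[of _ _ "(x - y) / \<pi> powi n"]) auto
  qed (auto simp: powi_mult_in_B_iff)
  then have "rep (n + 1) ` {x. x - y \<in> B n} = (\<lambda>u. rep (n + 1) (y + \<pi> powi n * u)) ` B 0"
    by (simp add: image_image)
  moreover have "card ((\<lambda>u. rep (n + 1) (y + \<pi> powi n * u)) ` B 0) = card (rep 1 ` B 0)"
  proof (rule card_image_eq_if_same_kernel)
    fix u v
    have "(y + \<pi> powi n * u) - (y + \<pi> powi n * v) = \<pi> powi n * (u - v)"
      by (simp add: algebra_simps)
    then show "rep (n + 1) (y + \<pi> powi n * u) = rep (n + 1) (y + \<pi> powi n * v) \<longleftrightarrow> rep 1 u = rep 1 v"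
      by (simp only: rep_eq_iff powi_mult_in_B_iff) simp
  qed
  ultimately show ?thesis by (simp add: q_eq_card_rep)
qed

definition periodic :: "int \<Rightarrow> ('k \<Rightarrow> 'a) \<Rightarrow> bool" where
  "periodic n g \<longleftrightarrow> (\<forall>x y. x - y \<in> B n \<longrightarrow> g x = g y)"

definition supported :: "int \<Rightarrow> ('k \<Rightarrow> 'a::zero) \<Rightarrow> bool" where
  "supported m g \<longleftrightarrow> (\<forall>x. x \<notin> B m \<longrightarrow> g x = 0)"

lemma periodic_mono: "periodic n g \<Longrightarrow> n \<le> n' \<Longrightarrow> periodic n' g"
  unfolding periodic_def using B_mono by blast

lemma supported_mono: "supported m g \<Longrightarrow> m' \<le> m \<Longrightarrow> supported m' g"
  unfolding supported_def using B_mono by blast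

lemma periodic_continuous:
  assumes "periodic n (g :: 'k \<Rightarrow> 'a::topological_space)"
  shows "continuous_on UNIV g"
proof -
  have "\<exists>T. open T \<and> x \<in> T \<and> (\<forall>y\<in>UNIV. y \<in> T \<longrightarrow> g y \<in> S)" if "g x \<in> S" for x S
  proof (intro exI conjI ballI impI)
    show "open {y. y - x \<in> B n}" by (rule open_coset)
    show "g y \<in> S" if "y \<in> {y. y - x \<in> B n}" for y
      using that assms \<open>g x \<in> S\<close> unfolding periodic_def by (metis mem_Collect_eq)
  qed simp
  then show ?thesis unfolding continuous_on_topological by simp
qed

text \<open>Each coset of \<open>B n\<close> splits into \<open>q\<close> cosets of
  \<open>B (n + 1)\<close>, and \<open>g\<close> is constant on it. The factor \<open>q\<close> will
  cancel against the ratio of consecutive volumes.\<close>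

lemma sum_refine:
  fixes g :: "'k \<Rightarrow> 'c::nonarch_field"
  assumes "periodic n g" "m \<le> n"
  shows "(\<Sum>x\<in>rep (n + 1) ` B m. g x) = of_nat q * (\<Sum>x\<in>rep n ` B m. g x)"
proof -
  let ?S = "rep (n + 1) ` B m"
  have "sum g ?S = (\<Sum>y\<in>rep n ` ?S. sum g {x \<in> ?S. rep n x = y})"
    by (rule sum.image_gen) (rule finite_rep_B)
  also have "rep n ` ?S = rep n ` B m"
    by (simp add: image_image rep_rep)
  also have "(\<Sum>y\<in>rep n ` B m. sum g {x \<in> ?S. rep n x = y}) = (\<Sum>y\<in>rep n ` B m. of_nat q * g y)"
  proof (rule sum.cong)
    fix y assume "y \<in> rep n ` B m"
    then have y: "rep n y = y" "y \<in> B m"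
      using assms(2) by (auto simp: rep_in_B_iff)
    have "{x \<in> ?S. rep n x = y} = rep (n + 1) ` {x. x - y \<in> B n}" (is "?L = ?R")
    proof (intro equalityI subsetI)
      fix x assume "x \<in> ?L"
      then obtain z where z: "x = rep (n + 1) z" "z \<in> B m" "rep n z = rep n y"
        using y by (auto simp: rep_rep)
      then show "x \<in> ?R" by (auto simp: rep_eq_iff)
    next
      fix x assume "x \<in> ?R"
      then obtain z where z: "x = rep (n + 1) z" "z - y \<in> B n" by auto
      then have "z \<in> B m" using y B_diff_cancel[OF B_mono[OF z(2) assms(2)]] by blast
      moreover have "rep n x = y" using z y rep_rep[of n "n + 1" z] rep_eq_iff[of n z y] by simp
      ultimately show "x \<in> ?L" using z by auto
    qed
    moreover have "g x = g y" if "x \<in> {x \<in> ?S. rep n x = y}" for x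
    proof -
      have "x - y \<in> B n" using that y rep_eq_iff[of n x y] by simp
      then show ?thesis using assms(1) by (auto simp: periodic_def)
    qed
    ultimately show "sum g {x \<in> ?S. rep n x = y} = of_nat q * g y"
      by (simp add: card_rep_coset)
  qed simp
  finally show ?thesis by (simp add: sum_distrib_left)
qed

end

subsection \<open>The Haar functional and the integral\<close>

locale haar = local_field \<pi> for \<pi> :: "'k::nonarch_field" +
  fixes \<delta> :: nat and sq :: "'c::nonarch_field"
  assumes sq_square: "sq ^ 2 = of_nat q"
    and q_unit: "vnorm (of_nat q :: 'c) = 1"
    and complete_c: "complete (UNIV :: 'c set)"
begin

lemma vnorm_sq: "vnorm sq = 1"
proof -
  have "vnorm sq ^ 2 = 1"
    using q_unit sq_square by (metis vnorm_power)
  then show ?thesis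
    using vnorm_nonneg[of sq] by (simp add: power2_eq_1_iff)
qed

lemma sq_nz [simp]: "sq \<noteq> 0"
  using vnorm_sq by auto

lemma q_nz [simp]: "q \<noteq> 0"
  using q_pos by simp

definition vol :: "int \<Rightarrow> 'c" where "vol n = sq powi (- 2 * n - int \<delta>)"

lemma vnorm_vol [simp]: "vnorm (vol n) = 1"
  by (simp add: vol_def vnorm_powi vnorm_sq)

lemma vol_nz [simp]: "vol n \<noteq> 0"
  by (simp add: vol_def)

lemma q_powi: "(of_nat q :: 'c) powi n = sq powi (2 * n)"
  by (simp add: sq_square[symmetric] power_int_mult)

lemma vol_add: "vol (n + k) = vol n * of_nat q powi (- k)"
  unfolding q_powi vol_def by (simp add: algebra_simps flip: power_int_add)

lemma vol_Suc: "vol (n + 1) * of_nat q = vol n"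
  by (simp add: vol_add)

definition riemann :: "int \<Rightarrow> int \<Rightarrow> ('k \<Rightarrow> 'c) \<Rightarrow> 'c" where
  "riemann n m g = vol n * (\<Sum>x\<in>rep n ` B m. g x)"

lemma riemann_refine:
  assumes "periodic n g" "m \<le> n" "n \<le> n'"
  shows "riemann n' m g = riemann n m g"
  using assms(3)
proof (induction n' rule: int_ge_induct)
  case (step i)
  have "riemann (i + 1) m g = (vol (i + 1) * of_nat q) * (\<Sum>x\<in>rep i ` B m. g x)"
    using sum_refine[of i g m] periodic_mono[OF assms(1)] assms(2) step.hyps
    by (simp add: riemann_def)
  then show ?case using step.IH by (simp add: riemann_def vol_Suc)
qed simp

lemma riemann_supported:
  assumes "supported m g" "m' \<le> m" "m \<le> n"
  shows "riemann n m' g = riemann n m g"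
proof -
  have "(\<Sum>x\<in>rep n ` B m'. g x) = (\<Sum>x\<in>rep n ` B m. g x)"
  proof (rule sum.mono_neutral_right)
    show "rep n ` B m \<subseteq> rep n ` B m'"
      using B_mono assms(2) by blast
    show "\<forall>x\<in>rep n ` B m' - rep n ` B m. g x = 0"
    proof
      fix x assume x: "x \<in> rep n ` B m' - rep n ` B m"
      then have "rep n x = x" by auto
      then have "x \<notin> B m" using x by (metis DiffE image_eqI)
      then show "g x = 0" using assms(1) by (simp add: supported_def)
    qed
  qed (rule finite_rep_B)
  then show ?thesis by (simp add: riemann_def)
qed

text \<open>A diagonal choice: as \<open>N\<close> grows, the mesh is refined and the ball exhausts
  \<open>K\<close> at the same time, so one index controls both.\<close>

definition S :: "nat \<Rightarrow> ('k \<Rightarrow> 'c) \<Rightarrow> 'c" where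
  "S N g = riemann (int N) (- int N) g"

definition level :: "nat \<Rightarrow> ('k \<Rightarrow> 'c) \<Rightarrow> bool" where
  "level N g \<longleftrightarrow> periodic (int N) g \<and> supported (- int N) g"

lemma level_mono: "level N g \<Longrightarrow> N \<le> M \<Longrightarrow> level M g"
  using periodic_mono[of "int N" g "int M"] supported_mono[of "- int N" g "- int M"]
  unfolding level_def by simp

lemma S_level: "level N g \<Longrightarrow> N \<le> M \<Longrightarrow> S M g = S N g"
  unfolding S_def level_def
  using riemann_refine[of "int N" g "- int N" "int M"] riemann_supported[of "- int N" g "- int M" "int M"]
  by simp

lemma S_add: "S N (\<lambda>x. g x + h x) = S N g + S N h"
  by (simp add: S_def riemann_def sum.distrib algebra_simps)

lemma S_diff: "S N (\<lambda>x. g x - h x) = S N g - S N h"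
  by (simp add: S_def riemann_def sum_subtractf algebra_simps)

lemma S_cmult: "S N (\<lambda>x. a * g x) = a * S N g"
  by (simp add: S_def riemann_def sum_distrib_left algebra_simps)

lemma S_bound:
  assumes "\<And>x. vnorm (g x) \<le> e" shows "vnorm (S N g) \<le> e"
proof -
  have "0 \<le> e" using assms[of 0] vnorm_nonneg order_trans by blast
  then show ?thesis
    unfolding S_def riemann_def vnorm_mult vnorm_vol using assms by (simp add: vnorm_sum_le)
qed

text \<open>Compactness of the support yields a Lebesgue number for the cover by open sets on which
  \<open>g\<close> is constant, hence one mesh valid everywhere; boundedness yields the ball. Two
  points off the closure of the support share the value 0.\<close>

lemma test_function_iff_level: "test_function g \<longleftrightarrow> (\<exists>N. level N g)"
proof
  assume g: "test_function g"
  let ?C = "closure {x. g x \<noteq> 0}"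
  let ?G = "{U. open U \<and> (\<forall>x\<in>U. \<forall>y\<in>U. g x = g y)}"
  have C: "compact ?C" using g by (simp add: test_function_def)
  have cover: "?C \<subseteq> \<Union>?G"
  proof
    fix x
    obtain U where "open U" "x \<in> U" "\<forall>y\<in>U. g y = g x"
      using g by (auto simp: test_function_def)
    then have "U \<in> ?G" by (intro CollectI conjI ballI) (assumption, metis)
    then show "x \<in> \<Union>?G" using \<open>x \<in> U\<close> by blast
  qed
  have op: "\<And>U. U \<in> ?G \<Longrightarrow> open U" by simp
  obtain e where e: "e > 0" "\<And>x. x \<in> ?C \<Longrightarrow> \<exists>U\<in>?G. ball x e \<subseteq> U"
    by (rule Heine_Borel_lemma[OF C cover]) (erule op, rule that)
  obtain N where N: "vnorm \<pi> powi (int N) < e"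
    using ex_vnorm_pi_powi_less[OF e(1)] by blast
  have near: "g x = g y" if xy: "x - y \<in> B (int N)" and xC: "x \<in> ?C" for x y
  proof -
    obtain U where U: "U \<in> ?G" "ball x e \<subseteq> U" using e(2)[OF xC] by blast
    have "y \<in> ball x e" using xy N by (simp add: in_B_iff dist_vnorm)
    moreover have "x \<in> ball x e" using e(1) by simp
    ultimately have "x \<in> U" "y \<in> U" using U(2) by blast+
    then show ?thesis using U(1) by blast
  qed
  have per: "periodic (int N) g"
    unfolding periodic_def
  proof (intro allI impI)
    fix x y assume xy: "x - y \<in> B (int N)"
    show "g x = g y"
    proof (cases "x \<in> ?C \<or> y \<in> ?C")
      case True
      then show ?thesis
      proof
        assume "x \<in> ?C"
        then show ?thesis by (rule near[OF xy])
      next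
        assume "y \<in> ?C"
        then have "g y = g x" by (rule near[OF B_diff_commute[THEN iffD1, OF xy]])
        then show ?thesis ..
      qed
    next
      case False
      then have "x \<notin> {x. g x \<noteq> 0}" "y \<notin> {x. g x \<noteq> 0}"
        using subsetD[OF closure_subset[of "{x. g x \<noteq> 0}"]] by blast+
      then show ?thesis by simp
    qed
  qed
  have "bounded ?C" using C by (rule compact_imp_bounded)
  then obtain r where r: "\<And>x. x \<in> ?C \<Longrightarrow> dist 0 x \<le> r"
    using bounded_any_center[of ?C 0] by auto
  define R where "R = max r 1"
  have R: "0 < R" by (simp add: R_def)
  then have "0 < 1 / R" by simp
  then obtain M where M: "vnorm \<pi> powi (int M) < 1 / R"
    by (rule ex_vnorm_pi_powi_less)
  have "supported (- int M) g"
    unfolding supported_def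
  proof (intro allI impI)
    fix x assume x: "x \<notin> B (- int M)"
    show "g x = 0"
    proof (rule ccontr)
      assume "g x \<noteq> 0"
      then have "x \<in> ?C" using subsetD[OF closure_subset[of "{x. g x \<noteq> 0}"], of x] by simp
      then have "vnorm x \<le> R" using r[of x] by (simp add: dist_vnorm R_def)
      moreover have "R < 1 / vnorm \<pi> ^ M"
        using M R vnorm_pi_pos by (simp add: less_divide_eq mult.commute)
      ultimately have "vnorm x \<le> vnorm \<pi> powi (- int M)"
        by (simp add: power_int_minus inverse_eq_divide)
      with x show False by (simp add: in_B_iff)
    qed
  qed
  then have "level (max N M) g"
    using periodic_mono[OF per, of "int (max N M)"] supported_mono[of "- int M" g "- int (max N M)"]
    unfolding level_def by simp
  then show "\<exists>N. level N g" ..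
next
  assume "\<exists>N. level N g"
  then obtain N where N: "periodic (int N) g" "supported (- int N) g"
    by (auto simp: level_def)
  show "test_function g"
    unfolding test_function_def
  proof (intro conjI allI)
    fix x
    show "\<exists>U. open U \<and> x \<in> U \<and> (\<forall>y\<in>U. g y = g x)"
    proof (intro exI conjI ballI)
      show "open {y. y - x \<in> B (int N)}" by (rule open_coset)
      show "g y = g x" if "y \<in> {y. y - x \<in> B (int N)}" for y
        using that N(1) unfolding periodic_def by blast
    qed simp
    have "{x. g x \<noteq> 0} \<subseteq> B (- int N)" using N(2) by (auto simp: supported_def)
    moreover have "closed (B (- int N))" using compact_B by (rule compact_imp_closed)
    ultimately have "closure {x. g x \<noteq> 0} \<subseteq> B (- int N)" by (rule closure_minimal)
    then have "closure {x. g x \<noteq> 0} = closure {x. g x \<noteq> 0} \<inter> B (- int N)" by blast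
    then show "compact (closure {x. g x \<noteq> 0})"
      using closed_Int_compact[OF closed_closure compact_B, of "{x. g x \<noteq> 0}" "- int N"] by simp
  qed
qed

lemma level_add: "level N g \<Longrightarrow> level N h \<Longrightarrow> level N (\<lambda>x. g x + h x)"
  unfolding level_def periodic_def supported_def by (metis add_0)

lemma level_cmult: "level N g \<Longrightarrow> level N (\<lambda>x. a * g x)"
  unfolding level_def periodic_def supported_def by (metis mult_zero_right)

text \<open>The choice of the level is immaterial by refinement. The value 0 off the test functions
  matches the normalization in \<open>haar_functional\<close>.\<close>

definition D0 :: "('k \<Rightarrow> 'c) \<Rightarrow> 'c" where
  "D0 g = (if test_function g then S (SOME N. level N g) g else 0)"

lemma D0_level: assumes "level N g" shows "D0 g = S N g"
proof -
  let ?M = "SOME N. level N g"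
  have "level ?M g" using assms by (rule someI)
  then have "S ?M g = S N g"
    using assms S_level[of N g "max N ?M"] S_level[of ?M g "max N ?M"] by simp
  then show ?thesis using assms test_function_iff_level by (auto simp: D0_def)
qed

lemma in_translate_B_iff: "x \<in> (+) a ` B n \<longleftrightarrow> x - a \<in> B n"
  by (auto intro: image_eqI[of _ _ "x - a"])

lemma indicator_coset_eq:
  "x - y \<in> B n \<Longrightarrow> indicator ((+) a ` B n) x = (indicator ((+) a ` B n) y :: 'c)"
  using B_diff_trans[of x y n a] B_diff_trans[of y x n a] B_diff_commute[of x y n]
  by (auto simp: indicator_def in_translate_B_iff)

lemma periodic_indicator: "periodic n (indicator ((+) a ` B n) :: 'k \<Rightarrow> 'c)"
  using indicator_coset_eq by (auto simp: periodic_def)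

lemma level_indicator:
  assumes "- int N \<le> n" "n \<le> int N" "a \<in> B (- int N)"
  shows "level N (indicator ((+) a ` B n) :: 'k \<Rightarrow> 'c)"
  unfolding level_def
proof
  show "periodic (int N) (indicator ((+) a ` B n) :: 'k \<Rightarrow> 'c)"
    by (rule periodic_mono[OF periodic_indicator assms(2)])
  have "x \<in> B (- int N)" if "x - a \<in> B n" for x
    using B_diff_cancel[OF B_mono[OF that assms(1)]] assms(3) by simp
  then show "supported (- int N) (indicator ((+) a ` B n) :: 'k \<Rightarrow> 'c)"
    by (auto simp: supported_def indicator_def in_translate_B_iff)
qed

lemma ex_level_indicator: "\<exists>N. level N (indicator ((+) a ` B n) :: 'k \<Rightarrow> 'c) \<and> - int N \<le> n \<and> n \<le> int N \<and> a \<in> B (- int N)"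
proof -
  obtain M where M: "a \<in> B (- int M)" by (rule ex_in_B)
  define N where "N = M + nat \<bar>n\<bar>"
  have "- int N \<le> n" "n \<le> int N" "a \<in> B (- int N)"
    using M by (auto simp: N_def intro: B_mono)
  then show ?thesis using level_indicator by blast
qed

lemma S_indicator:
  assumes "- int N \<le> n" "n \<le> int N" "a \<in> B (- int N)"
  shows "S N (indicator ((+) a ` B n)) = vol n"
proof -
  have "S N (indicator ((+) a ` B n)) = riemann n (- int N) (indicator ((+) a ` B n))"
    unfolding S_def by (rule riemann_refine[OF periodic_indicator assms(1,2)])
  also have "(\<Sum>x\<in>rep n ` B (- int N). indicator ((+) a ` B n) x) = (\<Sum>x\<in>{rep n a}. 1 :: 'c)"
  proof (rule sum.mono_neutral_cong_right)
    show "\<forall>x\<in>rep n ` B (- int N) - {rep n a}. indicator ((+) a ` B n) x = (0::'c)"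
    proof
      fix x assume x: "x \<in> rep n ` B (- int N) - {rep n a}"
      then have "rep n x \<noteq> rep n a" by auto
      then show "indicator ((+) a ` B n) x = (0::'c)"
        by (simp add: rep_eq_iff in_translate_B_iff indicator_def)
    qed
  qed (auto simp: finite_rep_B assms indicator_def in_translate_B_iff rep_diff)
  then have "riemann n (- int N) (indicator ((+) a ` B n)) = vol n"
    by (simp add: riemann_def)
  finally show ?thesis .
qed

lemma level_expand:
  assumes "level N g"
  shows "g x = (\<Sum>y\<in>rep (int N) ` B (- int N). g y * indicator ((+) y ` B (int N)) x)"
proof -
  let ?T = "rep (int N) ` B (- int N)" and ?r = "rep (int N) x"
  have ind: "indicator ((+) y ` B (int N)) x = (if y = ?r then 1 else 0 :: 'c)" if "y \<in> ?T" for y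
  proof -
    have "y = rep (int N) y" using that by auto
    then have "x - y \<in> B (int N) \<longleftrightarrow> ?r = y"
      using rep_eq_iff[of "int N" x y] by simp
    then show ?thesis by (auto simp: indicator_def in_translate_B_iff)
  qed
  have "(\<Sum>y\<in>?T. g y * indicator ((+) y ` B (int N)) x) = (\<Sum>y\<in>?T. if y = ?r then g y else 0)"
    by (rule sum.cong) (auto simp: ind)
  also have "\<dots> = (if ?r \<in> ?T then g ?r else 0)"
    by (simp add: finite_rep_B)
  also have "\<dots> = g x"
  proof -
    have gr: "g ?r = g x"
      using assms rep_diff[of "int N" x] by (auto simp: level_def periodic_def)
    have "g x = 0" if "?r \<notin> ?T"
    proof -
      have "x \<notin> B (- int N)" using that by blast
      then show ?thesis using assms by (simp add: level_def supported_def)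
    qed
    with gr show ?thesis by auto
  qed
  finally show ?thesis by simp
qed

lemma level_sum:
  assumes "finite F" "\<And>i. i \<in> F \<Longrightarrow> level N (h i)"
  shows "level N (\<lambda>x. \<Sum>i\<in>F. h i x)"
  using assms
proof (induction F rule: finite_induct)
  case empty
  then show ?case by (simp add: level_def periodic_def supported_def)
qed (simp add: level_add)

text \<open>A test function is a finite combination of coset indicators. The factor \<kappa> admits
  multiples of the Haar functional: \<kappa> = 1 gives uniqueness, other values give the change of
  variables.\<close>

lemma haar_functional_unique:
  assumes add: "\<And>g h. test_function g \<Longrightarrow> test_function h \<Longrightarrow> D (\<lambda>x. g x + h x) = D g + D h"
    and cmult: "\<And>a g. test_function g \<Longrightarrow> D (\<lambda>x. a * g x) = a * (D g :: 'c)"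
    and ind: "\<And>a n. D (indicator ((+) a ` B n)) = vol n * \<kappa>"
    and g: "level N g"
  shows "D g = S N g * \<kappa>"
proof -
  have "level 0 (\<lambda>x. 0)" by (simp add: level_def periodic_def supported_def)
  then have "test_function (\<lambda>x::'k. 0::'c)" using test_function_iff_level by blast
  then have D0: "D (\<lambda>x. 0) = 0"
    using cmult[of "\<lambda>x. 0" 0] by simp
  have lin: "D (\<lambda>x. \<Sum>y\<in>F. g y * indicator ((+) y ` B (int N)) x) = (\<Sum>y\<in>F. g y * (vol (int N) * \<kappa>))"
    if "finite F" "F \<subseteq> B (- int N)" for F
    using that
  proof (induction F rule: finite_induct)
    case (insert y F)
    have lev: "level N (\<lambda>x. g z * indicator ((+) z ` B (int N)) x)" if "z \<in> B (- int N)" for z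
      using level_cmult[OF level_indicator] that by simp
    have "level N (\<lambda>x. \<Sum>y\<in>F. g y * indicator ((+) y ` B (int N)) x)"
      using insert.hyps insert.prems by (intro level_sum lev) auto
    then have t1: "test_function (\<lambda>x. \<Sum>y\<in>F. g y * indicator ((+) y ` B (int N)) x)"
      unfolding test_function_iff_level ..
    have "level N (\<lambda>x. g y * indicator ((+) y ` B (int N)) x)"
      using lev insert.prems by simp
    then have t2: "test_function (\<lambda>x. g y * indicator ((+) y ` B (int N)) x)"
      unfolding test_function_iff_level ..
    have "level N (indicator ((+) y ` B (int N)) :: 'k \<Rightarrow> 'c)"
      using insert.prems by (intro level_indicator) auto
    then have t3: "test_function (indicator ((+) y ` B (int N)) :: 'k \<Rightarrow> 'c)"
      unfolding test_function_iff_level ..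
    have "D (\<lambda>x. \<Sum>y\<in>insert y F. g y * indicator ((+) y ` B (int N)) x) =
        D (\<lambda>x. g y * indicator ((+) y ` B (int N)) x + (\<Sum>y\<in>F. g y * indicator ((+) y ` B (int N)) x))"
      by (simp only: sum.insert[OF insert.hyps])
    also have "\<dots> = g y * (vol (int N) * \<kappa>) + (\<Sum>y\<in>F. g y * (vol (int N) * \<kappa>))"
      unfolding add[OF t2 t1] cmult[OF t3] ind using insert by simp
    finally show ?case using insert.hyps by simp
  qed (simp add: D0)
  have T: "rep (int N) ` B (- int N) \<subseteq> B (- int N)"
    by (auto simp: rep_in_B_iff)
  have "g = (\<lambda>x. \<Sum>y\<in>rep (int N) ` B (- int N). g y * indicator ((+) y ` B (int N)) x)"
    using level_expand[OF g] by (rule ext)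
  then have "D g = D (\<lambda>x. \<Sum>y\<in>rep (int N) ` B (- int N). g y * indicator ((+) y ` B (int N)) x)"
    by (rule arg_cong)
  also have "\<dots> = (\<Sum>y\<in>rep (int N) ` B (- int N). g y * (vol (int N) * \<kappa>))"
    by (rule lin[OF finite_rep_B T])
  finally show ?thesis
    by (simp add: S_def riemann_def sum_distrib_left sum_distrib_right mult.commute mult.left_commute)
qed

lemma haar_functional_eq: "haar_functional \<pi> \<delta> sq = D0"
  unfolding haar_functional_def
proof (rule the_equality)
  have "D0 (\<lambda>x. g x + h x) = D0 g + D0 h" if gh: "test_function g" "test_function h" for g h
  proof -
    obtain N M where "level N g" "level M h"
      using gh unfolding test_function_iff_level by auto
    then have l: "level (max N M) g" "level (max N M) h"
      using level_mono[of N g "max N M"] level_mono[of M h "max N M"] by auto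
    show ?thesis
      unfolding D0_level[OF level_add[OF l]] D0_level[OF l(1)] D0_level[OF l(2)] by (rule S_add)
  qed
  moreover have "D0 (\<lambda>x. a * g x) = a * D0 g" if g: "test_function g" for a g
  proof -
    obtain N where l: "level N g"
      using g unfolding test_function_iff_level ..
    show ?thesis
      unfolding D0_level[OF level_cmult[OF l]] D0_level[OF l] by (rule S_cmult)
  qed
  moreover have "D0 (indicator ((+) a ` B n)) = vol n" for a n
  proof -
    obtain N where N: "level N (indicator ((+) a ` B n) :: 'k \<Rightarrow> 'c)"
      "- int N \<le> n" "n \<le> int N" "a \<in> B (- int N)"
      using ex_level_indicator[of a n] by auto
    show ?thesis unfolding D0_level[OF N(1)] by (rule S_indicator[OF N(2-4)])
  qed
  moreover have "\<not> test_function g \<Longrightarrow> D0 g = 0" for g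
    by (simp add: D0_def)
  ultimately show "(\<forall>g h. test_function g \<and> test_function h \<longrightarrow> D0 (\<lambda>x. g x + h x) = D0 g + D0 h) \<and>
     (\<forall>a g. test_function g \<longrightarrow> D0 (\<lambda>x. a * g x) = a * D0 g) \<and>
     (\<forall>a n. D0 (indicator ((+) a ` B n)) = sq powi (- 2 * n - int \<delta>)) \<and>
     (\<forall>g. \<not> test_function g \<longrightarrow> D0 g = 0)"
    by (simp add: vol_def)
next
  fix D :: "('k \<Rightarrow> 'c) \<Rightarrow> 'c"
  assume D: "(\<forall>g h. test_function g \<and> test_function h \<longrightarrow> D (\<lambda>x. g x + h x) = D g + D h) \<and>
     (\<forall>a g. test_function g \<longrightarrow> D (\<lambda>x. a * g x) = a * D g) \<and>
     (\<forall>a n. D (indicator ((+) a ` B n)) = sq powi (- 2 * n - int \<delta>)) \<and>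
     (\<forall>g. \<not> test_function g \<longrightarrow> D g = 0)"
  show "D = D0"
  proof
    fix g
    show "D g = D0 g"
    proof (cases "test_function g")
      case True
      then obtain N where N: "level N g" using test_function_iff_level by blast
      have "D g = S N g * 1"
        by (rule haar_functional_unique[OF _ _ _ N]) (use D in \<open>auto simp: vol_def\<close>)
      then show ?thesis using D0_level[OF N] by simp
    next
      case False
      then show ?thesis using D by (simp add: D0_def)
    qed
  qed
qed

end

section \<open>Dissipative functions\<close>

context local_field
begin

lemma at_inf_tendsto_0_iff:
  fixes f :: "'k \<Rightarrow> 'a::nonarch_field"
  shows "(f \<longlongrightarrow> 0) at_inf \<longleftrightarrow> (\<forall>e>0. \<exists>N::nat. \<forall>x. x \<notin> B (- int N) \<longrightarrow> vnorm (f x) < e)"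
proof -
  have "eventually P at_inf \<longleftrightarrow> (\<exists>N::nat. \<forall>x. x \<notin> B (- int N) \<longrightarrow> P x)" for P :: "'k \<Rightarrow> bool"
  proof
    assume "eventually P at_inf"
    then obtain r where r: "\<And>x. r \<le> vnorm x \<Longrightarrow> P x"
      unfolding at_inf_def eventually_filtercomap eventually_at_top_linorder by blast
    define R where "R = max r 1"
    have R: "0 < R" "r \<le> R" by (auto simp: R_def)
    then have "0 < 1 / R" by simp
    then obtain N :: nat where N: "vnorm \<pi> powi (int N) < 1 / R"
      by (rule ex_vnorm_pi_powi_less)
    have RN: "R < vnorm \<pi> powi (- int N)"
      using N R vnorm_pi_pos by (simp add: power_int_minus inverse_eq_divide less_divide_eq mult.commute)
    have "P x" if "x \<notin> B (- int N)" for x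
    proof (rule r)
      show "r \<le> vnorm x" using that RN R unfolding in_B_iff by linarith
    qed
    then show "\<exists>N::nat. \<forall>x. x \<notin> B (- int N) \<longrightarrow> P x" by blast
  next
    assume "\<exists>N::nat. \<forall>x. x \<notin> B (- int N) \<longrightarrow> P x"
    then obtain N :: nat where N: "\<And>x. x \<notin> B (- int N) \<Longrightarrow> P x" by blast
    have "P x" if "vnorm \<pi> powi (- int N) + 1 \<le> vnorm x" for x
      using that by (intro N) (simp only: in_B_iff)
    moreover have "eventually (\<lambda>r. vnorm \<pi> powi (- int N) + 1 \<le> r) at_top"
      by (rule eventually_ge_at_top)
    ultimately show "eventually P at_inf"
      unfolding at_inf_def eventually_filtercomap by blast
  qed
  then show ?thesis unfolding tendsto_vnorm_iff by simp
qed

text \<open>Uniform continuity and decay at one common scale \<open>N\<close>: exactly what makes a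
  step function of mesh \<open>N\<close> on \<open>B (- int N)\<close> approximate \<open>f\<close>
  within \<open>e\<close>.\<close>

definition good :: "nat \<Rightarrow> ('k \<Rightarrow> 'a::nonarch_field) \<Rightarrow> real \<Rightarrow> bool" where
  "good N f e \<longleftrightarrow> (\<forall>x y. x - y \<in> B (int N) \<longrightarrow> vnorm (f x - f y) \<le> e) \<and>
     (\<forall>x. x \<notin> B (- int N) \<longrightarrow> vnorm (f x) \<le> e)"

lemma good_mono:
  assumes "good N f e" "N \<le> M"
  shows "good M f e"
proof -
  have "x - y \<in> B (int N)" if "x - y \<in> B (int M)" for x y
    using B_mono[OF that, of "int N"] assms(2) by simp
  moreover have "x \<notin> B (- int N)" if "x \<notin> B (- int M)" for x
    using that B_mono[of x "- int N" "- int M"] assms(2) by auto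
  ultimately show ?thesis using assms(1) unfolding good_def by blast
qed

text \<open>Decay settles the outside of a ball, uniform continuity its compact inside. Two points
  close to each other lie on the same side, since the ball is a union of cosets.\<close>

lemma dissipative_good:
  fixes f :: "'k \<Rightarrow> 'a::nonarch_field"
  assumes "dissipative f" "e > 0"
  shows "\<exists>N. good N f e"
proof -
  obtain K :: nat where K: "\<And>x. x \<notin> B (- int K) \<Longrightarrow> vnorm (f x) < e"
    using assms unfolding dissipative_def at_inf_tendsto_0_iff by blast
  have "continuous_on (B (- int K)) f"
    using assms(1) continuous_on_subset unfolding dissipative_def by blast
  then have "uniformly_continuous_on (B (- int K)) f"
    by (rule compact_uniformly_continuous[OF _ compact_B])
  then obtain d where d: "d > 0"
    "\<And>x y. x \<in> B (- int K) \<Longrightarrow> y \<in> B (- int K) \<Longrightarrow> dist y x < d \<Longrightarrow> dist (f y) (f x) < e"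
    unfolding uniformly_continuous_on_def using assms(2) by meson
  obtain M :: nat where M: "vnorm \<pi> powi (int M) < d"
    using d(1) by (rule ex_vnorm_pi_powi_less)
  have "vnorm (f x - f y) \<le> e" if xy: "x - y \<in> B (int (max K M))" for x y
  proof (cases "y \<in> B (- int K)")
    case True
    have "x \<in> B (- int K)"
      using B_diff_cancel[OF B_mono[OF xy, of "- int K"]] True by simp
    moreover have "vnorm (x - y) \<le> vnorm \<pi> powi (int M)"
      using B_mono[OF xy, of "int M"] by (simp add: in_B_iff)
    then have "dist x y < d" using M by (simp add: dist_vnorm)
    ultimately have "dist (f x) (f y) < e" using d(2) True by blast
    then show ?thesis by (simp add: dist_vnorm)
  next
    case False
    then have "x \<notin> B (- int K)"
      using B_diff_cancel[OF B_mono[OF xy, of "- int K"]] by simp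
    then show ?thesis using K[of x] K[of y] False by (intro vnorm_diff_le) auto
  qed
  moreover have "vnorm (f x) \<le> e" if "x \<notin> B (- int (max K M))" for x
  proof -
    have "x \<notin> B (- int K)" using that B_mono[of x "- int K" "- int (max K M)"] by auto
    then show ?thesis using K[of x] by simp
  qed
  ultimately have "good (max K M) f e" unfolding good_def by blast
  then show ?thesis ..
qed

lemma dissipative_bounded:
  fixes f :: "'k \<Rightarrow> 'a::nonarch_field"
  assumes "dissipative f" "e > 0"
  shows "\<exists>N::nat. \<forall>x. x \<notin> B (- int N) \<longrightarrow> vnorm (f x) \<le> e"
  using dissipative_good[OF assms] unfolding good_def by blast

lemma dissipativeI:
  fixes f :: "'k \<Rightarrow> 'a::nonarch_field"
  assumes "continuous_on UNIV f" "\<And>e. e > 0 \<Longrightarrow> \<exists>N::nat. \<forall>x. x \<notin> B (- int N) \<longrightarrow> vnorm (f x) \<le> e"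
  shows "dissipative f"
  unfolding dissipative_def at_inf_tendsto_0_iff
proof (intro conjI allI impI assms(1))
  fix e :: real assume "e > 0"
  then obtain N :: nat where N: "\<And>x. x \<notin> B (- int N) \<Longrightarrow> vnorm (f x) \<le> e / 2"
    using assms(2)[of "e / 2"] by auto
  have "vnorm (f x) < e" if "x \<notin> B (- int N)" for x
    using N[OF that] \<open>e > 0\<close> by simp
  then show "\<exists>N::nat. \<forall>x. x \<notin> B (- int N) \<longrightarrow> vnorm (f x) < e" by blast
qed

lemma dissipative_continuous: "dissipative f \<Longrightarrow> continuous_on UNIV f"
  by (simp add: dissipative_def)

lemma dissipative_cmult:
  fixes f :: "'k \<Rightarrow> 'a::nonarch_field"
  assumes "dissipative f" shows "dissipative (\<lambda>x. a * f x)"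
  using tendsto_mult[OF tendsto_const, of f 0 at_inf a] continuous_on_mult'[OF continuous_on_const, of UNIV f a] assms
  by (simp add: dissipative_def)

lemma dissipative_add:
  fixes f :: "'k \<Rightarrow> 'a::nonarch_field"
  assumes "dissipative f" "dissipative g" shows "dissipative (\<lambda>x. f x + g x)"
  using tendsto_add[of f 0 at_inf g 0] continuous_on_add[of UNIV f g] assms
  by (simp add: dissipative_def)

lemma dissipative_diff:
  fixes f :: "'k \<Rightarrow> 'a::nonarch_field"
  assumes "dissipative f" "dissipative g" shows "dissipative (\<lambda>x. f x - g x)"
  using dissipative_add[OF assms(1) dissipative_cmult[OF assms(2), of "- 1"]] by simp

lemma dissipative_zero: "dissipative (\<lambda>x::'k. 0 :: 'a::nonarch_field)"
  by (simp add: dissipative_def)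

lemma dissipative_sum:
  fixes f :: "'i \<Rightarrow> 'k \<Rightarrow> 'a::nonarch_field"
  assumes "\<And>i. i \<in> F \<Longrightarrow> dissipative (f i)"
  shows "dissipative (\<lambda>x. \<Sum>i\<in>F. f i x)"
  using assms
  by (induction F rule: infinite_finite_induct) (simp_all add: dissipative_zero dissipative_add)

lemma dissipative_mult_bounded:
  fixes f h :: "'k \<Rightarrow> 'a::nonarch_field"
  assumes "dissipative f" "continuous_on UNIV h" "\<And>x. vnorm (h x) \<le> 1"
  shows "dissipative (\<lambda>x. f x * h x)"
proof (rule dissipativeI)
  show "continuous_on UNIV (\<lambda>x. f x * h x)"
    using assms by (intro continuous_on_mult') (auto simp: dissipative_def)
  fix e :: real assume "e > 0"
  then obtain N :: nat where N: "\<And>x. x \<notin> B (- int N) \<Longrightarrow> vnorm (f x) \<le> e"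
    using dissipative_bounded[OF assms(1)] by blast
  have "vnorm (f x * h x) \<le> e" if "x \<notin> B (- int N)" for x
  proof -
    have "vnorm (f x * h x) \<le> vnorm (f x) * 1"
      unfolding vnorm_mult by (rule mult_left_mono) (simp_all add: assms(3))
    then show ?thesis using N[OF that] by simp
  qed
  then show "\<exists>N::nat. \<forall>x. x \<notin> B (- int N) \<longrightarrow> vnorm (f x * h x) \<le> e" by blast
qed

lemma dissipative_supported:
  fixes f :: "'k \<Rightarrow> 'a::nonarch_field"
  assumes "continuous_on UNIV f" "supported m f"
  shows "dissipative f"
proof (rule dissipativeI[OF assms(1)])
  fix e :: real assume "e > 0"
  have "vnorm (f x) \<le> e" if "x \<notin> B (- int (nat (- m)))" for x
  proof -
    have "- int (nat (- m)) \<le> m" by simp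
    then have "x \<notin> B m" using that B_mono[of x m "- int (nat (- m))"] by blast
    then show ?thesis using assms(2) \<open>e > 0\<close> by (simp add: supported_def)
  qed
  then show "\<exists>N::nat. \<forall>x. x \<notin> B (- int N) \<longrightarrow> vnorm (f x) \<le> e" by blast
qed

lemma dissipative_affine:
  fixes f :: "'k \<Rightarrow> 'a::nonarch_field"
  assumes "dissipative f" "c \<noteq> 0"
  shows "dissipative (\<lambda>x. f (c * x + a))"
proof (rule dissipativeI)
  show "continuous_on UNIV (\<lambda>x. f (c * x + a))"
    by (rule continuous_on_compose2[OF dissipative_continuous[OF assms(1)]])
       (intro continuous_intros, simp)
  fix e :: real assume "e > 0"
  then obtain N :: nat where N: "\<And>x. x \<notin> B (- int N) \<Longrightarrow> vnorm (f x) \<le> e"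
    using dissipative_bounded[OF assms(1)] by blast
  obtain M :: nat where M: "a \<in> B (- int M)" by (rule ex_in_B)
  \<comment> \<open>Dividing by \<open>c\<close> enlarges a ball by \<open>val c\<close> levels if
    that number is positive.\<close>
  define L where "L = max N M + nat (val c)"
  have "vnorm (f (c * x + a)) \<le> e" if "x \<notin> B (- int L)" for x
  proof (rule N)
    show "c * x + a \<notin> B (- int N)"
    proof
      assume "c * x + a \<in> B (- int N)"
      then have "c * x + a \<in> B (- int (max N M))" "a \<in> B (- int (max N M))"
        using M by (auto elim!: B_mono)
      then have "(c * x + a) - a \<in> B (- int (max N M))" by (rule B_diff)
      moreover have "inverse c \<in> B (- val c)"
        using assms(2) vnorm_eq_val[OF assms(2)]
        by (simp add: in_B_iff vnorm_inverse power_int_minus)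
      ultimately have "inverse c * (c * x) \<in> B (- val c + - int (max N M))"
        using B_mult[of "inverse c" "- val c" "c * x" "- int (max N M)"] by simp
      then have "x \<in> B (- val c + - int (max N M))"
        using assms(2) by (simp flip: mult.assoc)
      then have "x \<in> B (- int L)" by (rule B_mono) (simp add: L_def)
      then show False using that by simp
    qed
  qed
  then show "\<exists>N::nat. \<forall>x. x \<notin> B (- int N) \<longrightarrow> vnorm (f (c * x + a)) \<le> e" by blast
qed

end

section \<open>The integral of dissipative functions and its change of variables\<close>

context haar
begin

text \<open>The step function sampling \<open>f\<close> at the chosen representatives; these are the
  test functions witnessing \<open>integral_K\<close>.\<close>

definition dsc :: "nat \<Rightarrow> ('k \<Rightarrow> 'c) \<Rightarrow> 'k \<Rightarrow> 'c" where
  "dsc N f x = (if x \<in> B (- int N) then f (rep (int N) x) else 0)"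

lemma level_dsc: "level N (dsc N f)"
  unfolding level_def
proof
  show "periodic (int N) (dsc N f)"
    unfolding periodic_def
  proof (intro allI impI)
    fix x y assume xy: "x - y \<in> B (int N)"
    then have "x \<in> B (- int N) \<longleftrightarrow> y \<in> B (- int N)"
      using B_diff_cancel[OF B_mono[OF xy, of "- int N"]] by simp
    moreover have "rep (int N) x = rep (int N) y" using xy by (simp add: rep_eq_iff)
    ultimately show "dsc N f x = dsc N f y" by (simp add: dsc_def)
  qed
qed (simp add: supported_def dsc_def)

lemma S_dsc: "S N (dsc N f) = S N f"
proof -
  have "(\<Sum>x\<in>rep (int N) ` B (- int N). dsc N f x) = (\<Sum>x\<in>rep (int N) ` B (- int N). f x)"
    by (rule sum.cong) (auto simp: dsc_def rep_in_B_iff)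
  then show ?thesis by (simp add: S_def riemann_def)
qed

lemma dsc_error:
  assumes "good N f e" "0 \<le> e" shows "vnorm (f x - dsc N f x) \<le> e"
  using assms diff_rep[of x "int N"] by (auto simp: good_def dsc_def)

lemma good_nonneg: "good N f e \<Longrightarrow> 0 \<le> e"
proof -
  assume "good N f e"
  then have "vnorm (f 0 - f 0) \<le> e" unfolding good_def by (metis diff_self zero_in_B)
  then show ?thesis by simp
qed

text \<open>The coarse sum is also the fine sum of the step function \<open>dsc N f\<close>, so the
  difference is a Riemann sum of a function bounded by \<open>e\<close>.\<close>

lemma S_error:
  assumes "good N f e" "N \<le> M" shows "vnorm (S M f - S N f) \<le> e"
proof -
  have "S N f = S M (dsc N f)"
    using S_level[OF level_dsc assms(2)] S_dsc by simp
  then have "S M f - S N f = S M (\<lambda>x. f x - dsc N f x)" by (simp add: S_diff)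
  then show ?thesis using S_bound[OF dsc_error[OF assms(1) good_nonneg[OF assms(1)]]] by simp
qed

abbreviation I :: "('k \<Rightarrow> 'c) \<Rightarrow> 'c" where "I f \<equiv> integral_K \<pi> \<delta> sq f"

lemma S_convergent:
  assumes "dissipative f" shows "\<exists>J. (\<lambda>N. S N f) \<longlonglongrightarrow> J"
proof -
  have "Cauchy (\<lambda>N. S N f)"
  proof (rule metric_CauchyI)
    fix e :: real assume "e > 0"
    then obtain N where N: "good N f (e / 2)" using dissipative_good[OF assms, of "e / 2"] by auto
    have "dist (S m f) (S n f) < e" if "N \<le> m" "N \<le> n" for m n
    proof -
      have "vnorm ((S m f - S N f) - (S n f - S N f)) \<le> e / 2"
        using that by (intro vnorm_diff_le S_error[OF N])
      then show ?thesis using \<open>e > 0\<close> by (simp add: dist_vnorm)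
    qed
    then show "\<exists>M. \<forall>m\<ge>M. \<forall>n\<ge>M. dist (S m f) (S n f) < e" by blast
  qed
  then show ?thesis using complete_c by (auto simp: complete_def)
qed

text \<open>The sampled step functions provide one approximating sequence. Any other test function
  uniformly within \<open>e\<close> of \<open>f\<close> has, at every sufficiently fine mesh, a
  Riemann sum within \<open>e\<close> of that of \<open>f\<close>, so the limit does not depend on
  the sequence.\<close>

lemma integral_tendsto:
  assumes "dissipative f" shows "(\<lambda>N. S N f) \<longlonglongrightarrow> I f"
proof -
  obtain J where J: "(\<lambda>N. S N f) \<longlonglongrightarrow> J" using S_convergent[OF assms] by blast
  have "I f = J"
    unfolding integral_K_def haar_functional_eq
  proof (rule the_equality)
    show "\<exists>g. (\<forall>n. test_function (g n)) \<and> uniform_limit UNIV g f sequentially \<and> (\<lambda>n. D0 (g n)) \<longlonglongrightarrow> J"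
    proof (intro exI conjI allI)
      show "test_function (dsc n f)" for n
        unfolding test_function_iff_level using level_dsc by blast
      have "D0 (dsc n f) = S n f" for n using D0_level[OF level_dsc] S_dsc by simp
      then show "(\<lambda>n. D0 (dsc n f)) \<longlonglongrightarrow> J" using J by simp
      show "uniform_limit UNIV (\<lambda>n. dsc n f) f sequentially"
      proof (rule uniform_limitI)
        fix e :: real assume "e > 0"
        then obtain N where N: "good N f (e / 2)" using dissipative_good[OF assms, of "e / 2"] by auto
        have "dist (dsc n f x) (f x) < e" if "N \<le> n" for n x
          using dsc_error[OF good_mono[OF N that], of x] \<open>e > 0\<close>
          by (simp add: dist_vnorm vnorm_minus_commute)
        then show "\<forall>\<^sub>F n in sequentially. \<forall>x\<in>UNIV. dist (dsc n f x) (f x) < e"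
          unfolding eventually_sequentially by blast
      qed
    qed
  next
    fix J'
    assume "\<exists>g. (\<forall>n. test_function (g n)) \<and> uniform_limit UNIV g f sequentially \<and> (\<lambda>n. D0 (g n)) \<longlonglongrightarrow> J'"
    then obtain g where g: "\<And>n. test_function (g n)" "uniform_limit UNIV g f sequentially"
      "(\<lambda>n. D0 (g n)) \<longlonglongrightarrow> J'" by blast
    have "vnorm (J' - J) \<le> e" if "e > 0" for e
    proof -
      have "\<forall>\<^sub>F n in sequentially. (\<forall>x\<in>UNIV. dist (g n x) (f x) < e) \<and> vnorm (D0 (g n) - J') < e"
        using uniform_limitD[OF g(2) that] g(3) that unfolding tendsto_vnorm_iff
        by (intro eventually_conj) auto
      then obtain n where n: "\<And>x. dist (g n x) (f x) < e" "vnorm (D0 (g n) - J') < e"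
        unfolding eventually_sequentially by auto
      obtain N where N: "level N (g n)" using g(1)[of n] unfolding test_function_iff_level ..
      have "\<forall>\<^sub>F M in sequentially. N \<le> M \<and> vnorm (S M f - J) < e"
        using J that eventually_ge_at_top[of N] unfolding tendsto_vnorm_iff
        by (intro eventually_conj) auto
      then obtain M where M: "N \<le> M" "vnorm (S M f - J) < e"
        unfolding eventually_sequentially by auto
      have "D0 (g n) = S M (g n)" using D0_level[OF N] S_level[OF N M(1)] by simp
      moreover have "vnorm (S M (\<lambda>x. g n x - f x)) \<le> e"
        using n(1) by (intro S_bound) (auto simp: dist_vnorm less_imp_le)
      ultimately have "vnorm (D0 (g n) - S M f) \<le> e" by (simp add: S_diff)
      then have "vnorm ((D0 (g n) - S M f) + (S M f - J)) \<le> e"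
        using M(2) by (intro vnorm_add_le) auto
      then have "vnorm ((D0 (g n) - J) - (D0 (g n) - J')) \<le> e"
        using n(2) vnorm_diff_le[of "D0 (g n) - J" e "D0 (g n) - J'"] by simp
      then show ?thesis by simp
    qed
    then show "J' = J" by (rule vnorm_diff_le_imp_eq)
  qed
  then show ?thesis using J by simp
qed

lemma I_eqI: "dissipative f \<Longrightarrow> (\<lambda>N. S N f) \<longlonglongrightarrow> J \<Longrightarrow> I f = J"
  using integral_tendsto LIMSEQ_unique by blast

lemma I_add: "dissipative f \<Longrightarrow> dissipative g \<Longrightarrow> I (\<lambda>x. f x + g x) = I f + I g"
  by (intro I_eqI dissipative_add) (auto simp: S_add intro!: tendsto_add integral_tendsto)

lemma I_diff: "dissipative f \<Longrightarrow> dissipative g \<Longrightarrow> I (\<lambda>x. f x - g x) = I f - I g"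
  by (intro I_eqI dissipative_diff) (auto simp: S_diff intro!: tendsto_diff integral_tendsto)

lemma I_cmult: "dissipative f \<Longrightarrow> I (\<lambda>x. a * f x) = a * I f"
  by (intro I_eqI dissipative_cmult) (auto simp: S_cmult intro!: tendsto_mult tendsto_const integral_tendsto)

lemma I_zero [simp]: "I (\<lambda>x. 0) = 0"
  using I_cmult[OF dissipative_zero, of 0] by simp

lemma I_sum:
  assumes "\<And>i. i \<in> F \<Longrightarrow> dissipative (f i)"
  shows "I (\<lambda>x. \<Sum>i\<in>F. f i x) = (\<Sum>i\<in>F. I (f i))"
  using assms
  by (induction F rule: infinite_finite_induct) (simp_all add: I_add dissipative_sum)

lemma I_bound:
  assumes "dissipative f" "\<And>x. vnorm (f x) \<le> e" shows "vnorm (I f) \<le> e"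
  using integral_tendsto[OF assms(1)] by (rule vnorm_tendsto_le) (simp_all add: S_bound assms(2))

lemma I_error:
  assumes "dissipative f" "good N f e" shows "vnorm (I f - S N f) \<le> e"
proof (rule vnorm_tendsto_le)
  show "(\<lambda>M. S M f - S N f) \<longlonglongrightarrow> I f - S N f"
    by (intro tendsto_diff integral_tendsto assms tendsto_const)
  show "\<forall>\<^sub>F M in sequentially. vnorm (S M f - S N f) \<le> e"
    using eventually_ge_at_top[of N] by eventually_elim (rule S_error[OF assms(2)])
qed simp

lemma level_dissipative: "level N g \<Longrightarrow> dissipative g"
  unfolding level_def using periodic_continuous dissipative_supported by blast

lemma I_level: assumes "level N g" shows "I g = S N g"
proof (rule I_eqI[OF level_dissipative[OF assms]])
  have "\<forall>\<^sub>F M in sequentially. S M g = S N g"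
    using eventually_ge_at_top[of N] by eventually_elim (rule S_level[OF assms])
  then show "(\<lambda>M. S M g) \<longlonglongrightarrow> S N g" by (rule tendsto_eventually)
qed

lemma dissipative_indicator: "dissipative (indicator ((+) a ` B n) :: 'k \<Rightarrow> 'c)"
  using ex_level_indicator[of a n] level_dissipative by blast

lemma I_indicator: "I (indicator ((+) a ` B n)) = vol n"
proof -
  obtain N where N: "level N (indicator ((+) a ` B n) :: 'k \<Rightarrow> 'c)"
    "- int N \<le> n" "n \<le> int N" "a \<in> B (- int N)"
    using ex_level_indicator[of a n] by auto
  show ?thesis unfolding I_level[OF N(1)] by (rule S_indicator[OF N(2-4)])
qed

text \<open>Step functions are uniformly dense, and both sides are bounded by the sup norm; the
  bound on \<kappa> controls the error on the side of the integral.\<close>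

lemma functional_eq_integral:
  assumes add: "\<And>g h. dissipative g \<Longrightarrow> dissipative h \<Longrightarrow> L (\<lambda>x. g x + h x) = L g + (L h :: 'c)"
    and cmult: "\<And>a g. dissipative g \<Longrightarrow> L (\<lambda>x. a * g x) = a * L g"
    and bound: "\<And>g e. dissipative g \<Longrightarrow> (\<And>x. vnorm (g x) \<le> e) \<Longrightarrow> vnorm (L g) \<le> e"
    and ind: "\<And>a n. L (indicator ((+) a ` B n)) = vol n * \<kappa>" and \<kappa>: "vnorm \<kappa> \<le> 1"
    and f: "dissipative f"
  shows "L f = I f * \<kappa>"
proof -
  have test: "dissipative g" if "test_function g" for g :: "'k \<Rightarrow> 'c"
    using that level_dissipative unfolding test_function_iff_level by blast
  have "vnorm (L f - I f * \<kappa>) \<le> e" if e: "e > 0" for e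
  proof -
    obtain N where N: "good N f e" using dissipative_good[OF f e] by blast
    have d: "dissipative (dsc N f)" by (rule level_dissipative[OF level_dsc])
    have "L (dsc N f) = S N (dsc N f) * \<kappa>"
      by (rule haar_functional_unique[OF _ _ ind level_dsc]) (auto intro: add cmult test)
    then have Ld: "L (dsc N f) = S N f * \<kappa>" by (simp add: S_dsc)
    have "L f = L (\<lambda>x. (f x - dsc N f x) + dsc N f x)" by simp
    also have "\<dots> = L (\<lambda>x. f x - dsc N f x) + L (dsc N f)"
      by (rule add[OF dissipative_diff[OF f d] d])
    finally have "L f - I f * \<kappa> = L (\<lambda>x. f x - dsc N f x) - (I f - S N f) * \<kappa>"
      by (simp add: Ld algebra_simps)
    moreover have "vnorm (L (\<lambda>x. f x - dsc N f x)) \<le> e"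
      by (rule bound[OF dissipative_diff[OF f d]]) (rule dsc_error[OF N good_nonneg[OF N]])
    moreover have "vnorm ((I f - S N f) * \<kappa>) \<le> e"
      using mult_mono[OF I_error[OF f N] \<kappa>] e by (simp add: vnorm_mult)
    ultimately show ?thesis by (simp add: vnorm_diff_le)
  qed
  then show ?thesis by (rule vnorm_diff_le_imp_eq)
qed

lemma in_B_mult_iff: "c \<noteq> 0 \<Longrightarrow> c * x \<in> B n \<longleftrightarrow> x \<in> B (n - val c)"
proof -
  assume c: "c \<noteq> 0"
  have "c * x = \<pi> powi (val c) * ((c / \<pi> powi (val c)) * x)" by simp
  then show ?thesis using unit_part[OF c] powi_mult_in_B_iff unit_mult_in_B_iff by metis
qed

text \<open>The preimage of a coset of \<open>B n\<close> is a coset of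
  \<open>B (n - val c)\<close>, whose volume is larger by the factor \<open>q\<close> to the power
  \<open>val c\<close>. The substituted integral is thus a bounded functional known on
  indicators.\<close>

lemma I_affine:
  assumes "dissipative f" "c \<noteq> 0"
  shows "I (\<lambda>x. f (c * x + a)) = I f * of_nat q powi (val c)"
proof (rule functional_eq_integral[OF _ _ _ _ _ assms(1)])
  fix b n
  have "c * x + a - b \<in> B n \<longleftrightarrow> x - (b - a) / c \<in> B (n - val c)" for x
  proof -
    have "c * x + a - b = c * (x - (b - a) / c)" using assms(2) by (simp add: field_simps)
    then show ?thesis using in_B_mult_iff[OF assms(2)] by simp
  qed
  then have "(\<lambda>x. indicator ((+) b ` B n) (c * x + a)) = (indicator ((+) ((b - a) / c) ` B (n - val c)) :: 'k \<Rightarrow> 'c)"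
    by (intro ext) (simp add: indicator_def in_translate_B_iff)
  then show "I (\<lambda>x. indicator ((+) b ` B n) (c * x + a)) = vol n * of_nat q powi (val c)"
    using vol_add[of n "- val c"] by (simp add: I_indicator)
next
  show "vnorm (of_nat q powi val c :: 'c) \<le> 1" by (simp add: vnorm_powi q_unit)
qed (simp_all add: I_add I_cmult I_bound dissipative_affine[OF _ assms(2)])

end

subsection \<open>The residue field and the additive character\<close>

context local_field
begin

text \<open>The residue field is an elementary abelian \<open>l\<close>-group; adjoining one element at a time to a
  subgroup multiplies the index by \<open>l\<close>.\<close>

lemma residue_card_power:
  assumes l: "prime l" "vnorm (of_nat l :: 'k) < 1"
  shows "\<exists>k. q = l ^ k"
proof -
  \<comment> \<open>\<open>G\<close> describes the groups between the maximal ideal and the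
    valuation ring whose image in the residue field has order a power of \<open>l\<close>.\<close>
  define G where "G H \<longleftrightarrow> B 1 \<subseteq> H \<and> H \<subseteq> B 0 \<and> (\<forall>x\<in>H. \<forall>y\<in>H. x + y \<in> H) \<and> (\<forall>x\<in>H. - x \<in> H) \<and>
      (\<exists>k. card (rep 1 ` H) = l ^ k)" for H
  have gen: "\<exists>H. G H \<and> F \<subseteq> H" if "finite F" "F \<subseteq> B 0" for F
    using that
  proof (induction F rule: finite_induct)
    case empty
    have "rep 1 ` B 1 = {rep 1 0}"
    proof -
      have "rep 1 x = rep 1 0" if "x \<in> B 1" for x using that by (simp add: rep_eq_iff)
      then show ?thesis using zero_in_B[of 1] by blast
    qed
    then have "card (rep 1 ` B 1) = l ^ 0" by simp
    then have "\<exists>k. card (rep 1 ` B 1) = l ^ k" by blast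
    moreover have "B 1 \<subseteq> B 0" using B_mono[of _ 1 0] by auto
    ultimately have "G (B 1)" unfolding G_def by (simp add: B_add)
    then show ?case by blast
  next
    case (insert x F)
    then obtain H where H: "G H" "F \<subseteq> H" by auto
    then have H1: "B 1 \<subseteq> H" and H0: "H \<subseteq> B 0" and add: "\<And>x y. x \<in> H \<Longrightarrow> y \<in> H \<Longrightarrow> x + y \<in> H"
      and neg: "\<And>x. x \<in> H \<Longrightarrow> - x \<in> H" unfolding G_def by auto
    obtain k where k: "card (rep 1 ` H) = l ^ k" using H(1) unfolding G_def by auto
    have x0: "x \<in> B 0" using insert.prems by simp
    have nat_mult: "of_nat n * y \<in> H" if "y \<in> H" for n y
      using that H1 zero_in_B[of 1] by (induction n) (auto simp: distrib_right intro: add)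
    have int_mult: "of_int n * y \<in> H" if "y \<in> H" for n y
      using nat_mult[OF that] neg by (cases n rule: int_cases2) auto
    have lx: "of_nat l * x \<in> B 1"
    proof -
      have "vnorm (of_nat l * x) \<le> vnorm (of_nat l :: 'k) * 1"
        unfolding vnorm_mult using x0 by (intro mult_left_mono) (simp_all add: in_B_0_iff)
      then show ?thesis using l(2) by (simp add: B_1)
    qed
    show ?case
    proof (cases "x \<in> H")
      case True
      then show ?thesis using H by auto
    next
      case False
      define H' where "H' = {h + of_int i * x | h i. h \<in> H}"
      have HH': "h + of_int i * x \<in> H'" if "h \<in> H" for h i using that unfolding H'_def by blast
      have sub: "H \<subseteq> H'"
      proof
        fix h assume "h \<in> H"
        then show "h \<in> H'" using HH'[of h 0] by simp
      qed
      have "x \<in> H'" using HH'[of 0 1] subsetD[OF H1 zero_in_B] by simp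
      have H'0: "H' \<subseteq> B 0"
      proof
        fix z assume "z \<in> H'"
        then obtain h i where z: "z = h + of_int i * x" "h \<in> H" unfolding H'_def by blast
        have "vnorm (of_int i * x) \<le> 1 * 1"
          unfolding vnorm_mult using x0 vnorm_of_int_le_1
          by (intro mult_mono) (simp_all add: in_B_0_iff)
        then show "z \<in> B 0" unfolding z(1) using z(2) H0 by (intro B_add) (auto simp: in_B_0_iff)
      qed
      have addH': "u + v \<in> H'" if "u \<in> H'" "v \<in> H'" for u v
      proof -
        obtain h i h' j where "u = h + of_int i * x" "h \<in> H" "v = h' + of_int j * x" "h' \<in> H"
          using \<open>u \<in> H'\<close> \<open>v \<in> H'\<close> unfolding H'_def by blast
        then show ?thesis using HH'[of "h + h'" "i + j"] add by (simp add: algebra_simps)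
      qed
      have negH': "- u \<in> H'" if "u \<in> H'" for u
      proof -
        obtain h i where "u = h + of_int i * x" "h \<in> H" using \<open>u \<in> H'\<close> unfolding H'_def by blast
        then show ?thesis using HH'[of "- h" "- i"] neg by simp
      qed
      let ?m = "\<lambda>(r, i::nat). rep 1 (r + of_nat i * x)"
      \<comment> \<open>Multiples of \<open>x\<close> only matter up to \<open>l\<close>: since
        \<open>of_nat l * x\<close> lies in \<open>B 1\<close>, the quotient of \<open>i\<close> by
        \<open>l\<close> is absorbed into \<open>H\<close>.\<close>
      have "rep 1 ` H' = ?m ` (rep 1 ` H \<times> {..<l})"
      proof (intro equalityI subsetI)
        fix z assume "z \<in> rep 1 ` H'"
        then obtain h i where z: "z = rep 1 (h + of_int i * x)" "h \<in> H" unfolding H'_def by blast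
        define j where "j = nat (i mod int l)"
        have l0: "int l > 0" using l(1) prime_gt_0_nat by simp
        have j: "j < l" "int j = i mod int l"
          using l0 pos_mod_bound[OF l0, of i] pos_mod_sign[OF l0, of i] by (auto simp: j_def)
        define h' where "h' = h + of_int (i div int l) * (of_nat l * x)"
        have "h' \<in> H" unfolding h'_def using z(2) lx H1 by (intro add int_mult) auto
        moreover have "h + of_int i * x = h' + of_nat j * x"
        proof -
          have "i = (i div int l) * int l + int j" using j by simp
          then have "(of_int i :: 'k) = of_int (i div int l) * of_nat l + of_nat j"
            by (metis of_int_add of_int_mult of_int_of_nat_eq)
          then show ?thesis by (simp add: h'_def algebra_simps)
        qed
        moreover have "rep 1 (rep 1 h' + of_nat j * x) = rep 1 (h' + of_nat j * x)"
          using rep_diff[of 1 h'] by (simp add: rep_eq_iff)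
        ultimately have "z = ?m (rep 1 h', j)" "h' \<in> H" using z by simp_all
        then show "z \<in> ?m ` (rep 1 ` H \<times> {..<l})" using j(1) by blast
      next
        fix z assume "z \<in> ?m ` (rep 1 ` H \<times> {..<l})"
        then obtain h i where z: "z = rep 1 (rep 1 h + of_nat i * x)" "h \<in> H" by auto
        have "rep 1 (rep 1 h + of_nat i * x) = rep 1 (h + of_int (int i) * x)"
          using rep_diff[of 1 h] by (simp add: rep_eq_iff)
        then show "z \<in> rep 1 ` H'" using z HH'[of h "int i"] by simp
      qed
      moreover have "inj_on ?m (rep 1 ` H \<times> {..<l})"
      proof (rule inj_onI, clarify)
        fix h i h' j
        assume h: "h \<in> H" "h' \<in> H" and ij: "i < l" "j < l"
          and eq: "rep 1 (rep 1 h + of_nat i * x) = rep 1 (rep 1 h' + of_nat j * x)"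
        have "rep 1 (rep 1 h + of_nat i * x) = rep 1 (h + of_nat i * x)"
          "rep 1 (rep 1 h' + of_nat j * x) = rep 1 (h' + of_nat j * x)"
          using rep_diff[of 1 h] rep_diff[of 1 h'] by (simp_all add: rep_eq_iff)
        with eq have "(h + of_nat i * x) - (h' + of_nat j * x) \<in> B 1" by (simp flip: rep_eq_iff)
        then have d: "(h + of_nat i * x) - (h' + of_nat j * x) \<in> H" using H1 by blast
        have "((h + of_nat i * x) - (h' + of_nat j * x)) + (h' + - h) \<in> H"
          using d h by (intro add neg)
        then have dx: "of_int (int i - int j) * x \<in> H" by (simp add: algebra_simps)
        \<comment> \<open>Otherwise \<open>i - j\<close> is prime to \<open>l\<close>, and Bezout
          combines its multiple of \<open>x\<close> with \<open>of_nat l * x\<close> to put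
          \<open>x\<close> itself into \<open>H\<close>.\<close>
        have "i = j"
        proof (rule ccontr)
          assume "i \<noteq> j"
          then have "\<not> int l dvd int i - int j"
            using ij zdvd_not_zless[of "int i - int j" "int l"] zdvd_not_zless[of "int j - int i" "int l"]
              dvd_diff_commute[of "int l" "int i" "int j"] by (cases "i < j") auto
          then have "coprime (int l) (int i - int j)" using l(1) by (simp add: prime_imp_coprime)
          then obtain u v where uv: "u * int l + v * (int i - int j) = 1"
            by (metis bezout_int coprime_iff_gcd_eq_1)
          have "of_int u * (of_nat l * x) + of_int v * (of_int (int i - int j) * x) \<in> H"
            by (rule add[OF int_mult[OF subsetD[OF H1 lx]] int_mult[OF dx]])
          also have "of_int u * (of_nat l * x) + of_int v * (of_int (int i - int j) * x)
              = of_int (u * int l + v * (int i - int j)) * x"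
            by (simp add: algebra_simps)
          finally show False using False uv by simp
        qed
        with eq show "rep 1 h = rep 1 h' \<and> i = j" by (simp add: rep_eq_iff)
           (metis rep_eq_iff rep_rep_same)
      qed
      ultimately have "card (rep 1 ` H') = card (rep 1 ` H \<times> {..<l})" by (simp add: card_image)
      then have "card (rep 1 ` H') = l ^ Suc k" by (simp add: card_cartesian_product k)
      then have "\<exists>k. card (rep 1 ` H') = l ^ k" by blast
      then have "G H'" unfolding G_def using H1 sub H'0 addH' negH' by blast
      moreover have "insert x F \<subseteq> H'" using \<open>x \<in> H'\<close> H(2) sub by blast
      ultimately show ?thesis by blast
    qed
  qed
  have "rep 1 ` B 0 \<subseteq> B 0" by (auto simp: rep_in_B_iff)
  then obtain H where H: "G H" "rep 1 ` B 0 \<subseteq> H" using gen[OF finite_rep_B] by metis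
  have "B 0 \<subseteq> H"
  proof
    fix x assume "x \<in> B 0"
    then have "rep 1 x \<in> H" using H(2) by blast
    moreover have "x - rep 1 x \<in> H" using diff_rep[of x 1] H(1) unfolding G_def by (elim conjE) (erule subsetD)
    ultimately have "rep 1 x + (x - rep 1 x) \<in> H" using H(1) unfolding G_def by (elim conjE) (drule bspec, assumption, erule bspec)
    then show "x \<in> H" by simp
  qed
  then have "H = B 0" using H(1) unfolding G_def by blast
  then show ?thesis using H(1) unfolding G_def q_eq_card_rep by simp
qed

end

section \<open>The additive character of the \<open>l\<close>-adic numbers and the different\<close>

context padic_field
begin

lemma root_power_cong:
  assumes "is_root_system l (\<zeta> :: nat \<Rightarrow> 'c::nonarch_field)" "int l ^ T dvd int m - int m'"
  shows "\<zeta> T ^ m = \<zeta> T ^ m'"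
proof -
  have z: "\<zeta> T ^ (l ^ T) = 1" using assms(1) by (simp add: is_root_system_def)
  have red: "\<zeta> T ^ n = \<zeta> T ^ (n mod l ^ T)" for n
  proof -
    have "\<zeta> T ^ n = \<zeta> T ^ (l ^ T * (n div l ^ T) + n mod l ^ T)" by simp
    also have "\<dots> = \<zeta> T ^ (n mod l ^ T)" unfolding power_add power_mult z by simp
    finally show ?thesis .
  qed
  have "int m mod int (l ^ T) = int m' mod int (l ^ T)"
    using assms(2) by (simp add: mod_eq_dvd_iff)
  then have "m mod l ^ T = m' mod l ^ T" by (metis of_nat_eq_iff zmod_int)
  then show ?thesis using red[of m] red[of m'] by simp
qed

lemma root_descend:
  assumes "is_root_system l (\<zeta> :: nat \<Rightarrow> 'c::nonarch_field)"
  shows "\<zeta> (t + k) ^ (l ^ k) = \<zeta> t"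
proof (induction k)
  case (Suc k)
  have "\<zeta> (t + Suc k) ^ (l ^ Suc k) = (\<zeta> (Suc (t + k)) ^ l) ^ (l ^ k)"
    by (simp add: power_mult)
  also have "\<zeta> (Suc (t + k)) ^ l = \<zeta> (t + k)" using assms by (simp add: is_root_system_def)
  finally show ?case using Suc by simp
qed simp

text \<open>Compatibility of the roots of unity removes both choices from the definition: any
  \<open>T\<close> clearing the denominator and any natural approximation \<open>m\<close> give the
  same value. Additivity then follows by reading two arguments at a common level.\<close>

lemma zeta_power_eq:
  fixes x :: 'q
  assumes root: "is_root_system l (\<zeta> :: nat \<Rightarrow> 'c::nonarch_field)"
    and x: "vnorm x \<le> real l ^ T" and m: "vnorm (of_nat m - x * of_nat l ^ T) \<le> 1 / real l ^ T"
  shows "zeta_power l \<zeta> x = \<zeta> T ^ m"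
proof (cases "x \<in> valuation_ring")
  case True
  have "vnorm (x * of_nat l ^ T) \<le> 1 / real l ^ T"
    using True l_pos by (simp add: vnorm_mult vnorm_l_power valuation_ring_def divide_right_mono)
  then have "vnorm ((of_nat m - x * of_nat l ^ T) + x * of_nat l ^ T) \<le> 1 / real l ^ T"
    using m by (intro vnorm_add_le)
  then have "vnorm (of_int (int m) :: 'q) \<le> 1 / real l ^ T" by simp
  then have "int l ^ T dvd int m - int 0" using vnorm_of_int_le_dvd by simp
  then have "\<zeta> T ^ m = \<zeta> T ^ 0" by (rule root_power_cong[OF root])
  then show ?thesis using True by (simp add: zeta_power_def)
next
  case False
  then obtain t where t: "vnorm x = real l ^ t" using vnorm_eq_power by blast
  have inj: "s = t" if "real l ^ t = real l ^ s" for s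
    using that l_gt_1 by (metis power_inject_exp)
  have the: "(THE t::nat. vnorm x = real l ^ t) = t"
    using t inj by (intro the_equality) auto
  define m' where "m' = (SOME m :: nat. vnorm (of_nat m - x * of_nat l ^ t) \<le> 1 / real l ^ t)"
  have "vnorm (x * of_nat l ^ t) \<le> 1"
    using l_pos by (simp add: vnorm_mult vnorm_l_power t)
  then have "\<exists>m::nat. vnorm (of_nat m - x * of_nat l ^ t) \<le> 1 / real l ^ t"
    using nat_approx by blast
  then have m': "vnorm (of_nat m' - x * of_nat l ^ t) \<le> 1 / real l ^ t"
    unfolding m'_def by (rule someI_ex)
  have "t \<le> T" using x t l_gt_1 by (simp add: power_increasing_iff)
  then obtain k where k: "T = t + k" using le_Suc_ex by blast
  have "vnorm (of_nat l ^ k * (of_nat m' - x * of_nat l ^ t)) \<le> 1 / real l ^ T"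
    using divide_right_mono[OF m', of "real l ^ k"] l_pos
    by (simp only: vnorm_mult vnorm_l_power k power_add) (simp add: mult.commute)
  then have "vnorm ((of_nat m - x * of_nat l ^ T) - of_nat l ^ k * (of_nat m' - x * of_nat l ^ t)) \<le> 1 / real l ^ T"
    by (rule vnorm_diff_le[OF m])
  also have "(of_nat m - x * of_nat l ^ T) - of_nat l ^ k * (of_nat m' - x * of_nat l ^ t)
      = of_int (int m - int (l ^ k * m'))"
    by (simp add: k power_add algebra_simps)
  finally have "int l ^ T dvd int m - int (l ^ k * m')" by (rule vnorm_of_int_le_dvd)
  then have "\<zeta> T ^ m = \<zeta> T ^ (l ^ k * m')" by (rule root_power_cong[OF root])
  also have "\<dots> = \<zeta> t ^ m'" unfolding power_mult k root_descend[OF root] ..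
  finally show ?thesis
    using False by (simp add: zeta_power_def the Let_def m'_def)
qed

lemma ex_common_level:
  fixes x :: 'q
  obtains T where "vnorm x \<le> real l ^ T"
  using real_arch_pow[OF l_gt_1, of "vnorm x"] less_imp_le by blast

lemma zeta_power_rep:
  fixes x :: 'q
  assumes "vnorm x \<le> real l ^ T"
  shows "\<exists>m. vnorm (of_nat m - x * of_nat l ^ T) \<le> 1 / real l ^ T"
proof -
  have "vnorm (x * of_nat l ^ T) \<le> 1"
    using assms l_pos by (simp add: vnorm_mult vnorm_l_power)
  then show ?thesis using nat_approx by blast
qed

lemma zeta_power_add:
  fixes x y :: 'q
  assumes root: "is_root_system l (\<zeta> :: nat \<Rightarrow> 'c::nonarch_field)"
  shows "zeta_power l \<zeta> (x + y) = zeta_power l \<zeta> x * zeta_power l \<zeta> y"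
proof -
  obtain T1 where T1: "vnorm x \<le> real l ^ T1" by (rule ex_common_level)
  obtain T2 where T2: "vnorm y \<le> real l ^ T2" by (rule ex_common_level)
  define T where "T = max T1 T2"
  have "real l ^ T1 \<le> real l ^ T" "real l ^ T2 \<le> real l ^ T"
    using l_gt_1 by (auto simp: T_def intro!: power_increasing)
  then have T: "vnorm x \<le> real l ^ T" "vnorm y \<le> real l ^ T" using T1 T2 by linarith+
  obtain m where m: "vnorm (of_nat m - x * of_nat l ^ T) \<le> 1 / real l ^ T"
    using zeta_power_rep[OF T(1)] by blast
  obtain n where n: "vnorm (of_nat n - y * of_nat l ^ T) \<le> 1 / real l ^ T"
    using zeta_power_rep[OF T(2)] by blast
  have "vnorm ((of_nat m - x * of_nat l ^ T) + (of_nat n - y * of_nat l ^ T)) \<le> 1 / real l ^ T"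
    using m n by (rule vnorm_add_le)
  then have mn: "vnorm (of_nat (m + n) - (x + y) * of_nat l ^ T) \<le> 1 / real l ^ T"
    by (simp add: algebra_simps)
  show ?thesis
    unfolding zeta_power_eq[OF root T(1) m] zeta_power_eq[OF root T(2) n]
      zeta_power_eq[OF root vnorm_add_le[OF T] mn] by (rule power_add)
qed

text \<open>For \<open>x\<close> of order \<open>- t < 0\<close> the exponent \<open>m\<close> is
  prime to \<open>l\<close>, and a primitive root of unity of order \<open>l ^ t\<close> with
  \<open>t > 0\<close> stays nontrivial when raised to it.\<close>

lemma zeta_power_eq_1_iff:
  fixes x :: 'q
  assumes root: "is_root_system l (\<zeta> :: nat \<Rightarrow> 'c::nonarch_field)"
  shows "zeta_power l \<zeta> x = 1 \<longleftrightarrow> x \<in> valuation_ring"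
proof
  assume one: "zeta_power l \<zeta> x = 1"
  show "x \<in> valuation_ring"
  proof (rule ccontr)
    assume nx: "x \<notin> valuation_ring"
    then obtain t where t: "vnorm x = real l ^ t" using vnorm_eq_power by blast
    have "t \<noteq> 0" using t nx by (cases t) (auto simp: valuation_ring_def)
    obtain m where m: "vnorm (of_nat m - x * of_nat l ^ t) \<le> 1 / real l ^ t"
      using zeta_power_rep[of x t] t by auto
    have zm: "\<zeta> t ^ m = 1" using zeta_power_eq[OF root _ m] t one by simp
    have "vnorm (x * of_nat l ^ t) = 1" using l_pos by (simp add: vnorm_mult vnorm_l_power t)
    moreover have "1 / real l ^ t < 1"
      using l_gt_1 \<open>t \<noteq> 0\<close> by (simp add: one_less_power)
    ultimately have "vnorm (x * of_nat l ^ t - of_nat m) < vnorm (x * of_nat l ^ t)"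
      using m by (simp add: vnorm_minus_commute)
    then have "vnorm (of_nat m :: 'q) = 1"
      using vnorm_eq_if_diff_less \<open>vnorm (x * of_nat l ^ t) = 1\<close> by metis
    then have "\<not> int l dvd int m"
      using vnorm_of_int_dvd_le[of 1 "int m"] l_gt_1 by auto
    then have lm: "\<not> l dvd m" by simp
    have "m mod l ^ t \<noteq> 0"
    proof
      assume "m mod l ^ t = 0"
      then have "l ^ t dvd m" by (simp add: dvd_eq_mod_eq_0)
      moreover have "l dvd l ^ t" using \<open>t \<noteq> 0\<close> by simp
      ultimately show False using lm dvd_trans by blast
    qed
    moreover have "m mod l ^ t < l ^ t" using prime_l prime_gt_0_nat by simp
    ultimately have "\<zeta> t ^ (m mod l ^ t) \<noteq> 1"
      using root unfolding is_root_system_def by simp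
    moreover have "\<zeta> t ^ m = \<zeta> t ^ (m mod l ^ t)"
    proof (rule root_power_cong[OF root])
      have "int m - int (m mod l ^ t) = int l ^ t * int (m div l ^ t)"
        by (simp add: zmod_int minus_mod_eq_mult_div zdiv_int)
      then show "int l ^ t dvd int m - int (m mod l ^ t)" by simp
    qed
    ultimately show False using zm by simp
  qed
qed (simp add: zeta_power_def)

lemma vnorm_zeta_power:
  fixes x :: 'q
  assumes root: "is_root_system l (\<zeta> :: nat \<Rightarrow> 'c::nonarch_field)"
  shows "vnorm (zeta_power l \<zeta> x) = 1"
proof -
  have "vnorm (\<zeta> n) = 1" for n
  proof -
    have "vnorm (\<zeta> n) ^ (l ^ n) = 1"
      using root unfolding is_root_system_def by (metis vnorm_one vnorm_power)
    moreover have "0 < l ^ n" using prime_l prime_gt_0_nat by simp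
    ultimately show ?thesis using power_eq_imp_eq_base[of "vnorm (\<zeta> n)" "l ^ n" 1] by simp
  qed
  then show ?thesis by (simp add: zeta_power_def Let_def vnorm_power)
qed

end

text \<open>Multiplying by the generator of the different gives one inclusion. For the other, if all
  elements of the inverse different lay in \<open>B (1 - int \<delta>)\<close>, a lower power of
  \<pi> would already belong to the different; so some element has valuation at most
  \<open>- int \<delta>\<close>, and its multiples fill the ball.\<close>

lemma (in local_field) inverse_different_eq:
  fixes \<iota> :: "'q::nonarch_field \<Rightarrow> 'k"
  assumes "different \<iota> = B (int \<delta>)"
  shows "inverse_different \<iota> = B (- int \<delta>)"
proof (intro equalityI subsetI)
  have vr: "valuation_ring = B 0" by (auto simp: valuation_ring_def in_B_iff)
  have mult: "x * y \<in> inverse_different \<iota>" if x: "x \<in> inverse_different \<iota>" and y: "y \<in> B 0" for x y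
  proof -
    have "field_trace \<iota> (x * y * z) \<in> valuation_ring" if "z \<in> B 0" for z
      using x B_mult[OF y that] unfolding inverse_different_def vr by (simp add: mult.assoc)
    then show ?thesis unfolding inverse_different_def vr by simp
  qed
  fix x
  show "x \<in> B (- int \<delta>)" if "x \<in> inverse_different \<iota>"
  proof -
    have "\<pi> powi int \<delta> \<in> different \<iota>" unfolding assms by (simp only: in_B_iff vnorm_powi)
    then have "\<pi> powi int \<delta> * x \<in> B 0" using that unfolding different_def vr by blast
    then show ?thesis by (simp only: powi_mult_in_B_iff) simp
  qed
  show "x \<in> inverse_different \<iota>" if x: "x \<in> B (- int \<delta>)"
  proof -
    have "\<exists>y\<in>inverse_different \<iota>. y \<notin> B (1 - int \<delta>)"
    proof (rule ccontr)
      assume "\<not> ?thesis"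
      then have "y \<in> B (1 - int \<delta>)" if "y \<in> inverse_different \<iota>" for y using that by blast
      then have "\<pi> powi (int \<delta> - 1) * y \<in> B 0" if "y \<in> inverse_different \<iota>" for y
        using that by (simp only: powi_mult_in_B_iff) simp
      then have "\<pi> powi (int \<delta> - 1) \<in> different \<iota>" unfolding different_def vr by blast
      then show False unfolding assms in_B_iff vnorm_powi vnorm_pi_powi_le_iff by simp
    qed
    then obtain y where y: "y \<in> inverse_different \<iota>" "y \<notin> B (1 - int \<delta>)" by blast
    then have "y \<noteq> 0" by auto
    then have vy: "val y \<le> - int \<delta>" using y(2) in_B_val_iff by simp
    have "vnorm x \<le> vnorm \<pi> powi (- int \<delta>)" using x by (simp only: in_B_iff)
    also have "\<dots> \<le> vnorm y" unfolding vnorm_eq_val[OF \<open>y \<noteq> 0\<close>] vnorm_pi_powi_le_iff by (rule vy)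
    finally have "x / y \<in> B 0" using \<open>y \<noteq> 0\<close> by (simp add: in_B_0_iff vnorm_divide divide_le_eq_1)
    from mult[OF y(1) this] show ?thesis using \<open>y \<noteq> 0\<close> by simp
  qed
qed

subsection \<open>The Fourier transform\<close>

text \<open>The last axiom says that the ball dual to \<open>B 0\<close> is exactly
  \<open>B (- int \<delta>)\<close>. The half power in \<open>vol\<close> fits this:
  \<open>vol 0 * vol (- int \<delta>) = 1\<close>.\<close>

locale add_char = haar \<pi> \<delta> sq for \<pi> :: "'k::nonarch_field" and \<delta> :: nat and sq :: "'c::nonarch_field" +
  fixes \<theta> :: "'k \<Rightarrow> 'c"
  assumes \<theta>_add: "\<theta> (x + y) = \<theta> x * \<theta> y"
    and vnorm_\<theta>: "vnorm (\<theta> x) = 1"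
    and \<theta>_dual: "(\<forall>y\<in>B 0. \<theta> (x * y) = 1) \<longleftrightarrow> x \<in> B (- int \<delta>)"
begin

lemma \<theta>_nz [simp]: "\<theta> x \<noteq> 0"
  using vnorm_\<theta>[of x] by auto

lemma \<theta>_0 [simp]: "\<theta> 0 = 1"
  using \<theta>_add[of 0 0] by simp

lemma \<theta>_trivial: "x \<in> B (- int \<delta>) \<Longrightarrow> \<theta> x = 1"
proof -
  assume "x \<in> B (- int \<delta>)"
  then have "\<forall>y\<in>B 0. \<theta> (x * y) = 1" using \<theta>_dual by blast
  then have "\<theta> (x * 1) = 1" by (rule bspec) (simp add: in_B_iff)
  then show ?thesis by simp
qed

lemma \<theta>_cong: assumes "x - y \<in> B (- int \<delta>)" shows "\<theta> x = \<theta> y"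
  using \<theta>_add[of "x - y" y] \<theta>_trivial[OF assms] by simp

lemma \<theta>_mult_cong:
  assumes "x - x' \<in> B n" "y \<in> B m" "- int \<delta> \<le> n + m"
  shows "\<theta> (x * y) = \<theta> (x' * y)"
proof (rule \<theta>_cong)
  have "(x - x') * y \<in> B (- int \<delta>)" by (rule B_mono[OF B_mult[OF assms(1,2)] assms(3)])
  then show "x * y - x' * y \<in> B (- int \<delta>)" by (simp add: left_diff_distrib)
qed

lemma \<theta>_nontrivial:
  assumes "x \<notin> B (- int \<delta> - n)"
  obtains y where "y \<in> B n" "\<theta> (x * y) \<noteq> 1"
proof -
  have "\<pi> powi n * x \<notin> B (- int \<delta>)" unfolding powi_mult_in_B_iff by (rule assms)
  then obtain y where y: "y \<in> B 0" "\<theta> (\<pi> powi n * x * y) \<noteq> 1"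
    using \<theta>_dual[of "\<pi> powi n * x"] by auto
  have "\<pi> powi n * y \<in> B n" using y(1) by (simp only: powi_mult_in_B_iff) simp
  moreover have "\<pi> powi n * x * y = x * (\<pi> powi n * y)" by simp
  then have "\<theta> (x * (\<pi> powi n * y)) \<noteq> 1" using y(2) by metis
  ultimately show ?thesis by (rule that)
qed

lemma continuous_\<theta>_mult: "continuous_on UNIV (\<lambda>x. \<theta> (x * \<xi>))"
proof -
  obtain k :: nat where k: "\<xi> \<in> B (- int k)" by (rule ex_in_B)
  have "periodic (int k - int \<delta>) (\<lambda>x. \<theta> (x * \<xi>))"
    unfolding periodic_def
  proof (intro allI impI)
    fix x y assume "x - y \<in> B (int k - int \<delta>)"
    then show "\<theta> (x * \<xi>) = \<theta> (y * \<xi>)" by (rule \<theta>_mult_cong[OF _ k]) simp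
  qed
  then show ?thesis by (rule periodic_continuous)
qed

lemma dissipative_\<theta>: "dissipative f \<Longrightarrow> dissipative (\<lambda>x. f x * \<theta> (x * \<xi>))"
  by (rule dissipative_mult_bounded[OF _ continuous_\<theta>_mult]) (simp_all add: vnorm_\<theta>)

definition FT :: "('k \<Rightarrow> 'c) \<Rightarrow> 'k \<Rightarrow> 'c" where
  "FT f \<xi> = I (\<lambda>x. f x * \<theta> (x * \<xi>))"

lemma FT_bound: "dissipative f \<Longrightarrow> (\<And>x. vnorm (f x) \<le> e) \<Longrightarrow> vnorm (FT f \<xi>) \<le> e"
  unfolding FT_def by (rule I_bound[OF dissipative_\<theta>]) (simp_all add: vnorm_mult vnorm_\<theta>)

text \<open>Outside \<open>B (- int k)\<close> the function is small. Inside, moving \<xi> by an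
  element of \<open>B (int k)\<close> changes the product with \<open>x\<close> by an integral
  element, on which \<theta> is trivial.\<close>

lemma continuous_FT:
  assumes f: "dissipative f" shows "continuous_on UNIV (FT f)"
  unfolding continuous_on_iff
proof (intro ballI allI impI)
  fix \<xi> and e :: real assume "0 < e"
  then obtain k :: nat where k: "\<And>x. x \<notin> B (- int k) \<Longrightarrow> vnorm (f x) \<le> e / 2"
    using dissipative_bounded[OF f, of "e / 2"] by auto
  have "dist (FT f \<xi>') (FT f \<xi>) < e" if \<xi>': "\<xi>' - \<xi> \<in> B (int k)" for \<xi>'
  proof -
    have "FT f \<xi>' - FT f \<xi> = I (\<lambda>x. f x * \<theta> (x * \<xi>') - f x * \<theta> (x * \<xi>))"
      unfolding FT_def by (rule I_diff[symmetric]) (rule dissipative_\<theta>[OF f])+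
    moreover have "vnorm (I (\<lambda>x. f x * \<theta> (x * \<xi>') - f x * \<theta> (x * \<xi>))) \<le> e / 2"
    proof (rule I_bound)
      show "dissipative (\<lambda>x. f x * \<theta> (x * \<xi>') - f x * \<theta> (x * \<xi>))"
        by (intro dissipative_diff dissipative_\<theta> f)
      fix x
      show "vnorm (f x * \<theta> (x * \<xi>') - f x * \<theta> (x * \<xi>)) \<le> e / 2"
      proof (cases "x \<in> B (- int k)")
        case True
        have "\<theta> (\<xi>' * x) = \<theta> (\<xi> * x)" by (rule \<theta>_mult_cong[OF \<xi>' True]) simp
        then show ?thesis using \<open>0 < e\<close> by (simp add: mult.commute)
      next
        case False
        then show ?thesis using k[of x] by (intro vnorm_diff_le) (simp_all add: vnorm_mult vnorm_\<theta>)
      qed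
    qed
    ultimately show ?thesis using \<open>0 < e\<close> by (simp add: dist_vnorm)
  qed
  moreover have "\<xi>' - \<xi> \<in> B (int k)" if "dist \<xi>' \<xi> < vnorm \<pi> powi (int k)" for \<xi>'
    using that by (simp add: in_B_iff dist_vnorm)
  ultimately show "\<exists>d>0. \<forall>\<xi>'\<in>UNIV. dist \<xi>' \<xi> < d \<longrightarrow> dist (FT f \<xi>') (FT f \<xi>) < e"
    using vnorm_pi_pos by (intro exI[of _ "vnorm \<pi> powi (int k)"]) simp
qed

text \<open>The character is constant on cosets of \<open>B (int N)\<close> for all \<open>y\<close>
  in the ball \<open>B m\<close> at once, which makes the approximation of the Fourier transform
  uniform there.\<close>

lemma good_additive_twist:
  assumes "y \<in> B m" "good N f e" "- int \<delta> - m \<le> int N"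
  shows "good N (\<lambda>x. f x * \<theta> (x * y)) e"
  unfolding good_def
proof (intro conjI allI impI)
  fix x x' assume xx: "x - x' \<in> B (int N)"
  have "\<theta> (x * y) = \<theta> (x' * y)" by (rule \<theta>_mult_cong[OF xx assms(1)]) (use assms(3) in simp)
  then have "f x * \<theta> (x * y) - f x' * \<theta> (x' * y) = (f x - f x') * \<theta> (x' * y)"
    by (simp add: left_diff_distrib)
  then show "vnorm (f x * \<theta> (x * y) - f x' * \<theta> (x' * y)) \<le> e"
    using assms(2) xx by (simp add: vnorm_mult vnorm_\<theta> good_def)
next
  fix x assume "x \<notin> B (- int N)"
  then show "vnorm (f x * \<theta> (x * y)) \<le> e"
    using assms(2) by (simp add: vnorm_mult vnorm_\<theta> good_def)
qed

text \<open>The Riemann sums of \<open>f\<close> give finite linear combinations of additive characters that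
  approximate the Fourier transform uniformly on the support of \<open>\<phi>\<close>; no double integral is needed.\<close>

lemma multiplication_formula:
  assumes f: "dissipative f" and F: "dissipative (FT f)" and \<phi>: "dissipative \<phi>" "supported m \<phi>"
    and \<phi>1: "\<And>x. vnorm (\<phi> x) \<le> 1"
  shows "I (\<lambda>y. FT f y * \<phi> y) = I (\<lambda>x. f x * FT \<phi> x)"
proof -
  have d1: "dissipative (\<lambda>y. FT f y * \<phi> y)"
    by (rule dissipative_mult_bounded[OF F dissipative_continuous[OF \<phi>(1)] \<phi>1])
  have d2: "dissipative (\<lambda>x. f x * FT \<phi> x)"
    by (rule dissipative_mult_bounded[OF f continuous_FT[OF \<phi>(1)] FT_bound[OF \<phi>(1) \<phi>1]])
  have "vnorm (I (\<lambda>y. FT f y * \<phi> y) - I (\<lambda>x. f x * FT \<phi> x)) \<le> e" if e: "e > 0" for e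
  proof -
    obtain N1 where N1: "good N1 f e" using dissipative_good[OF f e] by blast
    obtain N2 where N2: "good N2 (\<lambda>x. f x * FT \<phi> x) e" using dissipative_good[OF d2 e] by blast
    \<comment> \<open>The extra summand refines the mesh until \<theta> is constant on its cosets
      for every \<open>y\<close> in the support of \<phi>.\<close>
    define N where "N = max N1 N2 + nat (- int \<delta> - m)"
    have N: "good N f e" "good N (\<lambda>x. f x * FT \<phi> x) e" "- int \<delta> - m \<le> int N"
      by (rule good_mono[OF N1], simp add: N_def) (rule good_mono[OF N2], simp_all add: N_def)
    let ?T = "rep (int N) ` B (- int N)"
    define h where "h y = S N (\<lambda>x. f x * \<theta> (x * y))" for y
    have h: "h y * \<phi> y = (\<Sum>x\<in>?T. (vol (int N) * f x) * (\<phi> y * \<theta> (y * x)))" for y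
      by (simp add: h_def S_def riemann_def sum_distrib_left sum_distrib_right mult_ac)
    have dx: "dissipative (\<lambda>y. (vol (int N) * f x) * (\<phi> y * \<theta> (y * x)))" for x
      by (intro dissipative_cmult dissipative_\<theta> \<phi>(1))
    have dh: "dissipative (\<lambda>y. h y * \<phi> y)"
      unfolding h by (rule dissipative_sum) (rule dx)
    have "I (\<lambda>y. h y * \<phi> y) = (\<Sum>x\<in>?T. I (\<lambda>y. (vol (int N) * f x) * (\<phi> y * \<theta> (y * x))))"
      unfolding h by (rule I_sum) (rule dx)
    also have "\<dots> = (\<Sum>x\<in>?T. vol (int N) * f x * FT \<phi> x)"
      by (rule sum.cong[OF refl]) (simp only: I_cmult[OF dissipative_\<theta>[OF \<phi>(1)]] FT_def)
    also have "\<dots> = S N (\<lambda>x. f x * FT \<phi> x)"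
      by (simp add: S_def riemann_def sum_distrib_left mult.assoc)
    finally have Ih: "I (\<lambda>y. h y * \<phi> y) = S N (\<lambda>x. f x * FT \<phi> x)" .
    have "vnorm (FT f y * \<phi> y - h y * \<phi> y) \<le> e" for y
    proof (cases "y \<in> B m")
      case True
      have "vnorm (FT f y - h y) \<le> e"
        unfolding FT_def h_def
        by (rule I_error[OF dissipative_\<theta>[OF f] good_additive_twist[OF True N(1,3)]])
      then have "vnorm (FT f y - h y) * vnorm (\<phi> y) \<le> e * 1"
        using \<phi>1[of y] e by (intro mult_mono) auto
      then show ?thesis by (simp add: vnorm_mult flip: left_diff_distrib)
    next
      case False
      then show ?thesis using \<phi>(2) e by (simp add: supported_def)
    qed
    then have "vnorm (I (\<lambda>y. FT f y * \<phi> y - h y * \<phi> y)) \<le> e"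
      by (rule I_bound[OF dissipative_diff[OF d1 dh]])
    then have "vnorm (I (\<lambda>y. FT f y * \<phi> y) - S N (\<lambda>x. f x * FT \<phi> x)) \<le> e"
      unfolding I_diff[OF d1 dh] Ih .
    from vnorm_diff_le[OF this I_error[OF d2 N(2)]] show ?thesis by simp
  qed
  then show ?thesis by (rule vnorm_diff_le_imp_eq)
qed

section \<open>Fourier transforms of balls\<close>

definition ballf :: "int \<Rightarrow> 'k \<Rightarrow> 'c" where "ballf n x = (if x \<in> B n then 1 else 0)"

lemma ballf_eq_indicator: "ballf n = indicator ((+) 0 ` B n)"
  by (intro ext) (simp add: ballf_def indicator_def in_translate_B_iff)

lemma continuous_ballf: "continuous_on UNIV (ballf n)"
  unfolding ballf_eq_indicator by (rule periodic_continuous[OF periodic_indicator])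

lemma dissipative_ballf: "dissipative (ballf n)"
  unfolding ballf_eq_indicator by (rule dissipative_indicator)

lemma vnorm_ballf: "vnorm (ballf n x) \<le> 1"
  by (simp add: ballf_def)

lemma I_ballf: "I (ballf n) = vol n"
  unfolding ballf_eq_indicator by (rule I_indicator)

text \<open>Off the dual ball some translation by \<open>t \<in> B n\<close> multiplies the
  integrand by a constant other than 1 while preserving the integral, which therefore
  vanishes.\<close>

lemma FT_ballf: "FT (ballf n) \<xi> = (if \<xi> \<in> B (- int \<delta> - n) then vol n else 0)"
proof (cases "\<xi> \<in> B (- int \<delta> - n)")
  case True
  have "ballf n x * \<theta> (x * \<xi>) = ballf n x" for x
  proof (cases "x \<in> B n")
    case x: True
    have "x * \<xi> \<in> B (- int \<delta>)" using B_mult[OF x True] by simp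
    then show ?thesis by (simp add: \<theta>_trivial)
  qed (simp add: ballf_def)
  then have "(\<lambda>x. ballf n x * \<theta> (x * \<xi>)) = ballf n" by (rule ext)
  then show ?thesis using True by (simp only: FT_def I_ballf if_True)
next
  case False
  then obtain t where t: "t \<in> B n" "\<theta> (\<xi> * t) \<noteq> 1" by (rule \<theta>_nontrivial)
  let ?g = "\<lambda>x. ballf n x * \<theta> (x * \<xi>)"
  have d: "dissipative ?g" by (rule dissipative_\<theta>[OF dissipative_ballf])
  have "?g (1 * x + t) = \<theta> (\<xi> * t) * ?g x" for x
  proof -
    have "x + t \<in> B n \<longleftrightarrow> x \<in> B n" using B_diff_cancel[of "x + t" x n] t(1) by simp
    moreover have "\<theta> ((x + t) * \<xi>) = \<theta> (\<xi> * t) * \<theta> (x * \<xi>)"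
    proof -
      have "(x + t) * \<xi> = \<xi> * t + x * \<xi>" by (simp add: algebra_simps)
      then show ?thesis by (simp only: \<theta>_add)
    qed
    ultimately show ?thesis by (simp add: ballf_def)
  qed
  then have "I (\<lambda>x. \<theta> (\<xi> * t) * ?g x) = I ?g * of_nat q powi val 1"
    using I_affine[OF d, of 1 t] by simp
  then have "\<theta> (\<xi> * t) * I ?g = I ?g" by (simp add: I_cmult[OF d] val_unit)
  then have "I ?g = 0" using t(2) by simp
  then show ?thesis using False by (simp add: FT_def)
qed

end

subsection \<open>Multiplicative characters and the local coefficients\<close>

text \<open>The contrast between the two absolute values of \<open>l\<close>, below 1 in
  \<open>K\<close> and equal to 1 in C_p, forces \<psi> to be locally constant on units. The
  normalization at \<pi> leaves the unramified part to the variable \<open>w\<close>.\<close>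

locale tate = add_char \<pi> \<delta> sq \<theta>
  for \<pi> :: "'k::nonarch_field" and \<delta> :: nat and sq :: "'c::nonarch_field" and \<theta> :: "'k \<Rightarrow> 'c" +
  fixes l :: nat and \<psi> :: "'k \<Rightarrow> 'c"
  assumes l_k: "vnorm (of_nat l :: 'k) < 1" and l_c: "vnorm (of_nat l :: 'c) = 1"
    and mult_\<psi>: "mult_character \<psi>" and \<psi>_pi: "\<psi> \<pi> = 1"
begin

lemma \<psi>_0: "\<psi> 0 = 0"
  using mult_\<psi> by (simp add: mult_character_def)

lemma \<psi>_nz [simp]: "x \<noteq> 0 \<Longrightarrow> \<psi> x \<noteq> 0"
  using mult_\<psi> by (simp add: mult_character_def)

lemma \<psi>_mult: "\<psi> (x * y) = \<psi> x * \<psi> y"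
  using mult_\<psi> by (cases "x = 0 \<or> y = 0") (auto simp: mult_character_def)

lemma \<psi>_1 [simp]: "\<psi> 1 = 1"
  using \<psi>_mult[of 1 1] by simp

lemma \<psi>_inverse: "\<psi> (inverse x) = inverse (\<psi> x)"
proof (cases "x = 0")
  case False
  then have "\<psi> x * \<psi> (inverse x) = 1" by (simp flip: \<psi>_mult)
  then show ?thesis by (rule inverse_unique[symmetric])
qed (simp add: \<psi>_0)

lemma \<psi>_power: "\<psi> (x ^ n) = \<psi> x ^ n"
  by (induction n) (simp_all add: \<psi>_mult)

lemma \<psi>_pi_powi: "\<psi> (\<pi> powi n) = 1"
  by (simp add: power_int_def \<psi>_power \<psi>_inverse \<psi>_pi)

lemma continuous_\<psi>: "continuous_on (UNIV - {0}) \<psi>"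
  using mult_\<psi> by (simp add: mult_character_def)

lemma \<psi>_near_1:
  assumes "e > 0"
  shows "\<exists>m::nat. \<forall>u. u - 1 \<in> B (int m) \<longrightarrow> vnorm (\<psi> u - 1) < e"
proof -
  obtain d where d: "d > 0" "\<And>u. u \<noteq> 0 \<Longrightarrow> dist u 1 < d \<Longrightarrow> dist (\<psi> u) (\<psi> 1) < e"
    using continuous_\<psi> assms unfolding continuous_on_iff by (metis DiffI UNIV_I singletonD zero_neq_one)
  obtain m1 :: nat where m1: "vnorm \<pi> powi (int m1) < min d 1"
    using ex_vnorm_pi_powi_less[of "min d 1"] d(1) by auto
  have "vnorm (\<psi> u - 1) < e" if u: "u - 1 \<in> B (int m1)" for u
  proof -
    have "vnorm (u - 1) < min d 1" using u m1 by (simp only: in_B_iff)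
    moreover from this have "u \<noteq> 0" by auto
    ultimately show ?thesis using d(2)[of u] by (simp add: dist_vnorm)
  qed
  then show ?thesis by blast
qed

text \<open>In \<open>v ^ l - 1 = (v - 1) * (\<Sum>i<l. v ^ i)\<close> the geometric sum is
  congruent to \<open>l\<close>, hence to 0, modulo \<pi>. Each power of \<open>l\<close> thus gains
  one level.\<close>

lemma unit_power_l:
  assumes "u - 1 \<in> B (int m)" "1 \<le> m"
  shows "u ^ (l ^ k) - 1 \<in> B (int (m + k))"
proof (induction k)
  case 0
  then show ?case using assms(1) by simp
next
  case (Suc k)
  let ?v = "u ^ (l ^ k)"
  have v1: "vnorm (?v - 1) < 1"
    using B_mono[OF Suc, of 1] assms(2) by (simp flip: B_1)
  have vle: "vnorm ?v \<le> 1"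
    using vnorm_add_le[of "?v - 1" 1 1] v1 by simp
  have vp: "vnorm (?v ^ j) \<le> 1" for j
    unfolding vnorm_power[of ?v j] by (rule power_le_one[OF vnorm_nonneg vle])
  have "?v ^ i - 1 \<in> B 1" for i
  proof -
    have "vnorm (\<Sum>j<i. ?v ^ j) \<le> 1"
      by (rule vnorm_sum_le[OF vp]) simp
    then have "vnorm (?v - 1) * vnorm (\<Sum>j<i. ?v ^ j) \<le> vnorm (?v - 1) * 1"
      by (intro mult_left_mono) simp_all
    then show ?thesis using v1 unfolding B_1 power_diff_1_eq[of ?v i] vnorm_mult by linarith
  qed
  then have "vnorm (?v ^ i - 1) \<le> vnorm \<pi>" for i
    by (simp add: in_B_iff del: power_mult)
  then have "vnorm (\<Sum>i<l. (?v ^ i - 1)) \<le> vnorm \<pi>"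
    by (intro vnorm_sum_le) simp_all
  moreover have "vnorm (of_nat l :: 'k) \<le> vnorm \<pi>"
    using l_k by (simp add: in_B_iff flip: B_1)
  ultimately have "vnorm ((\<Sum>i<l. (?v ^ i - 1)) + of_nat l) \<le> vnorm \<pi>" by (rule vnorm_add_le)
  then have "(\<Sum>i<l. ?v ^ i) \<in> B 1" by (simp add: in_B_iff sum_subtractf)
  then have "(?v - 1) * (\<Sum>i<l. ?v ^ i) \<in> B (int (m + k) + 1)" by (rule B_mult[OF Suc])
  then have "?v ^ l - 1 \<in> B (int (m + k) + 1)" by (simp only: power_diff_1_eq)
  moreover have "?v ^ l = u ^ (l ^ Suc k)" by (simp add: mult.commute flip: power_mult)
  ultimately show ?case by (simp add: algebra_simps)
qed

text \<open>The same factorization on the side of C_p: there the geometric sum is congruent to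
  \<open>l\<close>, which is a unit, so nothing is gained.\<close>

lemma vnorm_power_l_diff:
  assumes "vnorm (y - 1 :: 'c) < 1"
  shows "vnorm (y ^ (l ^ k) - 1) = vnorm (y - 1)"
proof (induction k)
  case (Suc k)
  let ?v = "y ^ (l ^ k)"
  have v1: "vnorm (?v - 1) < 1" using Suc assms by simp
  have vle: "vnorm ?v \<le> 1"
    using vnorm_add_le[of "?v - 1" 1 1] v1 by simp
  have vp: "vnorm (?v ^ j) \<le> 1" for j
    unfolding vnorm_power[of ?v j] by (rule power_le_one[OF vnorm_nonneg vle])
  have "vnorm (?v ^ i - 1) \<le> vnorm (?v - 1)" for i
  proof -
    have "vnorm (\<Sum>j<i. ?v ^ j) \<le> 1"
      by (rule vnorm_sum_le[OF vp]) simp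
    then have "vnorm (?v - 1) * vnorm (\<Sum>j<i. ?v ^ j) \<le> vnorm (?v - 1) * 1"
      by (intro mult_left_mono) simp_all
    then show ?thesis unfolding power_diff_1_eq[of ?v i] vnorm_mult by linarith
  qed
  then have "vnorm (\<Sum>i<l. (?v ^ i - 1)) \<le> vnorm (?v - 1)"
    by (intro vnorm_sum_le) simp_all
  then have "vnorm ((\<Sum>i<l. ?v ^ i) - of_nat l) < 1" using v1 by (simp add: sum_subtractf)
  then have "vnorm (of_nat l - (\<Sum>i<l. ?v ^ i)) < vnorm (of_nat l :: 'c)"
    using l_c by (simp add: vnorm_minus_commute)
  then have "vnorm (\<Sum>i<l. ?v ^ i) = vnorm (of_nat l :: 'c)" by (rule vnorm_eq_if_diff_less)
  then have "vnorm (?v ^ l - 1) = vnorm (?v - 1)"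
    by (simp only: power_diff_1_eq[of ?v l] vnorm_mult l_c mult_1_right)
  moreover have "?v ^ l = y ^ (l ^ Suc k)" by (simp add: mult.commute flip: power_mult)
  ultimately show ?case using Suc by simp
qed simp

text \<open>For \<open>u\<close> near 1 the powers \<open>u ^ (l ^ k)\<close> tend to 1, so their
  images under \<psi> do too. But the distance of these images to 1 is the same for all
  \<open>k\<close>, hence 0.\<close>

lemma \<psi>_locally_constant: "\<exists>m::nat. \<forall>u. vnorm u = 1 \<and> u - 1 \<in> B (int m) \<longrightarrow> \<psi> u = 1"
proof -
  obtain m0 :: nat where m0: "\<And>u. u - 1 \<in> B (int m0) \<Longrightarrow> vnorm (\<psi> u - 1) < 1"
    using \<psi>_near_1[of 1] by auto
  \<comment> \<open>Level at least 1 is needed for the contraction in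
    \<open>unit_power_l\<close>.\<close>
  define m where "m = Suc m0"
  have "\<psi> u = 1" if u: "u - 1 \<in> B (int m)" for u
  proof -
    have "u - 1 \<in> B (int m0)" using u by (rule B_mono) (simp add: m_def)
    then have y: "vnorm (\<psi> u - 1) < 1" by (rule m0)
    have "vnorm (\<psi> u - 1) \<le> e" if e: "e > 0" for e
    proof -
      obtain k :: nat where k: "\<And>v. v - 1 \<in> B (int k) \<Longrightarrow> vnorm (\<psi> v - 1) < e"
        using \<psi>_near_1[OF e] by blast
      have "u ^ (l ^ k) - 1 \<in> B (int (m + k))" by (rule unit_power_l[OF u]) (simp add: m_def)
      then have "u ^ (l ^ k) - 1 \<in> B (int k)" by (rule B_mono) simp
      then have "vnorm (\<psi> u ^ (l ^ k) - 1) < e" using k by (simp flip: \<psi>_power)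
      then show ?thesis unfolding vnorm_power_l_diff[OF y] by simp
    qed
    then show ?thesis by (rule vnorm_diff_le_imp_eq)
  qed
  then show ?thesis by blast
qed

text \<open>The conductor exponent. At level 0 the congruence holds for every unit, so
  \<open>cond = 0\<close> is the unramified case, where \<psi> is trivial because of its value at
  \<pi>.\<close>

definition cond :: nat where
  "cond = (LEAST m::nat. \<forall>u. vnorm u = 1 \<and> u - 1 \<in> B (int m) \<longrightarrow> \<psi> u = 1)"

lemma cond: "vnorm u = 1 \<Longrightarrow> u - 1 \<in> B (int cond) \<Longrightarrow> \<psi> u = 1"
  using LeastI_ex[OF \<psi>_locally_constant] unfolding cond_def by blast

lemma below_cond:
  assumes "m < cond" obtains u where "vnorm u = 1" "u - 1 \<in> B (int m)" "\<psi> u \<noteq> 1"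
  using not_less_Least[of m "\<lambda>m. \<forall>u. vnorm u = 1 \<and> u - 1 \<in> B (int m) \<longrightarrow> \<psi> u = 1"] assms that
  unfolding cond_def by auto

text \<open>The units form a compact set containing all powers of \<open>u\<close>, so the powers of
  \<psi>(u) stay bounded.\<close>

lemma vnorm_\<psi>_unit_le: assumes "vnorm u = 1" shows "vnorm (\<psi> u) \<le> 1"
proof -
  let ?U = "{u::'k. vnorm u = 1}"
  have "?U = B 0 \<inter> - {y. y - 0 \<in> B 1}"
    by (auto simp: in_B_0_iff B_1)
  moreover have "compact (B 0 \<inter> - {y. y - 0 \<in> B 1})"
    using open_coset[of 0 1] by (intro compact_Int_closed compact_B) (simp add: closed_def)
  ultimately have U: "compact ?U" by simp
  have "continuous_on ?U \<psi>" by (rule continuous_on_subset[OF continuous_\<psi>]) auto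
  then have "compact (\<psi> ` ?U)" using U by (rule compact_continuous_image)
  then have "bounded (\<psi> ` ?U)" by (rule compact_imp_bounded)
  then obtain r where r: "\<And>v. v \<in> \<psi> ` ?U \<Longrightarrow> dist 0 v \<le> r"
    using bounded_any_center[of "\<psi> ` ?U" 0] by auto
  have pow: "vnorm (\<psi> u) ^ n \<le> r" for n
  proof -
    have "\<psi> (u ^ n) \<in> \<psi> ` ?U" using assms by (intro imageI) (simp add: vnorm_power)
    then show ?thesis using r[of "\<psi> (u ^ n)"] by (simp add: dist_vnorm vnorm_power \<psi>_power)
  qed
  show ?thesis
  proof (rule ccontr)
    assume "\<not> vnorm (\<psi> u) \<le> 1"
    then obtain n where "r < vnorm (\<psi> u) ^ n" using real_arch_pow[of "vnorm (\<psi> u)" r] by auto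
    with pow[of n] show False by simp
  qed
qed

lemma vnorm_\<psi>: assumes "x \<noteq> 0" shows "vnorm (\<psi> x) = 1"
proof -
  define u where "u = x / \<pi> powi (val x)"
  have u: "vnorm u = 1" unfolding u_def by (rule unit_part[OF assms])
  have "vnorm (\<psi> u) \<le> 1" by (rule vnorm_\<psi>_unit_le[OF u])
  moreover have "inverse (vnorm (\<psi> u)) \<le> 1"
    using vnorm_\<psi>_unit_le[of "inverse u"] u by (simp add: vnorm_inverse \<psi>_inverse)
  moreover have "u \<noteq> 0" using u by auto
  then have "0 < vnorm (\<psi> u)" by simp
  ultimately have "vnorm (\<psi> u) = 1" by (simp add: inverse_le_1_iff)
  moreover have "x = \<pi> powi (val x) * u" by (simp add: u_def)
  then have "\<psi> x = \<psi> u" by (metis \<psi>_mult \<psi>_pi_powi mult_1)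
  ultimately show ?thesis by simp
qed

section \<open>Characters on shells and Gauss sums\<close>

definition shell :: "int \<Rightarrow> 'k set" where "shell k = {x. x \<noteq> 0 \<and> val x = k}"

lemma shell_iff: "x \<in> shell k \<longleftrightarrow> x \<in> B k \<and> x \<notin> B (k + 1)"
proof (cases "x = 0")
  case False
  then show ?thesis unfolding in_B_val_iff[OF False] by (auto simp: shell_def)
qed (simp add: shell_def)

text \<open>\<open>F\<close> is the identity for the zeta integral and \<open>inverse\<close> for
  the dual one, so both characters are handled together.\<close>

definition shellf :: "('c \<Rightarrow> 'c) \<Rightarrow> int \<Rightarrow> 'k \<Rightarrow> 'c" where
  "shellf F k x = (if x \<in> shell k then F (\<psi> x) else 0)"

lemma shell_cong:
  assumes "x - y \<in> B (k + 1)" shows "x \<in> shell k \<longleftrightarrow> y \<in> shell k"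
  using B_diff_cancel[OF assms] B_diff_cancel[OF B_mono[OF assms, of k]]
  unfolding shell_iff by simp

text \<open>The extra level beyond \<open>cond\<close> ensures that \<open>x / y\<close> is a unit;
  for \<open>cond = 0\<close> the congruence at level \<open>cond\<close> would not.\<close>

lemma \<psi>_cong:
  assumes "y \<in> shell k" "x - y \<in> B (k + int (Suc cond))"
  shows "\<psi> x = \<psi> y"
proof -
  have y: "y \<noteq> 0" "val y = k" using assms(1) by (auto simp: shell_def)
  have "y * (x / y - 1) = x - y" using y(1) by (simp add: field_simps)
  then have "y * (x / y - 1) \<in> B (k + int (Suc cond))" using assms(2) by simp
  then have d: "x / y - 1 \<in> B (int (Suc cond))" unfolding in_B_mult_iff[OF y(1)] y(2) by simp
  then have "x / y - 1 \<in> B (int cond)" by (rule B_mono) simp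
  moreover have "x / y - 1 \<in> B 1" using d by (rule B_mono) simp
  then have "vnorm (1 - x / y) < vnorm (1::'k)" unfolding B_1 by (simp add: vnorm_minus_commute)
  then have "vnorm (x / y) = 1" using vnorm_eq_if_diff_less[of 1 "x / y"] by simp
  ultimately have "\<psi> (x / y) = 1" using cond by blast
  moreover have "x = (x / y) * y" using y(1) by simp
  ultimately show ?thesis by (metis \<psi>_mult mult_1)
qed

lemma periodic_shellf: "periodic (k + int (Suc cond)) (shellf F k)"
  unfolding periodic_def
proof (intro allI impI)
  fix x y assume xy: "x - y \<in> B (k + int (Suc cond))"
  have "x - y \<in> B (k + 1)" using xy by (rule B_mono) simp
  then have "x \<in> shell k \<longleftrightarrow> y \<in> shell k" by (rule shell_cong)
  then show "shellf F k x = shellf F k y" using \<psi>_cong[OF _ xy] by (auto simp: shellf_def)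
qed

lemma supported_shellf: "supported k (shellf F k)"
  by (auto simp: supported_def shellf_def shell_iff)

lemma continuous_shellf: "continuous_on UNIV (shellf F k)"
  by (rule periodic_continuous[OF periodic_shellf])

lemma dissipative_shellf: "dissipative (shellf F k)"
  by (rule dissipative_supported[OF continuous_shellf supported_shellf])

lemma vnorm_shellf_inverse: "vnorm (shellf inverse k x) \<le> 1"
  by (auto simp: shellf_def shell_def vnorm_inverse vnorm_\<psi>)

lemma vnorm_shellf_id: "vnorm (shellf (\<lambda>y. y) k x) \<le> 1"
  by (auto simp: shellf_def shell_def vnorm_\<psi>)

text \<open>The Gauss sum of the inverse character: its integral over the units against the additive
  character scaled by the \<open>j\<close>-th power of \<pi>.\<close>

definition coef :: "int \<Rightarrow> 'c" where
  "coef j = FT (shellf inverse 0) (\<pi> powi j)"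

lemma shell_scale: "c \<noteq> 0 \<Longrightarrow> c * x \<in> shell (val c + k) \<longleftrightarrow> x \<in> shell k"
  by (auto simp: shell_def val_mult)

lemma shellf_inverse_scale:
  assumes "c \<noteq> 0"
  shows "shellf inverse (val c + k) (c * x) = inverse (\<psi> c) * shellf inverse k x"
  using shell_scale[OF assms] by (simp add: shellf_def \<psi>_mult)

text \<open>Substituting \<open>c * y\<close> with \<open>c = \<pi> powi (val x + n) / x\<close>
  carries the unit shell to shell \<open>n\<close> and replaces \<open>x\<close> by a power of
  \<pi>. Since \<psi> is 1 on powers of \<pi>, the factor produced by \<open>c\<close> is exactly
  \<open>\<psi> x\<close>.\<close>

lemma FT_shellf:
  assumes "x \<noteq> 0"
  shows "FT (shellf inverse n) x = of_nat q powi (- n) * \<psi> x * coef (val x + n)"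
proof -
  define c where "c = \<pi> powi (val x + n) / x"
  have c: "c \<noteq> 0" "c * x = \<pi> powi (val x + n)" using assms by (simp_all add: c_def)
  have "val c + val x = val x + n"
    using val_mult[OF c(1) assms] unfolding c(2) val_pi_powi by simp
  then have vc: "val c = n" by simp
  have "\<psi> c * \<psi> x = 1" unfolding \<psi>_mult[symmetric] c(2) by (rule \<psi>_pi_powi)
  then have "inverse (\<psi> c) = \<psi> x" by (rule inverse_unique)
  then have "shellf inverse n (c * y + 0) * \<theta> ((c * y + 0) * x)
      = \<psi> x * (shellf inverse 0 y * \<theta> (y * \<pi> powi (val x + n)))" for y
    using shellf_inverse_scale[OF c(1), of 0 y] unfolding vc by (simp add: mult_ac flip: c(2))
  then have "I (\<lambda>y. \<psi> x * (shellf inverse 0 y * \<theta> (y * \<pi> powi (val x + n))))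
      = FT (shellf inverse n) x * of_nat q powi n"
    using I_affine[OF dissipative_\<theta>[OF dissipative_shellf[of inverse n], of x] c(1), of 0]
    unfolding vc FT_def by simp
  then have "\<psi> x * coef (val x + n) = FT (shellf inverse n) x * of_nat q powi n"
    unfolding I_cmult[OF dissipative_\<theta>[OF dissipative_shellf]] coef_def FT_def .
  then have "of_nat q powi (- n) * (\<psi> x * coef (val x + n))
      = FT (shellf inverse n) x * (of_nat q powi n * of_nat q powi (- n))"
    by (simp only: mult_ac)
  also have "of_nat q powi n * of_nat q powi (- n) = (1::'c)"
    by (simp flip: power_int_add)
  finally show ?thesis by (simp add: mult.assoc)
qed

text \<open>Substituting \<open>u * y\<close> preserves the volume and, by assumption, the additive
  factor, but multiplies the integral by \<open>inverse (\<psi> u)\<close>, which is not 1.\<close>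

lemma coef_unit_invariance:
  assumes u: "vnorm u = 1" and *: "\<And>y. y \<in> shell 0 \<Longrightarrow> \<theta> (u * y * \<pi> powi j) = \<theta> (y * \<pi> powi j)"
    and "\<psi> u \<noteq> 1"
  shows "coef j = 0"
proof -
  let ?g = "\<lambda>y. shellf inverse 0 y * \<theta> (y * \<pi> powi j)"
  have d: "dissipative ?g" by (rule dissipative_\<theta>[OF dissipative_shellf])
  have u0: "u \<noteq> 0" "val u = 0" using u val_unit by auto
  have "?g (u * y + 0) = inverse (\<psi> u) * ?g y" for y
  proof (cases "y \<in> shell 0")
    case True
    then show ?thesis using shellf_inverse_scale[OF u0(1), of 0 y] *[OF True] u0(2) by simp
  next
    case False
    then show ?thesis using shellf_inverse_scale[OF u0(1), of 0 y] u0(2) by (simp add: shellf_def)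
  qed
  then have "inverse (\<psi> u) * I ?g = I ?g"
    using I_affine[OF d u0(1), of 0] u0(2) by (simp add: I_cmult[OF d])
  then have "(inverse (\<psi> u) - 1) * I ?g = 0" by (simp add: left_diff_distrib)
  moreover have "inverse (\<psi> u) \<noteq> 1" using assms(3) by (metis inverse_1 inverse_inverse_eq)
  ultimately show ?thesis by (simp add: coef_def FT_def)
qed

text \<open>The additive character is too coarse here: it does not notice multiplication by a unit
  close to 1 on which \<psi> is still nontrivial.\<close>

lemma coef_above_conductor:
  assumes "- int \<delta> - int cond < j" "1 \<le> cond" shows "coef j = 0"
proof -
  \<comment> \<open>The least level at which multiplying by \<open>u\<close> is invisible to
    \<theta>; truncation at 0 covers \<open>j \<ge> - int \<delta>\<close>, where any unit is
    allowed.\<close>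
  define r where "r = nat (- int \<delta> - j)"
  have "r < cond" using assms by (simp add: r_def)
  then
  obtain u where u: "vnorm u = 1" "u - 1 \<in> B (int r)" "\<psi> u \<noteq> 1" by (rule below_cond)
  have "\<theta> (u * y * \<pi> powi j) = \<theta> (y * \<pi> powi j)" if y: "y \<in> shell 0" for y
  proof (rule \<theta>_cong)
    have "(u - 1) * y \<in> B (int r + 0)" using u(2) y by (intro B_mult) (auto simp: shell_iff)
    then have "\<pi> powi j * ((u - 1) * y) \<in> B (- int \<delta>)"
      unfolding powi_mult_in_B_iff by (rule B_mono) (simp add: r_def)
    then show "u * y * \<pi> powi j - y * \<pi> powi j \<in> B (- int \<delta>)" by (simp add: algebra_simps)
  qed
  then show ?thesis by (rule coef_unit_invariance[OF u(1) _ u(3)])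
qed

text \<open>Now the additive character is too fine: adding \<open>t \<in> B (int cond)\<close> to a
  unit preserves \<psi> but multiplies \<theta> by a constant other than 1. That \<open>cond\<close>
  is positive keeps the shifted element a unit.\<close>

lemma coef_below_conductor:
  assumes "j < - int \<delta> - int cond" "1 \<le> cond" shows "coef j = 0"
proof -
  have "\<pi> powi j \<notin> B (- int \<delta> - int cond)"
    using assms(1) unfolding in_B_iff vnorm_powi vnorm_pi_powi_le_iff by simp
  then obtain t where t: "t \<in> B (int cond)" "\<theta> (\<pi> powi j * t) \<noteq> 1" by (rule \<theta>_nontrivial)
  let ?g = "\<lambda>y. shellf inverse 0 y * \<theta> (y * \<pi> powi j)"
  have d: "dissipative ?g" by (rule dissipative_\<theta>[OF dissipative_shellf])
  have t1: "t \<in> B 1" using t(1) by (rule B_mono) (use assms(2) in simp)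
  have "?g (1 * y + t) = \<theta> (\<pi> powi j * t) * ?g y" for y
  proof -
    have sh: "y + t \<in> shell 0 \<longleftrightarrow> y \<in> shell 0" by (rule shell_cong) (simp add: t1)
    have "\<psi> (y + t) = \<psi> y" if y: "y \<in> shell 0"
    proof -
      have y0: "y \<noteq> 0" "val y = 0" using y by (auto simp: shell_def)
      have "y * ((y + t) / y - 1) = t" using y0(1) by (simp add: field_simps)
      then have "y * ((y + t) / y - 1) \<in> B (int cond)" using t(1) by simp
      then have "(y + t) / y - 1 \<in> B (int cond)" unfolding in_B_mult_iff[OF y0(1)] y0(2) by simp
      moreover have yt0: "y + t \<noteq> 0" "val (y + t) = 0" using y sh by (auto simp: shell_def)
      have "vnorm ((y + t) / y) = 1"
        unfolding vnorm_divide vnorm_eq_val[OF y0(1)] vnorm_eq_val[OF yt0(1)] y0(2) yt0(2) by simp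
      ultimately have "\<psi> ((y + t) / y) = 1" using cond by blast
      moreover have "y + t = ((y + t) / y) * y" using y0(1) by simp
      ultimately show ?thesis by (metis \<psi>_mult mult_1)
    qed
    then have "shellf inverse 0 (y + t) = shellf inverse 0 y" using sh by (simp add: shellf_def)
    moreover have "\<theta> ((y + t) * \<pi> powi j) = \<theta> (\<pi> powi j * t) * \<theta> (y * \<pi> powi j)"
    proof -
      have "(y + t) * \<pi> powi j = \<pi> powi j * t + y * \<pi> powi j" by (simp add: algebra_simps)
      then show ?thesis by (simp only: \<theta>_add)
    qed
    ultimately show ?thesis by simp
  qed
  then have "\<theta> (\<pi> powi j * t) * I ?g = I ?g"
    using I_affine[OF d, of 1 t] by (simp add: I_cmult[OF d] val_unit)
  then have "(\<theta> (\<pi> powi j * t) - 1) * I ?g = 0" by (simp add: left_diff_distrib)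
  then show ?thesis using t(2) by (simp add: coef_def FT_def)
qed

text \<open>No absolute value is computed. If this coefficient vanished, all of them would, and the
  inverse character restricted to the units would have zero Fourier transform. The multiplication
  formula against a function whose transform is supported on \<open>1 + B (int cond)\<close>, where
  the character is 1, would then make a volume zero.\<close>

lemma gauss_sum_nonzero:
  assumes c: "1 \<le> cond"
  shows "coef (- int \<delta> - int cond) \<noteq> 0"
proof
  assume zero: "coef (- int \<delta> - int cond) = 0"
  have coef0: "coef j = 0" for j
    using zero coef_above_conductor[OF _ c, of j] coef_below_conductor[OF _ c, of j]
    by (cases j "- int \<delta> - int cond" rule: linorder_cases) simp_all
  let ?\<phi> = "shellf inverse 0"
  have d\<phi>: "dissipative ?\<phi>" by (rule dissipative_shellf)
  have FT_pi: "FT ?\<phi> 1 = 0" using coef0[of 0] by (simp add: coef_def)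
  \<comment> \<open>\<open>FT_shellf\<close> says nothing at 0, but the transform takes the same
    value at 0 and at 1, because \<theta> is trivial on the units.\<close>
  have "?\<phi> y * \<theta> (y * 1) = ?\<phi> y * \<theta> (y * 0)" for y
  proof (cases "y \<in> shell 0")
    case True
    then have "y \<in> B 0" by (simp add: shell_iff)
    then have "y \<in> B (- int \<delta>)" by (rule B_mono) simp
    then show ?thesis using \<theta>_trivial by simp
  qed (simp add: shellf_def)
  then have "FT ?\<phi> 1 = FT ?\<phi> 0" unfolding FT_def by (intro arg_cong[where f = I] ext)
  then have FT0: "FT ?\<phi> 0 = 0" using FT_pi by simp
  have FT\<phi>: "FT ?\<phi> x = 0" for x
    by (cases "x = 0") (simp_all add: FT0 FT_shellf coef0)
  define n where "n = - int \<delta> - int cond"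
  \<comment> \<open>The ball dual to \<open>B n\<close> is \<open>B (int cond)\<close>, and the
    additive factor moves it so that it is centred at 1.\<close>
  define f where "f = (\<lambda>x. ballf n x * \<theta> (x * (- 1)))"
  have df: "dissipative f" unfolding f_def by (rule dissipative_\<theta>[OF dissipative_ballf])
  have FTf: "FT f = (\<lambda>y. vol n * indicator ((+) 1 ` B (int cond)) y)"
  proof
    fix y
    have "f x * \<theta> (x * y) = ballf n x * \<theta> (x * (y - 1))" for x
    proof -
      have "x * (y - 1) = x * (- 1) + x * y" by (simp add: algebra_simps)
      then show ?thesis by (simp only: f_def \<theta>_add mult.assoc)
    qed
    then have "FT f y = FT (ballf n) (y - 1)" unfolding FT_def by simp
    then show "FT f y = vol n * indicator ((+) 1 ` B (int cond)) y"
      unfolding FT_ballf by (simp add: n_def indicator_def in_translate_B_iff)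
  qed
  have dF: "dissipative (FT f)"
    unfolding FTf by (rule dissipative_cmult[OF dissipative_indicator])
  have "I (\<lambda>y. FT f y * ?\<phi> y) = I (\<lambda>x. f x * FT ?\<phi> x)"
    by (rule multiplication_formula[OF df dF d\<phi> supported_shellf vnorm_shellf_inverse])
  also have "\<dots> = 0" by (simp add: FT\<phi>)
  finally have I0: "I (\<lambda>y. FT f y * ?\<phi> y) = 0" .
  have "FT f y * ?\<phi> y = vol n * indicator ((+) 1 ` B (int cond)) y" for y
  proof (cases "y - 1 \<in> B (int cond)")
    case True
    have "y - 1 \<in> B 1" using True by (rule B_mono) (use c in simp)
    then have "vnorm (1 - y) < vnorm (1::'k)" unfolding B_1 by (simp add: vnorm_minus_commute)
    then have y1: "vnorm y = 1" using vnorm_eq_if_diff_less[of 1 y] by simp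
    then have "y \<in> shell 0" unfolding shell_def using val_unit by auto
    then have "?\<phi> y = 1" using cond[OF y1 True] by (simp add: shellf_def)
    then show ?thesis by (simp add: FTf)
  next
    case False
    then show ?thesis by (simp add: FTf indicator_def in_translate_B_iff)
  qed
  then have "vol n * vol (int cond) = 0"
    using I0 by (simp add: I_cmult[OF dissipative_indicator] I_indicator)
  then show False by simp
qed

section \<open>Coefficients of the zeta integrals and their transformation\<close>

lemma dissipative_shell_part:
  assumes "dissipative f" "F = inverse \<or> F = (\<lambda>y. y)"
  shows "dissipative (\<lambda>x. f x * shellf F k x)"
  using dissipative_mult_bounded[OF assms(1) continuous_shellf] assms(2)
    vnorm_shellf_id vnorm_shellf_inverse by auto

lemma dissipative_ball_part: "dissipative f \<Longrightarrow> dissipative (\<lambda>x. f x * ballf k x)"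
  by (rule dissipative_mult_bounded[OF _ continuous_ballf vnorm_ballf])

definition acoef :: "('c \<Rightarrow> 'c) \<Rightarrow> ('k \<Rightarrow> 'c) \<Rightarrow> int \<Rightarrow> 'c" where
  "acoef F f k = I (\<lambda>x. f x * shellf F k x)"

definition ball_int :: "('k \<Rightarrow> 'c) \<Rightarrow> int \<Rightarrow> 'c" where
  "ball_int f k = I (\<lambda>x. f x * ballf k x)"

lemma acoef_FT:
  assumes "dissipative f" "dissipative (FT f)"
  shows "acoef inverse (FT f) n = I (\<lambda>x. f x * FT (shellf inverse n) x)"
  unfolding acoef_def
  by (rule multiplication_formula[OF assms dissipative_shellf supported_shellf vnorm_shellf_inverse])

text \<open>Only one Gauss sum is nonzero, so the transform of the function on shell
  \<open>n\<close> lives on the single shell \<open>- int \<delta> - int cond - n\<close>, up to its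
  value at 0, where \<open>f\<close> vanishes.\<close>

lemma acoef_FT_ramified:
  assumes f: "dissipative f" "dissipative (FT f)" "f 0 = 0" and c: "1 \<le> cond"
  shows "of_nat q powi n * acoef inverse (FT f) n
    = coef (- int \<delta> - int cond) * acoef (\<lambda>y. y) f (- int \<delta> - int cond - n)"
proof -
  let ?G = "coef (- int \<delta> - int cond)" and ?k = "- int \<delta> - int cond - n"
  have "f x * FT (shellf inverse n) x
      = (of_nat q powi (- n) * ?G) * (f x * shellf (\<lambda>y. y) ?k x)" for x
  proof (cases "x = 0")
    case True
    then show ?thesis by (simp add: f(3))
  next
    case False
    have "\<psi> x * coef (val x + n) = ?G * shellf (\<lambda>y. y) ?k x"
    proof (cases "val x + n" "- int \<delta> - int cond" rule: linorder_cases)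
      case less
      then show ?thesis using coef_below_conductor[OF less c] by (simp add: shellf_def shell_def)
    next
      case equal
      then show ?thesis using False by (simp add: shellf_def shell_def)
    next
      case greater
      then show ?thesis using coef_above_conductor[OF greater c] by (simp add: shellf_def shell_def)
    qed
    then show ?thesis unfolding FT_shellf[OF False] by (simp add: mult_ac)
  qed
  then have "(\<lambda>x. f x * FT (shellf inverse n) x)
      = (\<lambda>x. (of_nat q powi (- n) * ?G) * (f x * shellf (\<lambda>y. y) ?k x))" by (rule ext)
  then have "acoef inverse (FT f) n = I (\<lambda>x. (of_nat q powi (- n) * ?G) * (f x * shellf (\<lambda>y. y) ?k x))"
    unfolding acoef_FT[OF f(1,2)] by (rule arg_cong)
  then have "acoef inverse (FT f) n = of_nat q powi (- n) * ?G * acoef (\<lambda>y. y) f ?k"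
    unfolding I_cmult[OF dissipative_shell_part[OF f(1) disjI2[OF refl]]] acoef_def[of "\<lambda>y. y" f] .
  moreover have "of_nat q powi n * of_nat q powi (- n) = (1::'c)"
    by (simp flip: power_int_add)
  ultimately show ?thesis by (simp add: mult.assoc[symmetric])
qed

lemma \<psi>_unramified: assumes "cond = 0" "x \<noteq> 0" shows "\<psi> x = 1"
proof -
  define u where "u = x / \<pi> powi (val x)"
  have u: "vnorm u = 1" unfolding u_def by (rule unit_part[OF assms(2)])
  have "u - 1 \<in> B (int cond)"
    using u assms(1) vnorm_diff_le[of u 1 1] by (simp add: in_B_0_iff)
  then have "\<psi> u = 1" by (rule cond[OF u])
  moreover have "x = \<pi> powi (val x) * u" by (simp add: u_def)
  ultimately show ?thesis by (metis \<psi>_mult \<psi>_pi_powi mult_1)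
qed

lemma shellf_unramified:
  assumes "cond = 0" "F 1 = 1" shows "shellf F k x = ballf k x - ballf (k + 1) x"
proof (cases "x \<in> shell k")
  case True
  then have "x \<noteq> 0" by (simp add: shell_def)
  then show ?thesis using True \<psi>_unramified[OF assms(1)] assms(2)
    by (simp add: shellf_def ballf_def shell_iff)
next
  case False
  then have "x \<in> B k \<longleftrightarrow> x \<in> B (k + 1)" using B_mono[of x "k + 1" k] by (auto simp: shell_iff)
  then show ?thesis using False by (simp add: shellf_def ballf_def)
qed

lemma acoef_ball_int:
  assumes "cond = 0" "dissipative f"
  shows "acoef (\<lambda>y. y) f k = ball_int f k - ball_int f (k + 1)"
  unfolding acoef_def ball_int_def shellf_unramified[of "\<lambda>y. y", OF assms(1) refl]
    I_diff[OF dissipative_ball_part[OF assms(2)] dissipative_ball_part[OF assms(2)], symmetric]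
  by (simp add: right_diff_distrib)

text \<open>A shell is the difference of two consecutive balls, and these transform into the dual
  balls weighted by their volumes; the ratio \<open>1 / q\<close> of the volumes is the weight of
  the second term.\<close>

lemma acoef_FT_unramified:
  assumes "cond = 0" "dissipative f" "dissipative (FT f)"
  shows "of_nat q powi n * acoef inverse (FT f) n
    = vol 0 * (ball_int f (- int \<delta> - n) - inverse (of_nat q) * ball_int f (- int \<delta> - n - 1))"
proof -
  let ?A = "ball_int f"
  have FTs: "FT (shellf inverse n) x = vol n * ballf (- int \<delta> - n) x - vol (n + 1) * ballf (- int \<delta> - n - 1) x" for x
  proof -
    have "FT (shellf inverse n) x = I (\<lambda>y. ballf n y * \<theta> (y * x) - ballf (n + 1) y * \<theta> (y * x))"
      unfolding FT_def shellf_unramified[of inverse, OF assms(1) inverse_1] by (simp add: left_diff_distrib)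
    also have "\<dots> = FT (ballf n) x - FT (ballf (n + 1)) x"
      unfolding FT_def by (rule I_diff) (rule dissipative_\<theta>[OF dissipative_ballf])+
    finally show ?thesis unfolding FT_ballf by (simp add: ballf_def diff_diff_eq)
  qed
  have "f x * FT (shellf inverse n) x
      = vol n * (f x * ballf (- int \<delta> - n) x) - vol (n + 1) * (f x * ballf (- int \<delta> - n - 1) x)" for x
    unfolding FTs by (simp add: algebra_simps)
  then have "acoef inverse (FT f) n = I (\<lambda>x. vol n * (f x * ballf (- int \<delta> - n) x)
      - vol (n + 1) * (f x * ballf (- int \<delta> - n - 1) x))"
    unfolding acoef_FT[OF assms(2,3)] by (intro arg_cong[where f = I] ext)
  then have "acoef inverse (FT f) n = vol n * ?A (- int \<delta> - n) - vol (n + 1) * ?A (- int \<delta> - n - 1)"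
    unfolding ball_int_def
    by (simp only: I_diff[OF dissipative_cmult dissipative_cmult] I_cmult dissipative_ball_part[OF assms(2)])
  moreover have "of_nat q powi n * vol n = vol 0"
    using vol_add[of n "- n"] by (simp add: mult.commute)
  moreover have "of_nat q powi n * vol (n + 1) = vol 0 * inverse (of_nat q)"
    using vol_add[of n 1] \<open>of_nat q powi n * vol n = vol 0\<close> by (simp add: mult.assoc[symmetric])
  ultimately show ?thesis by (simp add: right_diff_distrib mult.assoc[symmetric])
qed

text \<open>A partial sum over \<open>F\<close> reproduces \<open>g\<close> on the shells in
  \<open>F\<close>. On the omitted outer shells \<open>g\<close> is small by decay, on the inner
  ones by continuity together with \<open>g 0 = 0\<close>.\<close>

lemma shell_sum:
  assumes g: "dissipative g" "g 0 = 0"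
  shows "((\<lambda>k. I (\<lambda>x. g x * of_bool (x \<in> shell k))) has_sum I g) UNIV"
  unfolding has_sum_def tendsto_vnorm_iff
proof (intro allI impI)
  fix e :: real assume e: "e > 0"
  obtain N where N: "good N g (e / 2)" using dissipative_good[OF g(1), of "e / 2"] e by auto
  let ?s = "\<lambda>k x. of_bool (x \<in> shell k) :: 'c"
  have d: "dissipative (\<lambda>x. g x * ?s k x)" for k
  proof (rule dissipative_mult_bounded[OF g(1)])
    have "periodic (k + 1) (?s k)"
      unfolding periodic_def using shell_cong by (intro allI impI) simp
    then show "continuous_on UNIV (?s k)" by (rule periodic_continuous)
  qed simp
  have "vnorm ((\<Sum>k\<in>F. I (\<lambda>x. g x * ?s k x)) - I g) < e"
    if F: "finite F" "{- int N..int N} \<subseteq> F" for F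
  proof -
    have "(\<Sum>k\<in>F. I (\<lambda>x. g x * ?s k x)) - I g = I (\<lambda>x. (\<Sum>k\<in>F. g x * ?s k x) - g x)"
      unfolding I_diff[OF dissipative_sum[OF d] g(1)] I_sum[OF d] ..
    moreover have "vnorm (I (\<lambda>x. (\<Sum>k\<in>F. g x * ?s k x) - g x)) \<le> e / 2"
    proof (rule I_bound[OF dissipative_diff[OF dissipative_sum[OF d] g(1)]])
      fix x
      show "vnorm ((\<Sum>k\<in>F. g x * ?s k x) - g x) \<le> e / 2"
      proof (cases "x = 0")
        case True
        then show ?thesis using e by (simp add: g(2))
      next
        case False
        have "(\<Sum>k\<in>F. g x * ?s k x) = (\<Sum>k\<in>F. if k = val x then g x else 0)"
          by (rule sum.cong[OF refl]) (use False in \<open>auto simp: shell_def\<close>)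
        also have "\<dots> = (if val x \<in> F then g x else 0)" using F(1) by simp
        finally have eq: "(\<Sum>k\<in>F. g x * ?s k x) - g x = (if val x \<in> F then 0 else - g x)" by simp
        have "vnorm (g x) \<le> e / 2" if "val x \<notin> F"
        proof (cases "val x < - int N")
          case True
          then have "x \<notin> B (- int N)" unfolding in_B_val_iff[OF False] by simp
          then show ?thesis using N by (simp add: good_def)
        next
          case le: False
          have "val x \<notin> {- int N..int N}" using that F(2) by blast
          then have "x - 0 \<in> B (int N)" using le unfolding diff_zero in_B_val_iff[OF False] by simp
          then have "vnorm (g x - g 0) \<le> e / 2" using N unfolding good_def by blast
          then show ?thesis by (simp add: g(2))
        qed
        then show ?thesis unfolding eq using e by simp
      qed
    qed
    ultimately show ?thesis using e by simp
  qed
  then show "\<forall>\<^sub>F F in finite_subsets_at_top UNIV. vnorm ((\<Sum>k\<in>F. I (\<lambda>x. g x * ?s k x)) - I g) < e"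
    unfolding eventually_finite_subsets_at_top by (intro exI[of _ "{- int N..int N}"]) simp
qed

end

section \<open>Unramified characters and the zeta integral as a Laurent series\<close>

context local_field
begin

definition unr :: "'c::nonarch_field \<Rightarrow> 'k \<Rightarrow> 'c" where
  "unr w x = (if x = 0 then 0 else w powi (val x))"

lemma val_locally_constant:
  assumes "x \<noteq> 0"
  shows "eventually (\<lambda>y. y \<noteq> 0 \<and> val y = val x) (nhds x)"
  unfolding eventually_nhds
proof (intro exI conjI ballI)
  show "open {y. y - x \<in> B (val x + 1)}" by (rule open_coset)
  show "x \<in> {y. y - x \<in> B (val x + 1)}" by simp
  fix y assume y: "y \<in> {y. y - x \<in> B (val x + 1)}"
  then have "y \<in> B (val x + 1) \<longleftrightarrow> x \<in> B (val x + 1)" using B_diff_cancel by blast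
  then have y1: "y \<notin> B (val x + 1)" unfolding in_B_val_iff[OF assms] by simp
  then show "y \<noteq> 0" by auto
  have "y - x \<in> B (val x)" using y B_mono[of "y - x" "val x + 1" "val x"] by simp
  then have "y \<in> B (val x)" using B_diff_cancel in_B_val_iff[OF assms] by blast
  then show "val y = val x" using y1 unfolding in_B_val_iff[OF \<open>y \<noteq> 0\<close>] by simp
qed

lemma continuous_on_unr: "continuous_on (UNIV - {0}) (unr w :: 'k \<Rightarrow> 'c::nonarch_field)"
proof (rule continuous_at_imp_continuous_on, intro ballI)
  fix x :: 'k assume "x \<in> UNIV - {0}"
  then have x: "x \<noteq> 0" by simp
  have "eventually (\<lambda>y. unr w y = (unr w x :: 'c)) (nhds x)"
    using val_locally_constant[OF x] by eventually_elim (use x in \<open>simp add: unr_def\<close>)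
  then have "isCont (unr w :: 'k \<Rightarrow> 'c) x \<longleftrightarrow> isCont (\<lambda>y. unr w x :: 'c) x" by (rule isCont_cong)
  then show "isCont (unr w :: 'k \<Rightarrow> 'c) x" by simp
qed

lemma mult_character_unr:
  assumes "w \<noteq> 0" shows "mult_character (unr w :: 'k \<Rightarrow> 'c::nonarch_field)"
  unfolding mult_character_def
proof (intro conjI allI impI)
  show "continuous_on (UNIV - {0}) (unr w :: 'k \<Rightarrow> 'c)" by (rule continuous_on_unr)
qed (use assms in \<open>auto simp: unr_def val_mult power_int_add\<close>)

lemma unr_pi: "unr w \<pi> = w"
  using val_pi_powi[of 1] by (simp add: unr_def)

lemma unram_char_eq:
  assumes "w \<noteq> 0" shows "unram_char \<pi> w = (unr w :: 'k \<Rightarrow> 'c::nonarch_field)"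
  unfolding unram_char_def
proof (rule the_equality)
  show "mult_character (unr w :: 'k \<Rightarrow> 'c) \<and> unramified (unr w) \<and> unr w \<pi> = w"
    using mult_character_unr[OF assms] unr_pi val_unit by (auto simp: unramified_def unr_def)
next
  fix \<psi> :: "'k \<Rightarrow> 'c" assume \<psi>: "mult_character \<psi> \<and> unramified \<psi> \<and> \<psi> \<pi> = w"
  then have nz: "\<And>x. x \<noteq> 0 \<Longrightarrow> \<psi> x \<noteq> 0" and mult: "\<And>x y. x \<noteq> 0 \<Longrightarrow> y \<noteq> 0 \<Longrightarrow> \<psi> (x * y) = \<psi> x * \<psi> y"
    and z: "\<psi> 0 = 0" and unit: "\<And>u. vnorm u = 1 \<Longrightarrow> \<psi> u = 1" and pi: "\<psi> \<pi> = w"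
    by (auto simp: mult_character_def unramified_def)
  have pow: "\<psi> (x ^ n) = \<psi> x ^ n" if "x \<noteq> 0" for x n
    by (induction n) (simp_all add: unit mult that)
  have inv: "\<psi> (inverse x) = inverse (\<psi> x)" if "x \<noteq> 0" for x
  proof -
    have "\<psi> x * \<psi> (inverse x) = 1" using mult[of x "inverse x"] that unit[of 1] by simp
    then show ?thesis by (rule inverse_unique[symmetric])
  qed
  show "\<psi> = unr w"
  proof
    fix x
    show "\<psi> x = unr w x"
    proof (cases "x = 0")
      case False
      have "\<psi> (\<pi> powi (val x) * (x / \<pi> powi (val x))) = \<psi> (\<pi> powi (val x)) * \<psi> (x / \<pi> powi (val x))"
        using False by (intro mult) simp_all
      also have "\<psi> (x / \<pi> powi (val x)) = 1" by (rule unit[OF unit_part[OF False]])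
      also have "\<psi> (\<pi> powi (val x)) = w powi (val x)"
        by (simp add: power_int_def pow inv pi)
      finally show ?thesis using False by (simp add: unr_def)
    qed (simp add: z unr_def)
  qed
qed

lemma eventually_at_0_B: "eventually (\<lambda>x. x \<in> B n \<and> x \<noteq> 0) (at (0::'k))"
  unfolding eventually_at_topological
  using open_coset[of 0 n] by (intro exI[of _ "{y. y - 0 \<in> B n}"]) simp

end

context tate
begin

text \<open>Both character factors have absolute value 1 away from 0, so the product is dominated by
  \<open>f\<close>. As \<open>f 0 = 0\<close>, its limit at 0 is 0, which is also its value there,
  so \<open>twist\<close> reduces to the plain product.\<close>

lemma zeta_dissipative:
  assumes f: "dissipative f" "f 0 = 0" and F: "F = inverse \<or> F = (\<lambda>y. y)" and w: "vnorm w = 1"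
  shows "twist f (\<lambda>x. F (\<psi> x) * unr w x) = (\<lambda>x. f x * (F (\<psi> x) * unr w x))" (is "_ = ?g")
    and "dissipative (\<lambda>x. f x * (F (\<psi> x) * unr w x))"
proof -
  have bound: "vnorm (?g x) \<le> vnorm (f x)" for x
    using F w by (cases "x = 0") (auto simp: vnorm_mult unr_def vnorm_powi vnorm_inverse vnorm_\<psi>)
  have small: "\<exists>N::nat. \<forall>x\<in>B (int N). vnorm (?g x) < e" if e: "e > 0" for e
  proof -
    obtain N where N: "good N f (e / 2)" using dissipative_good[OF f(1), of "e / 2"] e by auto
    have "vnorm (?g x) < e" if "x \<in> B (int N)" for x
    proof -
      have "vnorm (f x - f 0) \<le> e / 2" using N that unfolding good_def by (metis diff_zero)
      then show ?thesis using bound[of x] e by (simp add: f(2))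
    qed
    then show ?thesis by blast
  qed
  have lim0: "(?g \<longlongrightarrow> 0) (at 0)"
    unfolding tendsto_vnorm_iff
  proof (intro allI impI)
    fix e :: real assume "e > 0"
    then obtain N :: nat where N: "\<And>x. x \<in> B (int N) \<Longrightarrow> vnorm (?g x) < e" using small by blast
    show "\<forall>\<^sub>F x in at 0. vnorm (?g x - 0) < e"
      using eventually_at_0_B[of "int N"] by eventually_elim (use N in simp)
  qed
  have g0: "?g 0 = 0" by (simp add: unr_def)
  show "twist f (\<lambda>x. F (\<psi> x) * unr w x) = ?g"
  proof
    fix x
    show "twist f (\<lambda>x. F (\<psi> x) * unr w x) x = ?g x"
      using tendsto_Lim[OF at_0_nontrivial lim0] g0 by (cases "x = 0") (simp_all add: twist_def)
  qed
  show "dissipative ?g"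
  proof (rule dissipativeI)
    show "continuous_on UNIV ?g"
    proof (rule continuous_at_imp_continuous_on, intro ballI)
      fix x :: 'k
      show "isCont ?g x"
      proof (cases "x = 0")
        case True
        have "(?g \<longlongrightarrow> ?g 0) (at 0)" unfolding g0 by (rule lim0)
        then show ?thesis unfolding isCont_def True .
      next
        case False
        \<comment> \<open>Near \<open>x\<close> the valuation is constant, so the integrand agrees
          with \<open>f\<close> times a continuous function on one shell.\<close>
        let ?h = "\<lambda>y. f y * (shellf F (val x) y * w powi (val x))"
        have "continuous_on UNIV ?h"
          by (intro continuous_on_mult' dissipative_continuous f(1) continuous_shellf continuous_on_const)
        then have "isCont ?h x" by (simp add: continuous_on_eq_continuous_at)
        moreover have "eventually (\<lambda>y. ?g y = ?h y) (nhds x)"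
          using val_locally_constant[OF False]
          by eventually_elim (simp add: unr_def shellf_def shell_def)
        ultimately show ?thesis using isCont_cong[of ?g ?h x] by simp
      qed
    qed
    fix e :: real assume "e > 0"
    then obtain N :: nat where N: "\<And>x. x \<notin> B (- int N) \<Longrightarrow> vnorm (f x) \<le> e"
      using dissipative_bounded[OF f(1)] by blast
    have "vnorm (?g x) \<le> e" if "x \<notin> B (- int N)" for x
      using N[OF that] bound[of x] by simp
    then show "\<exists>N::nat. \<forall>x. x \<notin> B (- int N) \<longrightarrow> vnorm (?g x) \<le> e" by blast
  qed
qed

lemma zeta_has_sum:
  assumes f: "dissipative f" "f 0 = 0" and F: "F = inverse \<or> F = (\<lambda>y. y)" and w: "vnorm w = 1"
  shows "((\<lambda>k. acoef F f k * w powi k) has_sum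
    zeta_integral \<pi> \<delta> sq f (\<lambda>x. F (\<psi> x) * unram_char \<pi> w x)) UNIV"
proof -
  let ?g = "\<lambda>x. f x * (F (\<psi> x) * unr w x)"
  have "w \<noteq> 0" using w by auto
  have "((\<lambda>k. I (\<lambda>x. ?g x * of_bool (x \<in> shell k))) has_sum I ?g) UNIV"
    by (rule shell_sum[OF zeta_dissipative(2)[OF assms]]) (simp add: unr_def)
  moreover have "I (\<lambda>x. ?g x * of_bool (x \<in> shell k)) = acoef F f k * w powi k" for k
  proof -
    have "?g x * of_bool (x \<in> shell k) = w powi k * (f x * shellf F k x)" for x
      by (auto simp: unr_def shellf_def shell_def)
    then have "I (\<lambda>x. ?g x * of_bool (x \<in> shell k)) = I (\<lambda>x. w powi k * (f x * shellf F k x))"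
      by (intro arg_cong[where f = I] ext)
    also have "\<dots> = w powi k * acoef F f k"
      unfolding acoef_def by (rule I_cmult[OF dissipative_shell_part[OF f(1) F]])
    finally show ?thesis by (simp only: mult.commute)
  qed
  ultimately show ?thesis
    unfolding zeta_integral_def unram_char_eq[OF \<open>w \<noteq> 0\<close>] zeta_dissipative(1)[OF assms] by simp
qed

lemma acoef_bound:
  assumes "dissipative f" "F = inverse \<or> F = (\<lambda>y. y)" "0 \<le> e" "\<And>x. x \<in> shell k \<Longrightarrow> vnorm (f x) \<le> e"
  shows "vnorm (acoef F f k) \<le> e"
  unfolding acoef_def
proof (rule I_bound[OF dissipative_shell_part[OF assms(1,2)]])
  fix x
  show "vnorm (f x * shellf F k x) \<le> e"
  proof (cases "x \<in> shell k")
    case True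
    then have "vnorm (F (\<psi> x)) = 1" using assms(2) by (auto simp: shell_def vnorm_inverse vnorm_\<psi>)
    then show ?thesis using assms(4)[OF True] True by (simp add: shellf_def vnorm_mult)
  qed (simp add: shellf_def assms(3))
qed

end

subsection \<open>Laurent series on annuli\<close>

lemma has_sum_laurent_shift:
  fixes w :: "'c::nonarch_field"
  assumes "((\<lambda>k. a k * w powi k) has_sum s) UNIV" "w \<noteq> 0"
  shows "((\<lambda>k. c * a (k - n) * w powi k) has_sum (c * w powi n * s)) UNIV"
proof -
  have "((\<lambda>k. (c * w powi n) * (a k * w powi k)) has_sum (c * w powi n * s)) UNIV"
    by (rule has_sum_cmult_right[OF assms(1)])
  moreover have "bij_betw (\<lambda>k::int. k - n) UNIV UNIV"
    by (rule bij_betw_byWitness[of _ "\<lambda>k. k + n"]) auto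
  ultimately have "((\<lambda>k. (c * w powi n) * (a (k - n) * w powi (k - n))) has_sum (c * w powi n * s)) UNIV"
    using has_sum_reindex_bij_betw[of "\<lambda>k::int. k - n" UNIV UNIV "\<lambda>k. (c * w powi n) * (a k * w powi k)"]
    by blast
  moreover have "(c * w powi n) * (a (k - n) * w powi (k - n)) = c * a (k - n) * w powi k" for k
    using assms(2) by (simp add: power_int_diff)
  ultimately show ?thesis by simp
qed

lemma rigid_analytic_mult_monom:
  assumes "rigid_analytic_on J (F :: 'c::nonarch_field \<Rightarrow> 'c)"
  shows "rigid_analytic_on J (\<lambda>w. c * w powi n * F w)"
proof -
  obtain a where a: "\<And>w. w \<in> annulus J \<Longrightarrow> ((\<lambda>n. a n * w powi n) has_sum F w) UNIV"
    using assms unfolding rigid_analytic_on_def by blast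
  have "((\<lambda>k. c * a (k - n) * w powi k) has_sum (c * w powi n * F w)) UNIV" if "w \<in> annulus J" for w
    by (rule has_sum_laurent_shift[OF a[OF that]]) (use that in \<open>simp add: annulus_def\<close>)
  then show ?thesis
    unfolding rigid_analytic_on_def by (intro exI[of _ "\<lambda>k. c * a (k - n)"]) blast
qed

lemma rigid_analytic_add:
  assumes "rigid_analytic_on J (F :: 'c::nonarch_field \<Rightarrow> 'c)" "rigid_analytic_on J G"
  shows "rigid_analytic_on J (\<lambda>w. F w + G w)"
proof -
  obtain a where a: "\<And>w. w \<in> annulus J \<Longrightarrow> ((\<lambda>n. a n * w powi n) has_sum F w) UNIV"
    using assms(1) unfolding rigid_analytic_on_def by blast
  obtain b where b: "\<And>w. w \<in> annulus J \<Longrightarrow> ((\<lambda>n. b n * w powi n) has_sum G w) UNIV"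
    using assms(2) unfolding rigid_analytic_on_def by blast
  have "((\<lambda>n. (a n + b n) * w powi n) has_sum (F w + G w)) UNIV" if "w \<in> annulus J" for w
    unfolding distrib_right by (rule has_sum_add[OF a[OF that] b[OF that]])
  then show ?thesis
    unfolding rigid_analytic_on_def by (intro exI[of _ "\<lambda>n. a n + b n"]) blast
qed

lemma rigid_analytic_one: "rigid_analytic_on J (\<lambda>w. 1 :: 'c::nonarch_field)"
proof -
  have "((\<lambda>n. of_bool (n = 0) * w powi n) has_sum (1::'c)) UNIV" for w
    by (rule has_sum_finite_neutralI[of "{0}"]) simp_all
  then show ?thesis unfolding rigid_analytic_on_def by (intro exI[of _ "\<lambda>n. of_bool (n = 0)"]) blast
qed

lemma rigid_analytic_monom: "rigid_analytic_on J (\<lambda>w. c * w powi n :: 'c::nonarch_field)"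
  using rigid_analytic_mult_monom[OF rigid_analytic_one, of J c n] by simp

lemma rigid_analytic_mono: "rigid_analytic_on I F \<Longrightarrow> J \<subseteq> I \<Longrightarrow> rigid_analytic_on J F"
  unfolding rigid_analytic_on_def annulus_def by blast

lemma non_zero_divisor_one: "non_zero_divisor_on J (\<lambda>w. 1 :: 'c::nonarch_field)"
  unfolding non_zero_divisor_on_def using rigid_analytic_one by simp

lemma rigid_analytic_imp_meromorphic:
  assumes "rigid_analytic_on I (F :: 'c::nonarch_field \<Rightarrow> 'c)"
  shows "rigid_meromorphic_on I F"
  unfolding rigid_meromorphic_on_def
proof
  fix J assume "J \<in> affinoid_radii TYPE('c) I"
  then have "J \<subseteq> I" by (simp add: affinoid_radii_def)
  then show "\<exists>G H. rigid_analytic_on J G \<and> non_zero_divisor_on J H \<and>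
      (\<forall>w\<in>annulus J. H w \<noteq> 0 \<longrightarrow> F w = G w / H w)"
    using rigid_analytic_mono[OF assms] non_zero_divisor_one
    by (intro exI[of _ F] exI[of _ "\<lambda>w. 1"]) simp
qed

lemma vnorm_powi_diff_le:
  fixes r w :: "'c::nonarch_field"
  assumes "vnorm r = 1" "vnorm w = 1"
  shows "vnorm (r powi k - w powi k) \<le> vnorm (r - w)"
proof -
  have nat: "vnorm (r ^ n - w ^ n) \<le> vnorm (r - w)" for n
  proof (induction n)
    case (Suc n)
    have "r ^ Suc n - w ^ Suc n = r * (r ^ n - w ^ n) + (r - w) * w ^ n" by (simp add: algebra_simps)
    moreover have "vnorm (r * (r ^ n - w ^ n) + (r - w) * w ^ n) \<le> vnorm (r - w)"
      by (rule vnorm_add_le) (use Suc assms in \<open>simp_all add: vnorm_mult vnorm_power\<close>)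
    ultimately show ?case by simp
  qed simp
  show ?thesis
  proof (cases "0 \<le> k")
    case True
    then show ?thesis using nat[of "nat k"] by (simp add: power_int_def)
  next
    case False
    define n where "n = nat (- k)"
    have k: "k = - int n" using False by (simp add: n_def)
    have rw: "r \<noteq> 0" "w \<noteq> 0" using assms by auto
    have "r powi k - w powi k = (w ^ n - r ^ n) / (r ^ n * w ^ n)"
      using rw unfolding k by (simp add: power_int_minus divide_simps)
    then have "vnorm (r powi k - w powi k) = vnorm (r ^ n - w ^ n)"
      using assms by (simp add: vnorm_divide vnorm_mult vnorm_power vnorm_minus_commute)
    then show ?thesis using nat[of n] by simp
  qed
qed

text \<open>Each term outside a suitable finite set is the difference of two partial sums close to
  the limit.\<close>

lemma has_sum_bounded_terms:
  fixes t :: "'i \<Rightarrow> 'c::nonarch_field"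
  assumes "(t has_sum s) UNIV"
  shows "\<exists>C. \<forall>i. vnorm (t i) \<le> C"
proof -
  have "\<forall>\<^sub>F F in finite_subsets_at_top UNIV. vnorm (sum t F - s) < 1"
    using assms unfolding has_sum_def tendsto_vnorm_iff by simp
  then obtain F0 where F0: "finite F0" "\<And>F. finite F \<Longrightarrow> F0 \<subseteq> F \<Longrightarrow> vnorm (sum t F - s) < 1"
    unfolding eventually_finite_subsets_at_top by auto
  define C where "C = Max (insert 1 ((\<lambda>i. vnorm (t i)) ` F0))"
  have "vnorm (t i) \<le> C" for i
  proof (cases "i \<in> F0")
    case True
    then show ?thesis unfolding C_def using F0(1) by (intro Max_ge) auto
  next
    case False
    have "vnorm ((sum t (insert i F0) - s) - (sum t F0 - s)) < 1"
      by (rule vnorm_diff_less; rule F0(2)) (use F0(1) in auto)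
    moreover have "(sum t (insert i F0) - s) - (sum t F0 - s) = t i" using False F0(1) by simp
    ultimately have "vnorm (t i) \<le> 1" by simp
    also have "1 \<le> C" unfolding C_def using F0(1) by (intro Max_ge) auto
    finally show ?thesis .
  qed
  then show ?thesis by blast
qed

lemma has_sum_vnorm_le:
  fixes t :: "'i \<Rightarrow> 'c::nonarch_field"
  assumes "(t has_sum s) UNIV" "\<And>i. vnorm (t i) \<le> C" "0 \<le> C"
  shows "vnorm s \<le> C"
  using assms(1) unfolding has_sum_def
  by (rule vnorm_tendsto_le) (auto intro!: always_eventually vnorm_sum_le assms)

text \<open>A Laurent series is Lipschitz on the unit circle, so its values off the zero \<open>1 / b\<close> of the
  linear factor determine its value there.\<close>

lemma non_zero_divisor_linear:
  fixes b \<epsilon> :: "'c::nonarch_field"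
  assumes b: "vnorm b = 1" and \<epsilon>: "\<epsilon> \<noteq> 0" "vnorm \<epsilon> < 1"
  shows "non_zero_divisor_on J (\<lambda>w. 1 - b * w)"
  unfolding non_zero_divisor_on_def
proof (intro conjI allI impI ballI)
  have "rigid_analytic_on J (\<lambda>w. 1 + (- b) * w powi 1)"
    by (rule rigid_analytic_add[OF rigid_analytic_one rigid_analytic_monom])
  then show "rigid_analytic_on J (\<lambda>w. 1 - b * w)" by simp
next
  fix H :: "'c \<Rightarrow> 'c" and w :: 'c assume H: "rigid_analytic_on J H \<and> (\<forall>w\<in>annulus J. (1 - b * w) * H w = 0)"
    and w: "w \<in> annulus J"
  show "H w = 0"
  proof (cases "b * w = 1")
    case False
    then show ?thesis using H w by auto
  next
    case True
    have vw: "vnorm w = 1" using arg_cong[OF True, of vnorm] b by (simp add: vnorm_mult)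
    obtain a where a: "\<And>w. w \<in> annulus J \<Longrightarrow> ((\<lambda>n. a n * w powi n) has_sum H w) UNIV"
      using H unfolding rigid_analytic_on_def by blast
    obtain C where C: "\<And>n. vnorm (a n * w powi n) \<le> C" using has_sum_bounded_terms[OF a[OF w]] by blast
    have C0: "0 \<le> C" using C[of 0] vnorm_nonneg order_trans by blast
    have aC: "vnorm (a n) \<le> C" for n using C[of n] vw by (simp add: vnorm_mult vnorm_powi)
    have Hbound: "vnorm (H w) \<le> C * vnorm \<epsilon> ^ Suc i" for i
    proof -
      \<comment> \<open>These points converge to \<open>w\<close>, differ from it, and lie on the
        same circle, hence in the same annulus; there the linear factor is nonzero and
        \<open>H\<close> vanishes.\<close>
      define v where "v = w + \<epsilon> ^ Suc i"
      have "w - v = - (\<epsilon> ^ Suc i)" by (simp add: v_def)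
      then have d: "vnorm (w - v) = vnorm \<epsilon> ^ Suc i" by (simp only: vnorm_minus vnorm_power)
      have "vnorm \<epsilon> ^ Suc i < 1" using \<epsilon> by (intro power_Suc_less_one) simp_all
      then have "vnorm v = vnorm w" using vnorm_eq_if_diff_less[of w v] d vw by simp
      then have v: "v \<in> annulus J" "vnorm v = 1" using w vw by (auto simp: annulus_def)
      have "v \<noteq> w" using \<epsilon>(1) by (simp add: v_def)
      then have "b * v \<noteq> 1" using True b by (metis mult_cancel_left vnorm_zero zero_neq_one)
      then have "H v = 0" using H v(1) by auto
      then have "((\<lambda>n. a n * w powi n - a n * v powi n) has_sum (H w - 0)) UNIV"
        using has_sum_add[OF a[OF w] has_sum_uminusI[OF a[OF v(1)]]] by simp
      moreover have "vnorm (a n * w powi n - a n * v powi n) \<le> C * vnorm (w - v)" for n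
        unfolding right_diff_distrib[symmetric] vnorm_mult
        by (rule mult_mono[OF aC vnorm_powi_diff_le[OF vw v(2)] C0 vnorm_nonneg])
      ultimately have "vnorm (H w - 0) \<le> C * vnorm (w - v)"
        by (rule has_sum_vnorm_le) (simp add: C0)
      then show ?thesis by (simp only: d diff_zero)
    qed
    have "(\<lambda>i. C * vnorm \<epsilon> ^ Suc i) \<longlonglongrightarrow> C * 0"
      by (intro tendsto_mult tendsto_const LIMSEQ_Suc LIMSEQ_realpow_zero) (use \<epsilon> in simp_all)
    then have "vnorm (H w) \<le> C * 0"
      by (rule LIMSEQ_le_const) (use Hbound in blast)
    then show ?thesis using vnorm_nonneg[of "H w"] vnorm_eq_0_iff[of "H w"] by simp
  qed
qed

text \<open>On the annulus the \<open>k\<close>-th power of \<open>w\<close> has absolute value at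
  most \<open>c powi \<bar>k\<bar>\<close>, so the two one-sided conditions make the terms tend to
  0, which is enough in a complete ultrametric field.\<close>

lemma laurent_converges_on_annulus:
  fixes a :: "int \<Rightarrow> 'c::nonarch_field"
  assumes "complete (UNIV :: 'c set)" and c: "1 \<le> c"
    and pos: "\<And>e. e > 0 \<Longrightarrow> \<exists>K::nat. \<forall>k\<ge>int K. vnorm (a k) * c powi k \<le> e"
    and neg: "\<And>e. e > 0 \<Longrightarrow> \<exists>K::nat. \<forall>k\<ge>int K. vnorm (a (- k)) * c powi k \<le> e"
    and w: "w \<in> annulus {1 / c..c}"
  shows "\<exists>s. ((\<lambda>k. a k * w powi k) has_sum s) UNIV"
proof (rule nonarch_has_sum_exists[OF assms(1)])
  fix e :: real assume e: "e > 0"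
  have w0: "0 < vnorm w" "vnorm w \<le> c" "1 / c \<le> vnorm w" using w by (auto simp: annulus_def)
  have cw: "inverse (vnorm w) \<le> c" using w0 c by (simp add: field_simps)
  obtain K1 :: nat where K1: "\<And>k. k \<ge> int K1 \<Longrightarrow> vnorm (a k) * c powi k \<le> e / 2"
    using pos[of "e / 2"] e by auto
  obtain K2 :: nat where K2: "\<And>k. k \<ge> int K2 \<Longrightarrow> vnorm (a (- k)) * c powi k \<le> e / 2"
    using neg[of "e / 2"] e by auto
  have "vnorm (a k * w powi k) < e" if k: "k \<notin> {- int K2..int K1}" for k
  proof (cases "0 \<le> k")
    case True
    then have "vnorm w powi k \<le> c powi k" using w0 by (simp add: power_int_def power_mono)
    then have "vnorm (a k) * vnorm w powi k \<le> vnorm (a k) * c powi k" by (intro mult_left_mono) simp_all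
    moreover have "vnorm (a k) * c powi k \<le> e / 2" using k True by (intro K1) auto
    ultimately show ?thesis using e by (simp add: vnorm_mult vnorm_powi)
  next
    case False
    have "vnorm w powi k = inverse (vnorm w) ^ nat (- k)" using False by (simp add: power_int_def)
    also have "\<dots> \<le> c ^ nat (- k)" using w0 cw by (intro power_mono) simp_all
    also have "\<dots> = c powi (- k)" using False by (simp add: power_int_def)
    finally have "vnorm w powi k \<le> c powi (- k)" .
    then have "vnorm (a k) * vnorm w powi k \<le> vnorm (a k) * c powi (- k)"
      by (rule mult_left_mono) simp
    moreover have "vnorm (a k) * c powi (- k) \<le> e / 2" using K2[of "- k"] k False by simp
    ultimately show ?thesis using e by (simp add: vnorm_mult vnorm_powi)
  qed
  then have "{k. e \<le> vnorm (a k * w powi k)} \<subseteq> {- int K2..int K1}"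
    by (intro subsetI) (simp only: mem_Collect_eq not_le[symmetric], blast)
  then show "finite {k. e \<le> vnorm (a k * w powi k)}" by (rule finite_subset) simp
qed

subsection \<open>The local functional equation\<close>

text \<open>Twisting by the two unramified characters with values \<open>w\<close> and \<open>- w\<close> at the uniformizer
  forces the limit at 0 to vanish.\<close>

lemma (in local_field) schwartz_class_decay:
  fixes h :: "'k \<Rightarrow> 'c::nonarch_field" and w :: 'c
  assumes h: "schwartz_class \<pi> (vnorm w) h" and w: "w \<noteq> 0" and e: "e > 0"
  shows "\<exists>K::nat. \<forall>x. x \<noteq> 0 \<and> int K \<le> val x \<longrightarrow> vnorm (h x) * vnorm w powi (val x) \<le> e"
proof -
  have ex: "\<exists>L. ((\<lambda>x. h x * unr v x) \<longlongrightarrow> L) (at 0)" if "v = w \<or> v = - w" for v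
    using h mult_character_unr[of v] unr_pi[of v] that w unfolding schwartz_class_def by auto
  obtain L where L: "((\<lambda>x. h x * unr w x) \<longlongrightarrow> L) (at 0)" using ex by blast
  obtain L' where L': "((\<lambda>x. h x * unr (- w) x) \<longlongrightarrow> L') (at 0)" using ex by blast
  \<comment> \<open>Along even powers of \<pi> the two twists agree, along odd powers they differ by
    a sign. So the second limit equals both \<open>L\<close> and \<open>- L\<close>, and
    \<open>L\<close> is 0 in characteristic 0.\<close>
  have lim: "filterlim (\<lambda>n. \<pi> powi int (2 * n + i)) (at 0) sequentially" for i
    unfolding filterlim_at
  proof
    show "((\<lambda>n. \<pi> powi int (2 * n + i)) \<longlongrightarrow> 0) sequentially"
      unfolding tendsto_vnorm_iff
    proof (intro allI impI)
      fix e :: real assume "e > 0"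
      then obtain N :: nat where N: "vnorm \<pi> powi (int N) < e" by (rule ex_vnorm_pi_powi_less)
      have "vnorm (\<pi> powi int (2 * n + i) - 0) < e" if "N \<le> n" for n
      proof -
        have "vnorm \<pi> powi int (2 * n + i) \<le> vnorm \<pi> powi (int N)"
          unfolding vnorm_pi_powi_le_iff using that by simp
        then show ?thesis using N unfolding diff_zero vnorm_powi by linarith
      qed
      then show "\<forall>\<^sub>F n in sequentially. vnorm (\<pi> powi int (2 * n + i) - 0) < e"
        unfolding eventually_sequentially by blast
    qed
  qed simp
  have unr_minus: "unr (- w) (\<pi> powi int (2 * n + i)) = (- 1) ^ i * unr w (\<pi> powi int (2 * n + i))" for n i
  proof -
    have "(- w) ^ (2 * n + i) = (- 1) ^ i * w ^ (2 * n + i)"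
      unfolding power_minus[of w "2 * n + i"] by (simp add: power_add)
    then show ?thesis unfolding unr_def val_pi_powi unfolding power_int_of_nat by simp
  qed
  have L'_eq: "L' = (- 1) ^ i * L" for i
  proof -
    have "((\<lambda>n. h (\<pi> powi int (2 * n + i)) * unr (- w) (\<pi> powi int (2 * n + i))) \<longlongrightarrow> L') sequentially"
      by (rule filterlim_compose[OF L' lim])
    moreover have "((\<lambda>n. (- 1) ^ i * (h (\<pi> powi int (2 * n + i)) * unr w (\<pi> powi int (2 * n + i))))
        \<longlongrightarrow> (- 1) ^ i * L) sequentially"
      by (intro tendsto_mult tendsto_const filterlim_compose[OF L lim])
    then have "((\<lambda>n. h (\<pi> powi int (2 * n + i)) * unr (- w) (\<pi> powi int (2 * n + i)))
        \<longlongrightarrow> (- 1) ^ i * L) sequentially"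
      unfolding unr_minus by (simp only: mult.left_commute)
    ultimately show ?thesis by (rule LIMSEQ_unique)
  qed
  have "L = - L" using L'_eq[of 0] L'_eq[of 1] by simp
  then have "2 * L = 0" by (metis add.right_inverse mult_2)
  then have "L = 0" by simp
  then have "eventually (\<lambda>x. vnorm (h x * unr w x - 0) < e) (at 0)"
    using L e unfolding tendsto_vnorm_iff by blast
  then obtain d where d: "d > 0" "\<And>x. x \<noteq> 0 \<Longrightarrow> dist x 0 < d \<Longrightarrow> vnorm (h x * unr w x) < e"
    unfolding eventually_at by auto
  obtain K :: nat where K: "vnorm \<pi> powi (int K) < d" using d(1) by (rule ex_vnorm_pi_powi_less)
  have "vnorm (h x) * vnorm w powi (val x) \<le> e" if "x \<noteq> 0" "int K \<le> val x" for x
  proof -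
    have "x \<in> B (int K)" unfolding in_B_val_iff[OF that(1)] by (rule that(2))
    then have "dist x 0 < d" using K by (simp add: in_B_iff dist_vnorm)
    from d(2)[OF that(1) this] show ?thesis using that(1) by (simp add: unr_def vnorm_mult vnorm_powi)
  qed
  then show ?thesis by blast
qed

context tate
begin

abbreviation Z :: "('k \<Rightarrow> 'c) \<Rightarrow> 'c \<Rightarrow> 'c" where
  "Z f w \<equiv> zeta_integral \<pi> \<delta> sq f (\<lambda>x. \<psi> x * unram_char \<pi> w x)"

abbreviation Zd :: "('k \<Rightarrow> 'c) \<Rightarrow> 'c \<Rightarrow> 'c" where
  "Zd f w \<equiv> zeta_integral \<pi> \<delta> sq (FT f)
     (\<lambda>x. inverse (\<psi> x) * unram_char \<pi> (of_nat q * inverse w) x)"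

abbreviation admissible :: "('k \<Rightarrow> 'c) \<Rightarrow> bool" where
  "admissible f \<equiv> dissipative f \<and> dissipative (FT f) \<and> f 0 = 0 \<and> FT f 0 = 0"

abbreviation a :: "('k \<Rightarrow> 'c) \<Rightarrow> int \<Rightarrow> 'c" where "a f \<equiv> acoef (\<lambda>y. y) f"

text \<open>The dual integral is evaluated at \<open>q / w\<close>; rewriting its series in powers
  of \<open>w\<close> negates the index and leaves the power of \<open>q\<close>.\<close>

definition dcoef :: "('k \<Rightarrow> 'c) \<Rightarrow> int \<Rightarrow> 'c" where
  "dcoef f k = of_nat q powi (- k) * acoef inverse (FT f) (- k)"

lemma Z_has_sum:
  assumes "admissible f" "vnorm w = 1" shows "((\<lambda>k. a f k * w powi k) has_sum Z f w) UNIV"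
  using zeta_has_sum[of f "\<lambda>y. y" w] assms by simp

lemma Zd_has_sum:
  assumes "admissible f" "vnorm w = 1" shows "((\<lambda>k. dcoef f k * w powi k) has_sum Zd f w) UNIV"
proof -
  have "vnorm (of_nat q * inverse w) = 1" using assms(2) q_unit by (simp add: vnorm_mult vnorm_inverse)
  then have "((\<lambda>k. acoef inverse (FT f) k * (of_nat q * inverse w) powi k) has_sum Zd f w) UNIV"
    using zeta_has_sum[of "FT f" inverse "of_nat q * inverse w"] assms by simp
  moreover have "bij_betw uminus (UNIV::int set) UNIV"
    by (rule bij_betw_byWitness[of _ uminus]) auto
  ultimately have "((\<lambda>k. acoef inverse (FT f) (- k) * (of_nat q * inverse w) powi (- k)) has_sum Zd f w) UNIV"
    using has_sum_reindex_bij_betw[of uminus UNIV UNIV "\<lambda>k. acoef inverse (FT f) k * (of_nat q * inverse w) powi k"]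
    by blast
  moreover have "acoef inverse (FT f) (- k) * (of_nat q * inverse w) powi (- k) = dcoef f k * w powi k" for k
    by (simp add: dcoef_def power_int_mult_distrib power_int_inverse power_int_minus)
  ultimately show ?thesis by simp
qed

lemma rigid_analytic_on_1I:
  assumes "\<And>w. vnorm w = 1 \<Longrightarrow> ((\<lambda>k. b k * w powi k) has_sum F w) UNIV"
  shows "rigid_analytic_on {1} F"
  unfolding rigid_analytic_on_def annulus_def using assms by (intro exI[of _ b]) simp

lemma dcoef_ramified:
  assumes "admissible f" "1 \<le> cond"
  shows "dcoef f k = coef (- int \<delta> - int cond) * a f (k - (int \<delta> + int cond))"
  using acoef_FT_ramified[of f "- k"] assms by (simp add: dcoef_def algebra_simps)

lemma dcoef_unramified:
  assumes "admissible f" "cond = 0"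
  shows "dcoef f k = vol 0 * (ball_int f (k - int \<delta>) - inverse (of_nat q) * ball_int f (k - int \<delta> - 1))"
  using acoef_FT_unramified[of f "- k"] assms by (simp add: dcoef_def algebra_simps)

lemma functional_equation_ramified:
  assumes f: "admissible f" and c: "1 \<le> cond" and w: "vnorm w = 1"
  shows "Z f w = inverse (coef (- int \<delta> - int cond)) * w powi (- int \<delta> - int cond) * Zd f w"
proof -
  let ?G = "coef (- int \<delta> - int cond)" and ?n = "int \<delta> + int cond"
  have w0: "w \<noteq> 0" using w by auto
  have "((\<lambda>k. ?G * a f (k - ?n) * w powi k) has_sum (?G * w powi ?n * Z f w)) UNIV"
    by (rule has_sum_laurent_shift[OF Z_has_sum[OF f w] w0])
  then have "((\<lambda>k. dcoef f k * w powi k) has_sum (?G * w powi ?n * Z f w)) UNIV"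
    unfolding dcoef_ramified[OF f c] .
  then have Zd: "Zd f w = ?G * w powi ?n * Z f w"
    using Zd_has_sum[OF f w] has_sum_unique by blast
  have ww: "w powi (- int \<delta> - int cond) * w powi ?n = 1"
    using w0 by (simp flip: power_int_add)
  have GG: "inverse ?G * ?G = 1" using gauss_sum_nonzero[OF c] by simp
  have "inverse ?G * w powi (- int \<delta> - int cond) * Zd f w
      = inverse ?G * w powi (- int \<delta> - int cond) * (?G * w powi ?n * Z f w)"
    by (simp only: Zd)
  also have "\<dots> = (inverse ?G * ?G) * (w powi (- int \<delta> - int cond) * w powi ?n) * Z f w"
    by (simp only: mult_ac)
  also have "\<dots> = Z f w" by (simp only: GG ww mult_1)
  finally show ?thesis ..
qed

text \<open>The factor \<open>1 - w / q\<close> stays on the left because its zero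
  \<open>w = q\<close> lies on the unit circle. Comparing coefficients, both sides reduce to the
  same combination of three consecutive ball integrals.\<close>

lemma functional_equation_unramified:
  assumes f: "admissible f" and c: "cond = 0" and w: "vnorm w = 1"
  shows "(1 - inverse (of_nat q) * w) * Z f w
    = (inverse (vol 0) * w powi (- int \<delta>) + (- inverse (vol 0)) * w powi (- int \<delta> - 1)) * Zd f w"
proof -
  let ?v = "inverse (vol 0)" and ?q = "inverse (of_nat q) :: 'c" and ?A = "ball_int f"
  have w0: "w \<noteq> 0" using w by auto
  have "((\<lambda>k. ((- ?q) * a f (k - 1) * w powi k)) has_sum ((- ?q) * w powi 1 * Z f w)) UNIV"
    by (rule has_sum_laurent_shift[OF Z_has_sum[OF f w] w0])
  from has_sum_add[OF Z_has_sum[OF f w] this]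
  have 1: "((\<lambda>k. (a f k - ?q * a f (k - 1)) * w powi k) has_sum ((1 - ?q * w) * Z f w)) UNIV"
    by (simp add: algebra_simps)
  have s1: "((\<lambda>k. (?v * dcoef f (k - (- int \<delta>)) * w powi k)) has_sum (?v * w powi (- int \<delta>) * Zd f w)) UNIV"
    by (rule has_sum_laurent_shift[OF Zd_has_sum[OF f w] w0])
  have s2: "((\<lambda>k. ((- ?v) * dcoef f (k - (- int \<delta> - 1)) * w powi k)) has_sum ((- ?v) * w powi (- int \<delta> - 1) * Zd f w)) UNIV"
    by (rule has_sum_laurent_shift[OF Zd_has_sum[OF f w] w0])
  have coeffs: "?v * dcoef f (k - (- int \<delta>)) * w powi k + (- ?v) * dcoef f (k - (- int \<delta> - 1)) * w powi k
      = (a f k - ?q * a f (k - 1)) * w powi k" for k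
  proof -
    have d1: "?v * dcoef f (k - (- int \<delta>)) = ?A k - ?q * ?A (k - 1)"
      unfolding dcoef_unramified[OF f c] by (simp add: mult.assoc[symmetric])
    have "k - (- int \<delta> - 1) - int \<delta> = k + 1" "k + 1 - 1 = k" by simp_all
    then have d2: "?v * dcoef f (k - (- int \<delta> - 1)) = ?A (k + 1) - ?q * ?A k"
      unfolding dcoef_unramified[OF f c] by (simp only:) (simp add: mult.assoc[symmetric])
    have a1: "a f k = ?A k - ?A (k + 1)" "a f (k - 1) = ?A (k - 1) - ?A k"
      using acoef_ball_int[OF c, of f k] acoef_ball_int[OF c, of f "k - 1"] f by simp_all
    have "?v * dcoef f (k - (- int \<delta>)) * w powi k + (- ?v) * dcoef f (k - (- int \<delta> - 1)) * w powi k
        = (?v * dcoef f (k - (- int \<delta>)) - ?v * dcoef f (k - (- int \<delta> - 1))) * w powi k"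
      by (simp only: left_diff_distrib minus_mult_left[symmetric] add_uminus_conv_diff)
    then show ?thesis unfolding d1 d2 a1 by (simp add: right_diff_distrib)
  qed
  from has_sum_add[OF s1 s2] have "((\<lambda>k. (a f k - ?q * a f (k - 1)) * w powi k) has_sum
      (?v * w powi (- int \<delta>) * Zd f w + (- ?v) * w powi (- int \<delta> - 1) * Zd f w)) UNIV"
    unfolding coeffs .
  then have "(1 - ?q * w) * Z f w = ?v * w powi (- int \<delta>) * Zd f w + (- ?v) * w powi (- int \<delta> - 1) * Zd f w"
    using 1 has_sum_unique by blast
  then show ?thesis by (simp only: distrib_right)
qed

section \<open>Decay of the coefficients and continuation\<close>

lemma acoef_decay:
  fixes w0 :: 'c
  assumes h: "dissipative h" and F: "F = inverse \<or> F = (\<lambda>y. y)"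
    and s: "schwartz_class \<pi> (vnorm w0) h" "w0 \<noteq> 0" and e: "e > 0"
  shows "\<exists>K::nat. \<forall>k\<ge>int K. vnorm (acoef F h k) * vnorm w0 powi k \<le> e"
proof -
  obtain K :: nat where K: "\<And>x. x \<noteq> 0 \<Longrightarrow> int K \<le> val x \<Longrightarrow> vnorm (h x) * vnorm w0 powi (val x) \<le> e"
    using schwartz_class_decay[OF s e] by blast
  have "vnorm (acoef F h k) * vnorm w0 powi k \<le> e" if k: "k \<ge> int K" for k
  proof -
    have p: "0 < vnorm w0 powi k" using s(2) by simp
    have "vnorm (acoef F h k) \<le> e / vnorm w0 powi k"
    proof (rule acoef_bound[OF h F])
      show "0 \<le> e / vnorm w0 powi k" using p e by simp
      fix x assume "x \<in> shell k"
      then have "vnorm (h x) * vnorm w0 powi k \<le> e" using K[of x] k by (auto simp: shell_def)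
      then show "vnorm (h x) \<le> e / vnorm w0 powi k" using p by (simp add: pos_le_divide_eq)
    qed
    then show ?thesis using p by (simp add: pos_le_divide_eq)
  qed
  then show ?thesis by blast
qed

lemma vnorm_dcoef: "vnorm (dcoef f (- n)) = vnorm (acoef inverse (FT f) n)"
  by (simp add: dcoef_def vnorm_mult vnorm_powi q_unit)

text \<open>The whole integral is \<open>FT f 0 = 0\<close>, so a ball integral is minus the
  integral over the complement, where \<open>f\<close> is small.\<close>

lemma ball_int_tendsto:
  assumes f: "admissible f" and e: "e > 0"
  shows "\<exists>K::nat. \<forall>k. k \<le> - int K \<longrightarrow> vnorm (ball_int f k) \<le> e"
proof -
  have d: "dissipative f" using f by simp
  obtain K :: nat where K: "\<And>x. x \<notin> B (- int K) \<Longrightarrow> vnorm (f x) \<le> e"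
    using dissipative_bounded[OF d e] by blast
  have I0: "I f = 0" using f by (simp add: FT_def)
  have "vnorm (ball_int f k) \<le> e" if k: "k \<le> - int K" for k
  proof -
    have "ball_int f k = I (\<lambda>x. f x * ballf k x - f x)"
      unfolding I_diff[OF dissipative_ball_part[OF d] d] ball_int_def I0 by simp
    moreover have "vnorm (I (\<lambda>x. f x * ballf k x - f x)) \<le> e"
    proof (rule I_bound[OF dissipative_diff[OF dissipative_ball_part[OF d] d]])
      fix x
      show "vnorm (f x * ballf k x - f x) \<le> e"
      proof (cases "x \<in> B k")
        case False
        then have "x \<notin> B (- int K)" using B_mono[of x "- int K" k] k by blast
        then show ?thesis using K False by (simp add: ballf_def)
      qed (use e in \<open>simp add: ballf_def\<close>)
    qed
    ultimately show ?thesis by simp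
  qed
  then show ?thesis by blast
qed

text \<open>In the ramified case the two families differ by a shift and a constant factor. In the
  unramified case the dual coefficients only bound differences of ball integrals, and these are
  chained towards ever larger balls.\<close>

lemma acoef_neg_decay:
  assumes f: "admissible f" and c: "1 \<le> c"
    and dec: "\<And>e. e > 0 \<Longrightarrow> \<exists>K::nat. \<forall>k\<ge>int K. vnorm (acoef inverse (FT f) k) * c powi k \<le> e"
    and e: "e > 0"
  shows "\<exists>K::nat. \<forall>k\<ge>int K. vnorm (a f (- k)) * c powi k \<le> e"
proof (cases "cond = 0")
  case False
  then have m: "1 \<le> cond" by simp
  let ?G = "coef (- int \<delta> - int cond)" and ?n = "int \<delta> + int cond"
  have G: "0 < vnorm ?G" using gauss_sum_nonzero[OF m] by simp
  have cn: "0 < c powi ?n" using c by simp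
  \<comment> \<open>Compensates the Gauss sum and the shift of the exponent by
    \<open>?n\<close>.\<close>
  define e' where "e' = e * vnorm ?G / c powi ?n"
  have "e' > 0" using e G cn by (simp add: e'_def)
  then obtain K :: nat where K: "\<And>k. k \<ge> int K \<Longrightarrow> vnorm (acoef inverse (FT f) k) * c powi k \<le> e'"
    using dec by blast
  have "vnorm (a f (- k)) * c powi k \<le> e" if k: "k \<ge> int K + ?n" for k
  proof -
    have "dcoef f (- (k - ?n)) = ?G * a f (- k)" unfolding dcoef_ramified[OF f m] by simp
    then have "vnorm ?G * vnorm (a f (- k)) = vnorm (acoef inverse (FT f) (k - ?n))"
      using vnorm_dcoef[of f "k - ?n"] by (simp add: vnorm_mult)
    moreover have "c powi k = c powi (k - ?n) * c powi ?n"
      using c by (simp flip: power_int_add)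
    ultimately have "vnorm ?G * (vnorm (a f (- k)) * c powi k)
        = (vnorm (acoef inverse (FT f) (k - ?n)) * c powi (k - ?n)) * c powi ?n"
      by (simp only: mult.assoc[symmetric])
    also have "\<dots> \<le> e' * c powi ?n"
      using K[of "k - ?n"] k cn by (intro mult_right_mono) simp_all
    also have "\<dots> = vnorm ?G * e" using c by (simp add: e'_def)
    finally show ?thesis using G by simp
  qed
  then show ?thesis by (intro exI[of _ "K + \<delta> + cond"]) (simp add: add.assoc)
next
  case True
  let ?b = "\<lambda>n. ball_int f (- int \<delta> - n)" and ?q = "inverse (of_nat q) :: 'c"
  \<comment> \<open>The bound for \<open>a f (- k)\<close> will come from index \<open>n - 1\<close>
    with \<open>n = k - int \<delta>\<close>, so \<open>int \<delta> + 1\<close> powers of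
    \<open>c\<close> are lost.\<close>
  define e' where "e' = e / c powi (int \<delta> + 1)"
  have cn: "0 < c powi (int \<delta> + 1)" using c by simp
  have e': "e' > 0" using e cn by (simp add: e'_def)
  obtain K :: nat where K: "\<And>k. k \<ge> int K \<Longrightarrow> vnorm (acoef inverse (FT f) k) * c powi k \<le> e'"
    using dec[OF e'] by blast
  have cp: "0 < c powi n" for n using c by simp
  have vq: "vnorm ?q = 1" by (simp add: vnorm_inverse q_unit)
  have step: "vnorm (?b n) \<le> max (e' / c powi n) (vnorm (?b (n + 1)))" if n: "n \<ge> int K" for n
  proof -
    have "dcoef f (- n) = vol 0 * (?b n - ?q * ?b (n + 1))"
    proof -
      have "- n - int \<delta> = - int \<delta> - n" "- n - int \<delta> - 1 = - int \<delta> - (n + 1)" by simp_all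
      then show ?thesis unfolding dcoef_unramified[OF f True] by (simp only:)
    qed
    then have "vnorm (?b n - ?q * ?b (n + 1)) = vnorm (acoef inverse (FT f) n)"
      using vnorm_dcoef[of f n] by (simp add: vnorm_mult)
    also have "\<dots> \<le> e' / c powi n" using K[OF n] cp[of n] by (simp add: pos_le_divide_eq)
    finally have "vnorm ((?b n - ?q * ?b (n + 1)) + ?q * ?b (n + 1)) \<le> max (e' / c powi n) (vnorm (?b (n + 1)))"
      using vq by (intro vnorm_add_le) (simp_all add: vnorm_mult)
    then show ?thesis by simp
  qed
  \<comment> \<open>The ultrametric inequality yields a maximum rather than a sum, and
    \<open>e' / c powi n\<close> decreases in \<open>n\<close>, so the first bound dominates and no
    error accumulates.\<close>
  have iter: "vnorm (?b n) \<le> max (e' / c powi n) (vnorm (?b (n + int j)))" if "n \<ge> int K" for n j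
    using that
  proof (induction j arbitrary: n)
    case (Suc j)
    have "vnorm (?b (n + 1)) \<le> max (e' / c powi (n + 1)) (vnorm (?b (n + 1 + int j)))"
      by (rule Suc.IH) (use Suc.prems in simp)
    moreover have "e' / c powi (n + 1) \<le> e' / c powi n"
      using e' cp[of n] cp[of "n + 1"] power_int_increasing[of n "n + 1" c] c
      by (intro divide_left_mono) simp_all
    moreover have "n + 1 + int j = n + int (Suc j)" by simp
    ultimately show ?case using step[OF Suc.prems] by (simp only: le_max_iff_disj) linarith
  qed simp
  have b: "vnorm (?b n) * c powi n \<le> e'" if n: "n \<ge> int K" for n
  proof -
    have "0 < e' / c powi n" using e' cp[of n] by simp
    then obtain L :: nat where L: "\<And>k. k \<le> - int L \<Longrightarrow> vnorm (ball_int f k) \<le> e' / c powi n"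
      using ball_int_tendsto[OF f] by blast
    \<comment> \<open>The summand \<open>nat \<bar>n\<bar>\<close> brings the index below
      \<open>- int L\<close> whatever the sign of \<open>n\<close>.\<close>
    have "vnorm (?b (n + int (L + nat \<bar>n\<bar>))) \<le> e' / c powi n" by (rule L) simp
    then have "vnorm (?b n) \<le> e' / c powi n" using iter[OF n, of "L + nat \<bar>n\<bar>"] by simp
    then show ?thesis using cp[of n] by (simp add: pos_le_divide_eq)
  qed
  have "vnorm (a f (- k)) * c powi k \<le> e" if k: "k \<ge> int K + int \<delta> + 1" for k
  proof -
    define n where "n = k - int \<delta>"
    have n: "n \<ge> int K" "n - 1 \<ge> int K" using k by (simp_all add: n_def)
    have "a f (- k) = ?b n - ?b (n - 1)"
      using acoef_ball_int[OF True, of f "- k"] f by (simp add: n_def algebra_simps)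
    moreover have "vnorm (?b n) \<le> e' / c powi (n - 1)"
    proof -
      have "vnorm (?b n) * c powi (n - 1) \<le> vnorm (?b n) * c powi n"
        using c by (intro mult_left_mono power_int_increasing) simp_all
      then show ?thesis using b[OF n(1)] cp[of "n - 1"] by (simp add: pos_le_divide_eq)
    qed
    moreover have "vnorm (?b (n - 1)) \<le> e' / c powi (n - 1)"
      using b[OF n(2)] cp[of "n - 1"] by (simp add: pos_le_divide_eq)
    ultimately have "vnorm (a f (- k)) \<le> e' / c powi (n - 1)" by (simp add: vnorm_diff_le)
    then have le: "vnorm (a f (- k)) * c powi k \<le> e' / c powi (n - 1) * c powi k"
      using cp[of k] by (intro mult_right_mono) simp_all
    have "c powi (n - 1 + (int \<delta> + 1)) = c powi (n - 1) * c powi (int \<delta> + 1)"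
      by (rule power_int_add) (use c in simp)
    moreover have "n - 1 + (int \<delta> + 1) = k" by (simp add: n_def)
    ultimately have ck: "c powi k = c powi (n - 1) * c powi (int \<delta> + 1)" by (simp only:)
    have "e' / c powi (n - 1) * c powi k = e"
      unfolding ck using c by (simp add: e'_def)
    with le show ?thesis by (simp only:)
  qed
  then show ?thesis by (intro exI[of _ "K + \<delta> + 1"]) (simp add: add.assoc)
qed

text \<open>The class of \<open>f\<close> controls the coefficients of large positive index, the
  class of \<open>FT f\<close> those of large negative index. The continuation obtained is even
  analytic.\<close>

lemma meromorphic_continuation:
  fixes w0 :: 'c
  assumes f: "admissible f" and c: "1 \<le> vnorm w0"
    and s: "schwartz_class \<pi> (vnorm w0) f" "schwartz_class \<pi> (vnorm w0) (FT f)"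
  shows "\<exists>M. rigid_meromorphic_on {1 / vnorm w0..vnorm w0} M \<and> meromorphic_eq_on {1} M (Z f)"
proof -
  let ?A = "annulus {1 / vnorm w0..vnorm w0} :: 'c set"
  have w0: "w0 \<noteq> 0" using c by auto
  have "\<exists>K::nat. \<forall>k\<ge>int K. vnorm (a f k) * vnorm w0 powi k \<le> e" if "e > 0" for e
    using acoef_decay[of f "\<lambda>y. y", OF _ _ s(1) w0 that] f by simp
  moreover have "\<exists>K::nat. \<forall>k\<ge>int K. vnorm (acoef inverse (FT f) k) * vnorm w0 powi k \<le> e" if "e > 0" for e
    using acoef_decay[of "FT f" inverse, OF _ _ s(2) w0 that] f by simp
  then have "\<exists>K::nat. \<forall>k\<ge>int K. vnorm (a f (- k)) * vnorm w0 powi k \<le> e" if "e > 0" for e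
    using acoef_neg_decay[OF f c _ that] by blast
  ultimately have "\<forall>w\<in>?A. \<exists>s. ((\<lambda>k. a f k * w powi k) has_sum s) UNIV"
    by (intro ballI laurent_converges_on_annulus[OF complete_c c])
  then obtain M where M: "\<And>w. w \<in> ?A \<Longrightarrow> ((\<lambda>k. a f k * w powi k) has_sum M w) UNIV"
    by metis
  have Man: "rigid_analytic_on {1 / vnorm w0..vnorm w0} M"
    unfolding rigid_analytic_on_def using M by blast
  have in1: "{1} \<subseteq> {1 / vnorm w0..vnorm w0}" using c by (simp add: divide_le_eq)
  have eq: "M w = Z f w" if "w \<in> annulus {1}" for w
  proof -
    have "w \<in> ?A" "vnorm w = 1" using that in1 by (auto simp: annulus_def)
    then show ?thesis using M Z_has_sum[OF f] has_sum_unique by blast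
  qed
  have "meromorphic_eq_on {1} M (Z f)"
    unfolding meromorphic_eq_on_def
  proof (intro conjI ballI)
    show "rigid_meromorphic_on {1} M"
      by (rule rigid_analytic_imp_meromorphic[OF rigid_analytic_mono[OF Man in1]])
    show "rigid_meromorphic_on {1} (Z f)"
      by (rule rigid_analytic_imp_meromorphic[OF rigid_analytic_on_1I]) (rule Z_has_sum[OF f])
    fix J assume "J \<in> affinoid_radii TYPE('c) {1}"
    then have "annulus J \<subseteq> (annulus {1} :: 'c set)" by (auto simp: affinoid_radii_def annulus_def)
    then show "\<exists>G. non_zero_divisor_on J G \<and> (\<forall>w\<in>annulus J. G w \<noteq> 0 \<longrightarrow> M w = Z f w)"
      using eq by (intro exI[of _ "\<lambda>w. 1"]) (auto simp: non_zero_divisor_one)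
  qed
  then show ?thesis using rigid_analytic_imp_meromorphic[OF Man] by blast
qed

text \<open>A common shape for both cases: a numerator of at most two monomials and a denominator,
  chosen before \<open>f\<close>. This order of the quantifiers is the independence of
  \<open>f\<close>.\<close>

lemma functional_equation_without_denominators:
  fixes \<epsilon> :: 'c
  assumes \<epsilon>: "\<epsilon> \<noteq> 0" "vnorm \<epsilon> < 1"
  shows "\<exists>n1 n2 i j D. (\<forall>J. non_zero_divisor_on J D) \<and>
    (\<forall>f w. admissible f \<and> vnorm w = 1 \<longrightarrow> D w * Z f w = (n1 * w powi i + n2 * w powi j) * Zd f w)"
proof (cases "cond = 0")
  case True
  have nzd: "\<forall>J. non_zero_divisor_on J (\<lambda>w. 1 - inverse (of_nat q :: 'c) * w)"
    by (intro allI non_zero_divisor_linear[OF _ \<epsilon>]) (simp add: vnorm_inverse q_unit)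
  show ?thesis
    by (rule exI[of _ "inverse (vol 0)"], rule exI[of _ "- inverse (vol 0)"], rule exI[of _ "- int \<delta>"],
        rule exI[of _ "- int \<delta> - 1"], rule exI[of _ "\<lambda>w. 1 - inverse (of_nat q) * w"], rule conjI,
        rule nzd) (use functional_equation_unramified[OF _ True] in blast)
next
  case False
  then have c: "1 \<le> cond" by simp
  have fe: "1 * Z f w = (inverse (coef (- int \<delta> - int cond)) * w powi (- int \<delta> - int cond)
      + 0 * w powi 0) * Zd f w" if "admissible f \<and> vnorm w = 1" for f w
    using functional_equation_ramified[OF _ c, of f w] that by simp
  show ?thesis
    by (rule exI[of _ "inverse (coef (- int \<delta> - int cond))"], rule exI[of _ 0],
        rule exI[of _ "- int \<delta> - int cond"], rule exI[of _ 0], rule exI[of _ "\<lambda>w. 1"],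
        rule conjI, rule allI, rule non_zero_divisor_one, intro allI impI, erule fe)
qed

text \<open>The statement covers every \<open>r\<close> agreeing with \<open>R\<close> off 0,
  because a function of the character \<psi>\<chi> is determined by \<open>w\<close> only where
  \<open>unram_char\<close> is meaningful, that is for \<open>w \<noteq> 0\<close>.\<close>

lemma rho_exists:
  fixes \<epsilon> :: 'c
  assumes \<epsilon>: "\<epsilon> \<noteq> 0" "vnorm \<epsilon> < 1"
  shows "\<exists>R. \<forall>r. (\<forall>w. w \<noteq> 0 \<longrightarrow> r w = R w) \<longrightarrow> rigid_meromorphic_on {0<..} r \<and>
    (\<forall>f. admissible f \<longrightarrow> meromorphic_eq_on {1} (Z f) (\<lambda>w. r w * Zd f w))"
proof -
  obtain n1 n2 i j D where nD: "(\<forall>J. non_zero_divisor_on J D) \<and>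
    (\<forall>f w. admissible f \<and> vnorm w = 1 \<longrightarrow> D w * Z f w = (n1 * w powi i + n2 * w powi j) * Zd f w)"
    using functional_equation_without_denominators[OF \<epsilon>] by (elim exE) (rule that)
  have D: "non_zero_divisor_on J D" for J
    by (rule nD[THEN conjunct1, rule_format])
  have fe: "D w * Z f w = (n1 * w powi i + n2 * w powi j) * Zd f w"
    if "admissible f" "vnorm w = 1" for f w
    by (rule nD[THEN conjunct2, rule_format]) (use that in simp)
  define N where "N w = n1 * w powi i + n2 * w powi j" for w :: 'c
  have N: "rigid_analytic_on J N" for J
    unfolding N_def by (intro rigid_analytic_add rigid_analytic_monom)
  show ?thesis
  proof (intro exI[of _ "\<lambda>w. N w / D w"] allI impI conjI)
    fix r :: "'c \<Rightarrow> 'c" assume r: "\<forall>w. w \<noteq> 0 \<longrightarrow> r w = N w / D w"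
    then have r': "r w = N w / D w" if "w \<in> annulus J" for w J using that by (simp add: annulus_def)
    show "rigid_meromorphic_on {0<..} r"
      unfolding rigid_meromorphic_on_def
      by (intro ballI exI[of _ N] exI[of _ D] conjI N D impI) (rule r')
    fix f assume f: "admissible f"
    have Zan: "rigid_analytic_on {1} (Z f)" by (rule rigid_analytic_on_1I) (rule Z_has_sum[OF f])
    have Zdan: "rigid_analytic_on {1} (Zd f)" by (rule rigid_analytic_on_1I) (rule Zd_has_sum[OF f])
    have "rigid_analytic_on {1} (\<lambda>w. n1 * w powi i * Zd f w + n2 * w powi j * Zd f w)"
      by (intro rigid_analytic_add rigid_analytic_mult_monom Zdan)
    then have NZd: "rigid_analytic_on {1} (\<lambda>w. N w * Zd f w)"
      unfolding N_def by (simp only: distrib_right)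
    show "meromorphic_eq_on {1} (Z f) (\<lambda>w. r w * Zd f w)"
      unfolding meromorphic_eq_on_def
    proof (intro conjI ballI)
      show "rigid_meromorphic_on {1} (Z f)" by (rule rigid_analytic_imp_meromorphic[OF Zan])
      show "rigid_meromorphic_on {1} (\<lambda>w. r w * Zd f w)"
        unfolding rigid_meromorphic_on_def
      proof
        fix J assume "J \<in> affinoid_radii TYPE('c) {1}"
        then have "J \<subseteq> {1}" by (simp add: affinoid_radii_def)
        then have "rigid_analytic_on J (\<lambda>w. N w * Zd f w)" by (rule rigid_analytic_mono[OF NZd])
        moreover have "r w * Zd f w = N w * Zd f w / D w" if "w \<in> annulus J" for w
          using r'[OF that] by simp
        ultimately show "\<exists>F G. rigid_analytic_on J F \<and> non_zero_divisor_on J G \<and>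
            (\<forall>w\<in>annulus J. G w \<noteq> 0 \<longrightarrow> r w * Zd f w = F w / G w)"
          using D[of J] by (intro exI[of _ "\<lambda>w. N w * Zd f w"] exI[of _ D]) simp
      qed
      fix J assume J: "J \<in> affinoid_radii TYPE('c) {1}"
      have "Z f w = r w * Zd f w" if w: "w \<in> annulus J" and Dw: "D w \<noteq> 0" for w
      proof -
        have "vnorm w = 1" using J w by (auto simp: affinoid_radii_def annulus_def)
        from fe[OF f this] have "D w * Z f w = N w * Zd f w" unfolding N_def .
        then have "Z f w = N w * Zd f w / D w" using Dw by (simp add: eq_divide_eq mult.commute)
        then show ?thesis using r'[OF w] by simp
      qed
      then show "\<exists>G. non_zero_divisor_on J G \<and> (\<forall>w\<in>annulus J. G w \<noteq> 0 \<longrightarrow> Z f w = r w * Zd f w)"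
        by (intro exI[of _ D] conjI ballI impI D)
    qed
  qed
qed

end

theorem mainTheorem2:
  fixes l p :: nat
    and \<iota> :: "'q::nonarch_field \<Rightarrow> 'k::nonarch_field"
    and \<pi> :: 'k
    and \<delta> :: nat
    and sq :: "'c::nonarch_field"
    and \<zeta> :: "nat \<Rightarrow> 'c"
  assumes "prime l" and "prime p" and "l \<noteq> p"
    and "is_padic_numbers l TYPE('q)"
    and "is_finite_extension \<iota>"
    and "is_uniformizer \<pi>"
    and "different \<iota> = ideal_pow \<pi> (int \<delta>)"
    and "is_padic_complex_numbers p TYPE('c)"
    and "sq ^ 2 = of_nat (residue_card \<pi>)"
    and "is_root_system l \<zeta>"
  shows "\<exists>\<rho> :: ('k \<Rightarrow> 'c) \<Rightarrow> 'c. \<forall>\<psi> :: 'k \<Rightarrow> 'c. mult_character \<psi> \<and> \<psi> \<pi> = 1 \<longrightarrow>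
    rigid_meromorphic_on {0<..} (\<lambda>w. \<rho> (\<lambda>x. \<psi> x * unram_char \<pi> w x)) \<and>
    (\<forall>f :: 'k \<Rightarrow> 'c.
      continuous_on UNIV f \<and> (\<forall>x. f x \<in> valuation_ring) \<and>
      (f \<longlongrightarrow> 0) at_inf \<and> (fourier l \<iota> \<pi> \<delta> sq \<zeta> f \<longlongrightarrow> 0) at_inf \<and>
      f 0 = 0 \<and> fourier l \<iota> \<pi> \<delta> sq \<zeta> f 0 = 0 \<longrightarrow>
      rigid_analytic_on {1}
        (\<lambda>w. zeta_integral \<pi> \<delta> sq f (\<lambda>x. \<psi> x * unram_char \<pi> w x)) \<and>
      meromorphic_eq_on {1}
        (\<lambda>w. zeta_integral \<pi> \<delta> sq f (\<lambda>x. \<psi> x * unram_char \<pi> w x))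
        (\<lambda>w. \<rho> (\<lambda>x. \<psi> x * unram_char \<pi> w x) *
             zeta_integral \<pi> \<delta> sq (fourier l \<iota> \<pi> \<delta> sq \<zeta> f)
               (\<lambda>x. inverse (\<psi> x) * unram_char \<pi> (of_nat (residue_card \<pi>) * inverse w) x)) \<and>
      (\<forall>c::real. 1 \<le> c \<and> c \<in> range (vnorm :: 'c \<Rightarrow> real) \<and>
        schwartz_class \<pi> c f \<and> schwartz_class \<pi> c (fourier l \<iota> \<pi> \<delta> sq \<zeta> f) \<longrightarrow>
        (\<exists>M. rigid_meromorphic_on {1 / c..c} M \<and>
             meromorphic_eq_on {1} M
               (\<lambda>w. zeta_integral \<pi> \<delta> sq f (\<lambda>x. \<psi> x * unram_char \<pi> w x)))))"
proof -
  interpret E: finite_padic_extension l "TYPE('q)" \<iota>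
    by unfold_locales (use assms in simp_all)
  have l_k: "vnorm (of_nat l :: 'k) < 1"
    using E.vnorm_l_less_1 E.vnorm_\<iota>[of "of_nat l"] E.\<iota>_of_nat[of l] by simp
  \<comment> \<open>If \<pi> were 0, the maximal ideal would be zero; but it contains
    \<open>l\<close>, which is nonzero in characteristic 0.\<close>
  have "\<pi> \<noteq> 0"
  proof
    assume "\<pi> = 0"
    then have "ideal_pow \<pi> 1 \<subseteq> {0}" by (auto simp: ideal_pow_def)
    moreover have "(of_nat l :: 'k) \<in> ideal_pow \<pi> 1"
      using assms(6) l_k by (simp add: is_uniformizer_def)
    moreover have "(of_nat l :: 'k) \<noteq> 0" using assms(1) prime_gt_0_nat by simp
    ultimately show False by blast
  qed
  then interpret K: local_field \<pi>
    by unfold_locales (use assms(6) E.compact_vnorm_ball in simp_all)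
  have p_c: "vnorm (of_nat p :: 'c) < 1"
    using assms(2,8) prime_gt_1_nat[of p] by (simp add: is_padic_complex_numbers_def)
  have l_c: "vnorm (of_nat l :: 'c) = 1"
    using primes_coprime[OF assms(1-3)] by (rule vnorm_of_nat_coprime[OF p_c])
  obtain k where k: "residue_card \<pi> = l ^ k" using K.residue_card_power[OF assms(1) l_k] by blast
  interpret H: haar \<pi> \<delta> sq
    by unfold_locales
      (use assms(8,9) l_c in \<open>simp_all add: k vnorm_power is_padic_complex_numbers_def\<close>)
  define \<theta> where "\<theta> x = zeta_power l \<zeta> (field_trace \<iota> x)" for x
  have vr: "valuation_ring = ideal_pow \<pi> 0" by (auto simp: valuation_ring_def K.in_B_0_iff)
  interpret A: add_char \<pi> \<delta> sq \<theta>
  proof unfold_locales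
    fix x y
    show "\<theta> (x + y) = \<theta> x * \<theta> y"
      unfolding \<theta>_def E.field_trace_add by (rule E.zeta_power_add[OF assms(10)])
    show "vnorm (\<theta> x) = 1" unfolding \<theta>_def by (rule E.vnorm_zeta_power[OF assms(10)])
    show "(\<forall>y\<in>ideal_pow \<pi> 0. \<theta> (x * y) = 1) \<longleftrightarrow> x \<in> ideal_pow \<pi> (- int \<delta>)"
      unfolding \<theta>_def E.zeta_power_eq_1_iff[OF assms(10)]
        K.inverse_different_eq[OF assms(7), symmetric] inverse_different_def vr[symmetric] by simp
  qed
  have fourier: "fourier l \<iota> \<pi> \<delta> sq \<zeta> f = A.FT f" for f
    by (rule ext) (simp only: fourier_def A.FT_def \<theta>_def)
  have tate: "tate \<pi> \<delta> sq \<theta> l \<psi>" if "mult_character \<psi> \<and> \<psi> \<pi> = 1" for \<psi>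
    by unfold_locales (use that l_k l_c in simp_all)
  \<comment> \<open>The prime \<open>p\<close> serves as the small nonzero element whose powers
    approach a zero of the linear denominator.\<close>
  have eps: "(of_nat p :: 'c) \<noteq> 0" using assms(2) prime_gt_0_nat by simp
  \<comment> \<open>The factor has to be chosen for all \<psi> at once, before any of them is fixed;
    \<open>P\<close> collects what the choice must provide.\<close>
  define P where "P \<psi> R \<longleftrightarrow> (\<forall>r. (\<forall>w. w \<noteq> 0 \<longrightarrow> r w = R w) \<longrightarrow> rigid_meromorphic_on {0<..} r \<and>
    (\<forall>f. dissipative f \<and> dissipative (A.FT f) \<and> f 0 = 0 \<and> A.FT f 0 = 0 \<longrightarrow>
      meromorphic_eq_on {1}
        (\<lambda>w. zeta_integral \<pi> \<delta> sq f (\<lambda>x. \<psi> x * unram_char \<pi> w x))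
        (\<lambda>w. r w * zeta_integral \<pi> \<delta> sq (A.FT f)
               (\<lambda>x. inverse (\<psi> x) * unram_char \<pi> (of_nat (residue_card \<pi>) * inverse w) x))))"
    for \<psi> R
  have "\<exists>R. P \<psi> R" if "mult_character \<psi> \<and> \<psi> \<pi> = 1" for \<psi>
    unfolding P_def by (rule tate.rho_exists[OF tate[OF that] eps p_c])
  then obtain R where R: "\<And>\<psi>. mult_character \<psi> \<and> \<psi> \<pi> = 1 \<Longrightarrow> P \<psi> (R \<psi>)"
    by metis
  \<comment> \<open>A character \<eta> determines its parts: since \<psi> is 1 at \<pi>, the
    parameter \<open>w\<close> is \<open>\<eta> \<pi>\<close>, and \<psi> is \<eta> times the
    unramified character with value \<open>inverse w\<close>. So \<rho> is a function of the
    character alone.\<close>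
  define \<rho> where "\<rho> \<eta> = R (\<lambda>x. \<eta> x * unram_char \<pi> (inverse (\<eta> \<pi>)) x) (\<eta> \<pi>)" for \<eta> :: "'k \<Rightarrow> 'c"
  have rho: "\<rho> (\<lambda>x. \<psi> x * unram_char \<pi> w x) = R \<psi> w"
    if \<psi>: "mult_character \<psi> \<and> \<psi> \<pi> = 1" and w: "w \<noteq> 0" for \<psi> w
  proof -
    have "inverse w \<noteq> 0" using w by simp
    have "\<psi> x * K.unr w x * K.unr (inverse w) x = \<psi> x" for x
    proof (cases "x = 0")
      case True
      then show ?thesis using \<psi> by (simp add: mult_character_def)
    next
      case False
      then show ?thesis using w by (simp add: K.unr_def power_int_inverse)
    qed
    then have eq: "(\<lambda>x. \<psi> x * K.unr w x * K.unr (inverse w) x) = \<psi>" by (rule ext)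
    have pi: "\<psi> \<pi> * K.unr w \<pi> = w" using \<psi> by (simp add: K.unr_pi)
    show ?thesis
      unfolding \<rho>_def K.unram_char_eq[OF w] pi K.unram_char_eq[OF \<open>inverse w \<noteq> 0\<close>] eq ..
  qed
  show ?thesis
  proof (intro exI[of _ \<rho>] allI impI)
    fix \<psi> :: "'k \<Rightarrow> 'c" assume \<psi>: "mult_character \<psi> \<and> \<psi> \<pi> = 1"
    interpret T: tate \<pi> \<delta> sq \<theta> l \<psi> by (rule tate[OF \<psi>])
    note main = R[OF \<psi>, unfolded P_def, rule_format, of "\<lambda>w. \<rho> (\<lambda>x. \<psi> x * unram_char \<pi> w x)",
        OF rho[OF \<psi>]]
    show "rigid_meromorphic_on {0<..} (\<lambda>w. \<rho> (\<lambda>x. \<psi> x * unram_char \<pi> w x)) \<and>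
      (\<forall>f :: 'k \<Rightarrow> 'c.
      continuous_on UNIV f \<and> (\<forall>x. f x \<in> valuation_ring) \<and>
      (f \<longlongrightarrow> 0) at_inf \<and> (fourier l \<iota> \<pi> \<delta> sq \<zeta> f \<longlongrightarrow> 0) at_inf \<and>
      f 0 = 0 \<and> fourier l \<iota> \<pi> \<delta> sq \<zeta> f 0 = 0 \<longrightarrow>
      rigid_analytic_on {1} (T.Z f) \<and>
      meromorphic_eq_on {1} (T.Z f)
        (\<lambda>w. \<rho> (\<lambda>x. \<psi> x * unram_char \<pi> w x) *
             zeta_integral \<pi> \<delta> sq (fourier l \<iota> \<pi> \<delta> sq \<zeta> f)
               (\<lambda>x. inverse (\<psi> x) * unram_char \<pi> (of_nat (residue_card \<pi>) * inverse w) x)) \<and>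
      (\<forall>c::real. 1 \<le> c \<and> c \<in> range (vnorm :: 'c \<Rightarrow> real) \<and>
        schwartz_class \<pi> c f \<and> schwartz_class \<pi> c (fourier l \<iota> \<pi> \<delta> sq \<zeta> f) \<longrightarrow>
        (\<exists>M. rigid_meromorphic_on {1 / c..c} M \<and> meromorphic_eq_on {1} M (T.Z f))))"
      unfolding fourier
    proof (intro conjI allI impI)
      show "rigid_meromorphic_on {0<..} (\<lambda>w. \<rho> (\<lambda>x. \<psi> x * unram_char \<pi> w x))"
        using main by blast
      fix f :: "'k \<Rightarrow> 'c"
      assume f: "continuous_on UNIV f \<and> (\<forall>x. f x \<in> valuation_ring) \<and> (f \<longlongrightarrow> 0) at_inf \<and>
        (A.FT f \<longlongrightarrow> 0) at_inf \<and> f 0 = 0 \<and> A.FT f 0 = 0"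
      then have df: "dissipative f" by (simp add: dissipative_def)
      have adm: "dissipative f \<and> dissipative (A.FT f) \<and> f 0 = 0 \<and> A.FT f 0 = 0"
        using f df A.continuous_FT[OF df] by (simp add: dissipative_def)
      show "rigid_analytic_on {1} (T.Z f)"
        by (rule T.rigid_analytic_on_1I) (rule T.Z_has_sum[OF adm])
      show "meromorphic_eq_on {1} (T.Z f) (\<lambda>w. \<rho> (\<lambda>x. \<psi> x * unram_char \<pi> w x) * T.Zd f w)"
        using main adm by blast
      fix c :: real
      assume c: "1 \<le> c \<and> c \<in> range (vnorm :: 'c \<Rightarrow> real) \<and>
        schwartz_class \<pi> c f \<and> schwartz_class \<pi> c (A.FT f)"
      then obtain w0 :: 'c where w0: "c = vnorm w0" by blast
      show "\<exists>M. rigid_meromorphic_on {1 / c..c} M \<and> meromorphic_eq_on {1} M (T.Z f)"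
        using T.meromorphic_continuation[OF adm, of w0] c unfolding w0 by blast
    qed
  qed
qed

end
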